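(* Let $L>0$, $0<v<1$, $\phi^0\in H_0^1(\mathbf{I}_0)$ and $\phi^1\in L^2(\mathbf{I}_0)$, where $\mathbf{I}_t=(vt,L+vt)$. Let $\phi$ be the solution of $$\phi_{tt}-\phi_{xx}=0 \ \ (x\in\mathbf{I}_t,\ t>0),\qquad \phi(vt,t)=\phi(L+vt,t)=0\ \ (t>0),\qquad \phi(x,0)=\phi^0(x),\ \phi_t(x,0)=\phi^1(x)\ \ (x\in\mathbf{I}_0),$$ and let $$\mathcal{E}_v(t)=\frac12\int_{vt}^{L+vt}\left(\phi_t+v\phi_x\right)^2+(1-v^2)\phi_x^2\,dx,\qquad t\ge 0.$$ Then $$\mathcal{E}_v(t)=\frac{2\pi^2(1-v^2)}{L}\sum_{n\in\mathbb{Z}^*}|nc_n|^2\qquad\text{for all } t\ge 0,$$ where $c_n$ are the coefficients of the series representation of $\phi$ given in the context. In particular, $\mathcal{E}_v(t)$ is independent of $t$.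
   Context: Here $\mathbb{Z}^*=\mathbb{Z}\setminus\{0\}$, subscripts $t,x$ denote partial derivatives, and all data and solutions are real valued. For $0<v<1$ and the given data, "the solution" is the (known to exist) weak solution satisfying, for every $T>0$, $\phi\in C([0,T];H_0^1(\mathbf{I}_t))$ and $\phi_t\in C([0,T];L^2(\mathbf{I}_t))$. Coefficients: the solution is represented as $$\phi(x,t)=\sum_{n\in\mathbb{Z}^*}c_n\left(e^{n\pi i(1-v)(t+x)/L}-e^{n\pi i(1+v)(t-x)/L}\right),\qquad x\in\mathbf{I}_t,$$ with $$c_n=\frac{1}{4n\pi i}\int_0^{L_2}\left(\tilde\phi^0_x+\tilde\phi^1\right)e^{-n\pi i(1-v)x/L}\,dx,\qquad n\in\mathbb{Z}^*,$$ where $\gamma_v=\frac{1+v}{1-v}$, $L_2=\frac{2}{1-v}L$, and on $(0,L_2)$ the extensions of the initial data are $\tilde\phi^0_x(x)=\phi^0_x(x)$, $\tilde\phi^1(x)=\phi^1(x)$ for $x\in(0,L)$, and $\tilde\phi^0_x(x)=\frac{1}{\gamma_v}\phi^0_x\left(-\frac{x}{\gamma_v}+\frac{2L}{1+v}\right)$, $\tilde\phi^1(x)=-\frac{1}{\gamma_v}\phi^1\left(-\frac{x}{\gamma_v}+\frac{2L}{1+v}\right)$ for $x\in(L,L_2)$. *)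

theory Defs
  imports "HOL-Analysis.Analysis"
begin

section \<open>Test functions, $L^2$, $H^1$ and $H^1_0$ on an open set of reals\<close>

text \<open>Class $C^k$ on the whole space: all partial derivatives up to order $k$ exist and are
  continuous, and those of order below $k$ are (totally) differentiable.\<close>

primrec Ck :: "nat \<Rightarrow> ('a::euclidean_space \<Rightarrow> real) \<Rightarrow> bool" where
  "Ck 0 f \<longleftrightarrow> continuous_on UNIV f"
| "Ck (Suc k) f \<longleftrightarrow>
     (\<forall>x. f differentiable (at x)) \<and> (\<forall>b\<in>Basis. Ck k (\<lambda>x. frechet_derivative f (at x) b))"

definition test_functions :: "'a::euclidean_space set \<Rightarrow> ('a \<Rightarrow> real) set" where
  "test_functions S = {\<psi>. (\<forall>k. Ck k \<psi>) \<and> compact (closure {x. \<psi> x \<noteq> 0})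
     \<and> closure {x. \<psi> x \<noteq> 0} \<subseteq> S}"

text \<open>Elements of the function spaces below are representatives: membership depends only on the
  class of a function modulo equality almost everywhere on the set.\<close>

definition L2_space :: "real set \<Rightarrow> (real \<Rightarrow> real) set" where
  "L2_space S = {f. set_borel_measurable lebesgue S f \<and> set_integrable lebesgue S (\<lambda>x. (f x)\<^sup>2)}"

definition L2_dist :: "real set \<Rightarrow> (real \<Rightarrow> real) \<Rightarrow> (real \<Rightarrow> real) \<Rightarrow> real" where
  "L2_dist S f g = sqrt (LINT x:S|lebesgue. (f x - g x)\<^sup>2)"

text \<open>\<open>H1_deriv S u u'\<close>: the function \<open>u\<close> belongs to $H^1(S)$ and \<open>u'\<close> is a representative
  of its weak derivative.\<close>

definition H1_deriv :: "real set \<Rightarrow> (real \<Rightarrow> real) \<Rightarrow> (real \<Rightarrow> real) \<Rightarrow> bool" where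
  "H1_deriv S u u' \<longleftrightarrow> u \<in> L2_space S \<and> u' \<in> L2_space S \<and>
     (\<forall>\<psi>\<in>test_functions S.
        (LINT x:S|lebesgue. u x * deriv \<psi> x) = - (LINT x:S|lebesgue. u' x * \<psi> x))"

definition H10_space :: "real set \<Rightarrow> (real \<Rightarrow> real) set" where
  "H10_space S = {u. \<exists>u'. H1_deriv S u u' \<and>
     (\<exists>\<psi>::nat \<Rightarrow> real \<Rightarrow> real. (\<forall>k. \<psi> k \<in> test_functions S) \<and>
        (\<lambda>k. L2_dist S (\<psi> k) u) \<longlonglongrightarrow> 0 \<and> (\<lambda>k. L2_dist S (deriv (\<psi> k)) u') \<longlonglongrightarrow> 0)}"

section \<open>The wave equation on a moving interval\<close>

definition moving_interval :: "real \<Rightarrow> real \<Rightarrow> real \<Rightarrow> real set" where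
  "moving_interval L v t = {v * t<..<L + v * t}"

definition moving_domain :: "real \<Rightarrow> real \<Rightarrow> (real \<times> real) set" where
  "moving_domain L v = {(x, t). 0 < t \<and> x \<in> moving_interval L v t}"

text \<open>Continuity on $[0,T]$ with values in $L^2$ of the moving interval, understood through the
  translation $y \mapsto y + vt$ that carries the interval at time $0$ to the one at time $t$.\<close>

definition continuous_L2_moving ::
    "real \<Rightarrow> real \<Rightarrow> real \<Rightarrow> (real \<Rightarrow> real \<Rightarrow> real) \<Rightarrow> bool" where
  "continuous_L2_moving L v T u \<longleftrightarrow>
     (\<forall>t\<in>{0..T}. (\<lambda>x. u x t) \<in> L2_space (moving_interval L v t)) \<and>
     (\<forall>t\<in>{0..T}.
        ((\<lambda>s. L2_dist (moving_interval L v 0) (\<lambda>y. u (y + v * s) s) (\<lambda>y. u (y + v * t) t))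
           \<longlongrightarrow> 0) (at t within {0..T}))"

text \<open>Integral over the space-time domain, as an iterated integral. For the integrands used below,
  the product of a continuous $L^2$-valued curve and a test function, the inner integral is a
  continuous, compactly supported function of the time.\<close>

definition spacetime_integral :: "real \<Rightarrow> real \<Rightarrow> (real \<Rightarrow> real \<Rightarrow> real) \<Rightarrow> real" where
  "spacetime_integral L v g =
     (LINT t:{0<..}|lebesgue. (LINT x:moving_interval L v t|lebesgue. g x t))"

definition partial_x :: "(real \<times> real \<Rightarrow> real) \<Rightarrow> real \<Rightarrow> real \<Rightarrow> real" where
  "partial_x \<psi> x t = deriv (\<lambda>y. \<psi> (y, t)) x"

definition partial_t :: "(real \<times> real \<Rightarrow> real) \<Rightarrow> real \<Rightarrow> real \<Rightarrow> real" where
  "partial_t \<psi> x t = deriv (\<lambda>s. \<psi> (x, s)) t"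

text \<open>The functions \<open>\<phi>x\<close> and \<open>\<phi>t\<close> are the weak space and time derivatives of \<open>\<phi>\<close>; by the
  continuity in time they are determined by \<open>\<phi>\<close> almost everywhere on the interval at every time.
  The homogeneous boundary conditions are contained in the membership in $H^1_0$, and the equation
  holds in the weak sense, tested against smooth functions with compact support.\<close>

definition weak_wave_solution ::
    "real \<Rightarrow> real \<Rightarrow> (real \<Rightarrow> real) \<Rightarrow> (real \<Rightarrow> real) \<Rightarrow>
     (real \<Rightarrow> real \<Rightarrow> real) \<Rightarrow> (real \<Rightarrow> real \<Rightarrow> real) \<Rightarrow> (real \<Rightarrow> real \<Rightarrow> real) \<Rightarrow> bool" where
  "weak_wave_solution L v \<phi>0 \<phi>1 \<phi> \<phi>x \<phi>t \<longleftrightarrow>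
     (\<forall>t\<ge>0. (\<lambda>x. \<phi> x t) \<in> H10_space (moving_interval L v t) \<and>
             H1_deriv (moving_interval L v t) (\<lambda>x. \<phi> x t) (\<lambda>x. \<phi>x x t)) \<and>
     (\<forall>\<psi>\<in>test_functions (moving_domain L v).
        spacetime_integral L v (\<lambda>x t. \<phi> x t * partial_t \<psi> x t)
          = - spacetime_integral L v (\<lambda>x t. \<phi>t x t * \<psi> (x, t))) \<and>
     (\<forall>T>0. continuous_L2_moving L v T \<phi> \<and> continuous_L2_moving L v T \<phi>x \<and>
             continuous_L2_moving L v T \<phi>t) \<and>
     (\<forall>\<psi>\<in>test_functions (moving_domain L v).
        spacetime_integral L v
          (\<lambda>x t. \<phi>t x t * partial_t \<psi> x t - \<phi>x x t * partial_x \<psi> x t) = 0) \<and>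
     (AE x in lebesgue. x \<in> moving_interval L v 0 \<longrightarrow> \<phi> x 0 = \<phi>0 x) \<and>
     (AE x in lebesgue. x \<in> moving_interval L v 0 \<longrightarrow> \<phi>t x 0 = \<phi>1 x)"

definition energy ::
    "real \<Rightarrow> real \<Rightarrow> (real \<Rightarrow> real \<Rightarrow> real) \<Rightarrow> (real \<Rightarrow> real \<Rightarrow> real) \<Rightarrow> real \<Rightarrow> real" where
  "energy L v \<phi>x \<phi>t t = 1 / 2 *
     (LINT x:moving_interval L v t|lebesgue.
        (\<phi>t x t + v * \<phi>x x t)\<^sup>2 + (1 - v\<^sup>2) * (\<phi>x x t)\<^sup>2)"

section \<open>The coefficients of the series\<close>

definition gamma_v :: "real \<Rightarrow> real" where
  "gamma_v v = (1 + v) / (1 - v)"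

text \<open>Extensions from $(0,L)$ to $(0,2L/(1-v))$ of the derivative of the initial position and of
  the initial velocity. The value at the single point $L$ is irrelevant.\<close>

definition ext_position_deriv :: "real \<Rightarrow> real \<Rightarrow> (real \<Rightarrow> real) \<Rightarrow> real \<Rightarrow> real" where
  "ext_position_deriv L v \<phi>0x x =
     (if x < L then \<phi>0x x
      else 1 / gamma_v v * \<phi>0x (- x / gamma_v v + 2 * L / (1 + v)))"

definition ext_velocity :: "real \<Rightarrow> real \<Rightarrow> (real \<Rightarrow> real) \<Rightarrow> real \<Rightarrow> real" where
  "ext_velocity L v \<phi>1 x =
     (if x < L then \<phi>1 x
      else - (1 / gamma_v v) * \<phi>1 (- x / gamma_v v + 2 * L / (1 + v)))"

definition series_coeff ::
    "real \<Rightarrow> real \<Rightarrow> (real \<Rightarrow> real) \<Rightarrow> (real \<Rightarrow> real) \<Rightarrow> int \<Rightarrow> complex" where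
  "series_coeff L v \<phi>0x \<phi>1 n =
     1 / (4 * of_int n * of_real pi * \<i>) *
     (LINT x:{0<..<2 / (1 - v) * L}|lebesgue.
        of_real (ext_position_deriv L v \<phi>0x x + ext_velocity L v \<phi>1 x) *
        exp (- (of_int n * of_real pi * \<i> * of_real (1 - v) * of_real x / of_real L)))"

end

theory Submission
  imports Defs
begin

text \<open>
Split a solution into its travelling components \<open>\<phi>\<^sub>t + \<phi>\<^sub>x\<close> and \<open>\<phi>\<^sub>t - \<phi>\<^sub>x\<close>. At any fixed time, in the
moving frame \<open>y = x - v t\<close>, they are two $L^2$ functions on \<open>(0, L)\<close>. Reflecting the second one at the
end point \<open>L\<close> and stretching it by the factor \<open>\<gamma>\<close> produces a single function \<open>h\<close> on a period of length
\<open>P = 2 L / (1 - v)\<close>, by the same formula that extends the initial data. In these variables the energy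
is diagonal: it equals \<open>(1 + v) / 4\<close> times the square norm of \<open>h\<close> (\<open>energy_extension\<close>). Parseval's
identity (\<open>parseval\<close>) turns it into a sum of \<open>\<bar>n c\<^sub>n\<bar>\<^sup>2\<close> over \<open>n \<noteq> 0\<close>, where \<open>c\<^sub>n\<close> is computed from the
data at time \<open>t\<close>; the coefficient of index \<open>0\<close> is the mean of \<open>\<phi>\<^sub>x\<close>, which vanishes by the boundary
conditions (\<open>energy_parseval\<close>).

It remains to see that \<open>\<bar>c\<^sub>n\<bar>\<close> does not depend on time. Let \<open>\<psi>\<close> be a smooth solution of the same
problem, a difference of a left- and a right-going wave with frequencies in the ratio \<open>(1 - v) : (1 + v)\<close>,
and let \<open>S\<close> be the corresponding sum. Two solutions have the conserved quantity
\<open>\<integral> \<phi>\<^sub>t \<psi> - \<phi> \<psi>\<^sub>t\<close>; since \<open>\<psi>\<^sub>t = S\<^sub>x\<close>, it equals \<open>\<integral> \<phi>\<^sub>t \<psi> + \<phi>\<^sub>x S\<close> (\<open>conserved_quantity\<close>). For all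
phases of \<open>\<psi>\<close> together, these quantities amount to the \<open>n\<close>-th Fourier coefficient of the extended data,
up to a unimodular factor that depends on time (\<open>fourier_coeff_modulus_conserved\<close>).

As \<open>\<phi>\<close> is only a weak solution, conservation is proved by testing the weak equations with \<open>\<psi>\<close> and
\<open>\<psi>\<^sub>t\<close>, multiplied by a cutoff near the moving boundary and by a function of time. When the cutoff is
removed, the boundary layer in the wave equation disappears because \<open>\<psi>\<close> vanishes linearly at the
boundary (\<open>wave_equation_tested\<close>); the one in the equation for the time derivative is first rewritten by
means of the weak space derivative (\<open>time_derivative_tested\<close>). A continuous function of time with
vanishing weak derivative is constant (\<open>weakly_constant\<close>).
\<close>

section \<open>Smooth functions and a smooth step\<close>

lemma Ck_SucI:
  fixes f :: "'a::euclidean_space \<Rightarrow> real"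
  assumes "\<And>x. (f has_derivative D x) (at x)" "\<And>b. b \<in> Basis \<Longrightarrow> Ck k (\<lambda>x. D x b)"
  shows "Ck (Suc k) f"
proof -
  have "frechet_derivative f (at x) = D x" for x
    using frechet_derivative_at[OF assms(1)] by simp
  then show ?thesis
    using assms by (auto simp: differentiable_def)
qed

lemma Ck_SucD:
  fixes f :: "'a::euclidean_space \<Rightarrow> real"
  assumes "Ck (Suc k) f"
  shows "(f has_derivative frechet_derivative f (at x)) (at x)"
    and "b \<in> Basis \<Longrightarrow> Ck k (\<lambda>x. frechet_derivative f (at x) b)"
  using assms by (auto simp: frechet_derivative_works)

lemma Ck_decrease:
  fixes f :: "'a::euclidean_space \<Rightarrow> real"
  shows "Ck (Suc k) f \<Longrightarrow> Ck k f"
proof (induction k arbitrary: f)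
  case 0
  then show ?case
    by (auto intro!: differentiable_imp_continuous_on simp: differentiable_on_def)
next
  case (Suc k)
  show ?case
    by (rule Ck_SucI[OF Ck_SucD(1)[OF Suc.prems]]) (use Suc.IH Ck_SucD(2)[OF Suc.prems] in blast)
qed

lemma Ck_imp_continuous:
  fixes f :: "'a::euclidean_space \<Rightarrow> real"
  shows "Ck k f \<Longrightarrow> continuous_on UNIV f"
proof (induction k)
  case (Suc k)
  from Suc.IH[OF Ck_decrease[OF Suc.prems]] show ?case .
qed simp

lemma Ck_const: "Ck k (\<lambda>x::'a::euclidean_space. c)"
proof (induction k arbitrary: c)
  case (Suc k)
  show ?case
    by (rule Ck_SucI[of _ "\<lambda>x h. 0"]) (use Suc in auto)
qed auto

lemma Ck_add:
  fixes f g :: "'a::euclidean_space \<Rightarrow> real"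
  shows "Ck k f \<Longrightarrow> Ck k g \<Longrightarrow> Ck k (\<lambda>x. f x + g x)"
proof (induction k arbitrary: f g)
  case (Suc k)
  show ?case
    by (rule Ck_SucI[OF has_derivative_add[OF Ck_SucD(1)[OF Suc.prems(1)] Ck_SucD(1)[OF Suc.prems(2)]]])
       (use Suc.IH Ck_SucD(2)[OF Suc.prems(1)] Ck_SucD(2)[OF Suc.prems(2)] in blast)
qed (auto intro!: continuous_intros)

lemma Ck_mult:
  fixes f g :: "'a::euclidean_space \<Rightarrow> real"
  shows "Ck k f \<Longrightarrow> Ck k g \<Longrightarrow> Ck k (\<lambda>x. f x * g x)"
proof (induction k arbitrary: f g)
  case (Suc k)
  show ?case
    by (rule Ck_SucI[OF has_derivative_mult[OF Ck_SucD(1)[OF Suc.prems(1)] Ck_SucD(1)[OF Suc.prems(2)]]])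
       (intro Ck_add Suc.IH Ck_SucD(2)[OF Suc.prems(1)] Ck_SucD(2)[OF Suc.prems(2)]
          Ck_decrease[OF Suc.prems(1)] Ck_decrease[OF Suc.prems(2)])
qed (auto intro!: continuous_intros)

lemma Ck_diff:
  fixes f g :: "'a::euclidean_space \<Rightarrow> real"
  assumes "Ck k f" "Ck k g"
  shows "Ck k (\<lambda>x. f x - g x)"
  using Ck_add[OF assms(1) Ck_mult[OF Ck_const[of k "-1"] assms(2)]] by simp

lemma Ck_SucI_real:
  fixes f :: "real \<Rightarrow> real"
  assumes "\<And>x. (f has_real_derivative f' x) (at x)" "Ck k f'"
  shows "Ck (Suc k) f"
  by (rule Ck_SucI[of _ "\<lambda>x h. f' x * h"]) (use assms in \<open>auto simp: has_field_derivative_def\<close>)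

lemma Ck_SucD_real:
  fixes f :: "real \<Rightarrow> real"
  assumes "Ck (Suc k) f"
  shows "(f has_real_derivative deriv f x) (at x)" "Ck k (deriv f)"
proof -
  show *: "(f has_real_derivative deriv f x) (at x)" for x
    using assms by (simp add: DERIV_deriv_iff_real_differentiable)
  have "frechet_derivative f (at x) 1 = deriv f x" for x
    using frechet_derivative_at[OF *[of x, unfolded has_field_derivative_def]] by (metis mult.right_neutral)
  then show "Ck k (deriv f)"
    using Ck_SucD(2)[OF assms, of 1] by simp
qed

lemma Ck_affine_compose:
  fixes f :: "real \<Rightarrow> real" and l :: "'a::euclidean_space \<Rightarrow> real"
  assumes l: "bounded_linear l"
  shows "Ck k f \<Longrightarrow> Ck k (\<lambda>x. f (l x + c))"
proof (induction k arbitrary: f)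
  case 0
  have "continuous_on UNIV l"
    by (simp add: l linear_continuous_on)
  then show ?case
    using 0 by (auto intro!: continuous_on_compose2[of UNIV f] continuous_intros)
next
  case (Suc k)
  have 1: "((\<lambda>x. f (l x + c)) has_derivative (\<lambda>h. deriv f (l x + c) * l h)) (at x)" for x
  proof -
    have "((\<lambda>x. l x + c) has_derivative l) (at x)"
      by (intro has_derivative_add_const bounded_linear_imp_has_derivative l)
    from has_derivative_compose[OF this, of f "\<lambda>h. deriv f (l x + c) * h"]
    show ?thesis
      using Ck_SucD_real(1)[OF Suc.prems] by (simp add: has_field_derivative_def)
  qed
  show ?case
    by (rule Ck_SucI[OF 1]) (intro Ck_mult Ck_const Suc.IH Ck_SucD_real(2)[OF Suc.prems])
qed

lemma Ck_cos: "Ck k (\<lambda>s::real. cos (s + c))"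
proof (induction k arbitrary: c)
  case (Suc k)
  have "((\<lambda>s. cos (s + c)) has_real_derivative cos (x + (c + pi / 2))) (at x)" for x
    by (auto intro!: derivative_eq_intros simp: cos_add sin_add)
  then show ?case
    by (rule Ck_SucI_real) (rule Suc)
qed (auto intro!: continuous_intros)

lemma Ck_cos_affine:
  fixes l :: "'a::euclidean_space \<Rightarrow> real"
  assumes "bounded_linear l"
  shows "Ck k (\<lambda>x. cos (l x + c))"
  using Ck_affine_compose[OF assms Ck_cos[of k 0], of c] by simp

text \<open>The derivative of \<open>1 / f\<close> is \<open>- f' / f\<^sup>2\<close>, a product of factors that the induction hypothesis
already covers.\<close>

lemma Ck_inverse:
  fixes f :: "'a::euclidean_space \<Rightarrow> real"
  assumes nz: "\<And>x. f x \<noteq> 0"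
  shows "Ck k f \<Longrightarrow> Ck k (\<lambda>x. inverse (f x))"
proof (induction k)
  case 0
  then show ?case
    using nz by (auto intro!: continuous_intros)
next
  case (Suc k)
  show ?case
    by (rule Ck_SucI[OF Deriv.has_derivative_inverse[OF nz Ck_SucD(1)[OF Suc.prems]]])
      (use Ck_mult[OF Ck_const[of k "-1"] Ck_mult[OF Ck_mult[OF Suc.IH[OF Ck_decrease[OF Suc.prems]] Ck_SucD(2)[OF Suc.prems]]
           Suc.IH[OF Ck_decrease[OF Suc.prems]]]] in simp)
qed

text \<open>The functions \<open>x\<^sup>-\<^sup>n exp (- 1 / x)\<close>, extended by zero to the left. Differentiation maps each of them
to a combination of two others, so that all of them are smooth by one induction on the order of
differentiability.\<close>

definition flat :: "nat \<Rightarrow> real \<Rightarrow> real" where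
  "flat n x = (if x > 0 then exp (- inverse x) * inverse x ^ n else 0)"

lemma flat_tendsto_0: "(flat n \<longlongrightarrow> 0) (at 0)"
proof -
  have "((\<lambda>y::real. y ^ n / exp y) \<longlongrightarrow> 0) at_top"
    by (rule tendsto_power_div_exp_0)
  from filterlim_compose[OF this filterlim_inverse_at_top_right]
  have "((\<lambda>x::real. inverse x ^ n / exp (inverse x)) \<longlongrightarrow> 0) (at_right 0)" .
  then have "(flat n \<longlongrightarrow> 0) (at_right 0)"
    by (rule Lim_transform_eventually)
       (auto simp: eventually_at_right_less flat_def exp_minus field_simps
          intro!: eventually_mono[OF eventually_at_right_less[of "0::real"]])
  moreover have "(flat n \<longlongrightarrow> 0) (at_left 0)"
    by (rule Lim_transform_eventually[of "\<lambda>_. 0"])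
       (auto simp: flat_def intro!: eventually_mono[OF eventually_at_left_real[of "-1" 0]])
  ultimately show ?thesis
    by (simp add: filterlim_split_at)
qed

lemma flat_has_derivative:
  "(flat n has_real_derivative flat (n + 2) x - real n * flat (n + 1) x) (at x)"
proof -
  consider "x > 0" | "x < 0" | "x = 0" by linarith
  then show ?thesis
  proof cases
    case 1
    have "((\<lambda>x. inverse x ^ n) has_real_derivative real n * (- (inverse x * inverse x) * inverse x ^ (n - 1))) (at x)"
      using 1 by (auto intro!: derivative_eq_intros simp: power2_eq_square)
    also have "real n * (- (inverse x * inverse x) * inverse x ^ (n - 1)) = - real n * inverse x ^ (n + 1)"
      by (cases n) (auto simp: algebra_simps)
    finally have d: "((\<lambda>x. inverse x ^ n) has_real_derivative - real n * inverse x ^ (n + 1)) (at x)" .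
    have "((\<lambda>x. exp (- inverse x)) has_real_derivative exp (- inverse x) * (inverse x * inverse x)) (at x)"
      using 1 by (auto intro!: derivative_eq_intros simp: power2_eq_square)
    from DERIV_mult[OF this d]
    have "((\<lambda>x. exp (- inverse x) * inverse x ^ n) has_real_derivative
        flat (n + 2) x - real n * flat (n + 1) x) (at x)"
      using 1 by (simp add: flat_def algebra_simps)
    then show ?thesis
      by (rule has_field_derivative_transform_within_open[of _ _ _ "{0<..}"]) (use 1 in \<open>auto simp: flat_def\<close>)
  next
    case 2
    have "((\<lambda>x. 0) has_real_derivative flat (n + 2) x - real n * flat (n + 1) x) (at x)"
      using 2 by (simp add: flat_def)
    then show ?thesis
      by (rule has_field_derivative_transform_within_open[of _ _ _ "{..<0}"]) (use 2 in \<open>auto simp: flat_def\<close>)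
  next
    case 3
    have "((\<lambda>h. (flat n (0 + h) - flat n 0) / h) \<longlongrightarrow> 0) (at 0)"
      by (rule Lim_transform_eventually[OF flat_tendsto_0[of "Suc n"]])
         (auto simp: flat_def field_simps eventually_at_filter)
    then show ?thesis
      using 3 by (simp add: DERIV_def flat_def)
  qed
qed

lemma Ck_flat: "Ck k (flat n)"
proof (induction k arbitrary: n)
  case 0
  show ?case
    using flat_has_derivative by (auto simp: continuous_on_eq_continuous_at intro: DERIV_isCont)
next
  case (Suc k)
  show ?case
    by (rule Ck_SucI_real[OF flat_has_derivative])
       (intro Ck_diff Ck_mult Ck_const Suc)
qed

text \<open>A smooth passage from \<open>0\<close> (left of \<open>0\<close>) to \<open>1\<close> (right of \<open>1\<close>). Spatial cutoffs, test functions of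
time and, through its derivative, a mollifier are all built from it.\<close>

definition smooth_step :: "real \<Rightarrow> real" where
  "smooth_step x = flat 0 x * inverse (flat 0 x + flat 0 (1 - x))"

lemma flat_sum_pos: "flat 0 x + flat 0 (1 - x) > 0"
  by (auto simp: flat_def intro: add_pos_pos)

lemma Ck_smooth_step: "Ck k smooth_step"
proof -
  have "Ck k (\<lambda>x. flat 0 (1 - x))"
    using Ck_affine_compose[OF bounded_linear_minus[OF bounded_linear_ident] Ck_flat, of k 0 1] by simp
  then have "Ck k (\<lambda>x. flat 0 x + flat 0 (1 - x))"
    by (intro Ck_add Ck_flat)
  then have "Ck k (\<lambda>x. inverse (flat 0 x + flat 0 (1 - x)))"
    by (rule Ck_inverse[rotated]) (use flat_sum_pos in \<open>simp add: less_imp_neq[THEN not_sym]\<close>)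
  from Ck_mult[OF Ck_flat[of k 0] this]
  show ?thesis by (simp add: smooth_step_def [abs_def])
qed

lemma smooth_step_eq_0: "x \<le> 0 \<Longrightarrow> smooth_step x = 0"
  and smooth_step_eq_1: "x \<ge> 1 \<Longrightarrow> smooth_step x = 1"
  by (auto simp: smooth_step_def flat_def)

lemma smooth_step_bounds: "0 \<le> smooth_step x" "smooth_step x \<le> 1"
proof -
  have "smooth_step x = flat 0 x / (flat 0 x + flat 0 (1 - x))"
    by (simp add: smooth_step_def field_simps)
  moreover have "flat 0 x \<ge> 0" "flat 0 (1 - x) \<ge> 0"
    by (auto simp: flat_def)
  ultimately show "0 \<le> smooth_step x" "smooth_step x \<le> 1"
    using flat_sum_pos[of x] by (auto simp: divide_le_eq)
qed

abbreviation "bump \<equiv> deriv smooth_step"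

lemma smooth_step_deriv [derivative_intros]:
  "(f has_real_derivative f') (at x) \<Longrightarrow>
   ((\<lambda>x. smooth_step (f x)) has_real_derivative bump (f x) * f') (at x)"
  using DERIV_chain2[OF Ck_SucD_real(1)[OF Ck_smooth_step]] by blast

lemma Ck_bump: "Ck k bump"
  by (rule Ck_SucD_real(2)[OF Ck_smooth_step])

text \<open>At the end points of the unit interval a one-sided derivative decides, because the step is constant
on one side.\<close>

lemma bump_eq_0:
  assumes "x \<le> 0 \<or> x \<ge> 1"
  shows "bump x = 0"
proof -
  have *: "(smooth_step has_real_derivative bump x) (at x within S)" for S
    using Ck_SucD_real(1)[OF Ck_smooth_step] by (rule has_field_derivative_at_within)
  show ?thesis
    using assms
  proof
    assume x: "x \<le> 0"
    have "(smooth_step has_real_derivative 0) (at x within {..x})"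
      by (rule has_field_derivative_transform_within[of "\<lambda>_. 0" _ _ _ 1])
         (use x in \<open>auto simp: smooth_step_eq_0\<close>)
    moreover have "at x within {..x} \<noteq> bot"
      using trivial_limit_at_left_real[of x] by (auto simp: at_within_Iic_at_left)
    ultimately show ?thesis
      using * by (auto dest: has_field_derivative_unique)
  next
    assume x: "x \<ge> 1"
    have "(smooth_step has_real_derivative 0) (at x within {x..})"
      by (rule has_field_derivative_transform_within[of "\<lambda>_. 1" _ _ _ 1])
         (use x in \<open>auto simp: smooth_step_eq_1\<close>)
    moreover have "at x within {x..} \<noteq> bot"
      using trivial_limit_at_right_real[of x] by (auto simp: at_within_Ici_at_right)
    ultimately show ?thesis
      using * by (auto dest: has_field_derivative_unique)
  qed
qed

lemma bump_bounded: obtains M where "M > 0" "\<And>x. \<bar>bump x\<bar> \<le> M"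
proof -
  have "compact (bump ` {0..1})"
    by (intro compact_continuous_image continuous_on_subset[OF Ck_imp_continuous[OF Ck_bump[of 0]]]) auto
  from compact_imp_bounded[OF this] obtain M where "M > 0" "\<forall>y\<in>bump ` {0..1}. norm y \<le> M"
    unfolding bounded_pos by blast
  then have M: "\<And>x. x \<in> {0..1} \<Longrightarrow> \<bar>bump x\<bar> \<le> M" "M > 0"
    by auto
  have "\<bar>bump x\<bar> \<le> M" for x
    using M(1)[of x] M(2) bump_eq_0[of x] by (cases "x \<in> {0..1}") auto
  with M(2) that show thesis by blast
qed

lemma test_functionsI:
  assumes "\<And>k. Ck k \<psi>" "compact K" "K \<subseteq> S" "\<And>x. \<psi> x \<noteq> 0 \<Longrightarrow> x \<in> K"
  shows "\<psi> \<in> test_functions S"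
proof -
  have "closure {x. \<psi> x \<noteq> 0} \<subseteq> K"
    using assms by (intro closure_minimal) (auto simp: compact_imp_closed)
  then show ?thesis
    using assms by (auto simp: test_functions_def compact_closure intro: bounded_subset compact_imp_bounded)
qed

section \<open>Square-integrable functions\<close>

lemma continuous_imp_lebesgue_measurable:
  fixes g :: "real \<Rightarrow> 'b::euclidean_space"
  assumes "continuous_on UNIV g"
  shows "g \<in> borel_measurable lebesgue"
  by (rule measurable_completion) (use borel_measurable_continuous_onI[OF assms] in simp)

lemma set_measurable_mult:
  fixes f g :: "real \<Rightarrow> real"
  assumes "set_borel_measurable M S f" "set_borel_measurable M S g"
  shows "set_borel_measurable M S (\<lambda>x. f x * g x)"
proof -
  have "(\<lambda>x. (indicator S x *\<^sub>R f x) * (indicator S x *\<^sub>R g x)) \<in> borel_measurable M"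
    using assms unfolding set_borel_measurable_def by (rule borel_measurable_times)
  moreover have "(indicator S x *\<^sub>R f x) * (indicator S x *\<^sub>R g x) = indicator S x *\<^sub>R (f x * g x)" for x
    by (simp add: indicator_def)
  ultimately show ?thesis
    unfolding set_borel_measurable_def by (simp only:)
qed

lemma set_measurable_add:
  fixes f g :: "real \<Rightarrow> real"
  assumes "set_borel_measurable M S f" "set_borel_measurable M S g"
  shows "set_borel_measurable M S (\<lambda>x. f x + g x)"
  using borel_measurable_add[OF assms[unfolded set_borel_measurable_def]]
  unfolding set_borel_measurable_def by (simp only: scaleR_add_right)

lemma L2_mult_integrable:
  assumes f: "f \<in> L2_space S" and g: "g \<in> L2_space S"
  shows "set_integrable lebesgue S (\<lambda>x. f x * g x)"
proof -
  have "set_integrable lebesgue S (\<lambda>x. (f x)\<^sup>2 + (g x)\<^sup>2)"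
    using f g by (intro set_integral_add) (auto simp: L2_space_def)
  then show ?thesis
  proof (rule set_integrable_bound)
    show "set_borel_measurable lebesgue S (\<lambda>x. f x * g x)"
      using f g by (intro set_measurable_mult) (auto simp: L2_space_def)
    have "\<bar>f x * g x\<bar> \<le> (f x)\<^sup>2 + (g x)\<^sup>2" for x
    proof -
      have "2 * (\<bar>f x\<bar> * \<bar>g x\<bar>) \<le> (f x)\<^sup>2 + (g x)\<^sup>2"
        using sum_squares_bound[of "\<bar>f x\<bar>" "\<bar>g x\<bar>"] by (simp add: mult.assoc)
      moreover have "0 \<le> \<bar>f x\<bar> * \<bar>g x\<bar>"
        by simp
      ultimately show ?thesis
        unfolding abs_mult by linarith
    qed
    then show "AE x in lebesgue. x \<in> S \<longrightarrow> norm (f x * g x) \<le> norm ((f x)\<^sup>2 + (g x)\<^sup>2)"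
      by (auto intro!: AE_I2 order_trans[OF _ abs_ge_self])
  qed
qed

lemma L2_add:
  assumes f: "f \<in> L2_space S" and g: "g \<in> L2_space S"
  shows "(\<lambda>x. f x + g x) \<in> L2_space S"
proof -
  have "set_integrable lebesgue S (\<lambda>x. (f x)\<^sup>2 + (g x)\<^sup>2 + 2 * (f x * g x))"
    using f g by (intro set_integral_add set_integrable_mult_right L2_mult_integrable)
      (auto simp: L2_space_def)
  then show ?thesis
    using f g by (auto simp: L2_space_def power2_sum algebra_simps set_measurable_add)
qed

lemma L2_cmult:
  assumes f: "f \<in> L2_space S"
  shows "(\<lambda>x. c * f x) \<in> L2_space S"
proof -
  have "(\<lambda>x. c * (indicator S x *\<^sub>R f x)) \<in> borel_measurable lebesgue"
    using f by (intro borel_measurable_times borel_measurable_const) (simp add: L2_space_def set_borel_measurable_def)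
  then have "set_borel_measurable lebesgue S (\<lambda>x. c * f x)"
    by (simp add: set_borel_measurable_def mult.left_commute)
  then show ?thesis
    using f by (auto simp: L2_space_def power_mult_distrib)
qed

lemma L2_diff:
  assumes "f \<in> L2_space S" "g \<in> L2_space S"
  shows "(\<lambda>x. f x - g x) \<in> L2_space S"
  using L2_add[OF assms(1) L2_cmult[OF assms(2), of "-1"]] by simp

lemma L2_bounded:
  assumes S: "S \<in> lmeasurable" and g: "set_borel_measurable lebesgue S g" and C: "\<And>x. x \<in> S \<Longrightarrow> \<bar>g x\<bar> \<le> C"
  shows "g \<in> L2_space S"
proof -
  have "set_integrable lebesgue S (\<lambda>x. C\<^sup>2)"
    using S by (auto simp: set_integrable_def fmeasurable_def)
  then have "set_integrable lebesgue S (\<lambda>x. (g x)\<^sup>2)"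
  proof (rule set_integrable_bound)
    show "set_borel_measurable lebesgue S (\<lambda>x. (g x)\<^sup>2)"
      using set_measurable_mult[OF g g] by (simp add: power2_eq_square)
    show "AE x in lebesgue. x \<in> S \<longrightarrow> norm ((g x)\<^sup>2) \<le> norm (C\<^sup>2)"
      using C by (auto intro!: AE_I2) (metis abs_le_square_iff abs_ge_self order_trans)
  qed
  with g show ?thesis
    by (simp add: L2_space_def)
qed

lemma measurable_imp_set_measurable:
  fixes g :: "real \<Rightarrow> 'b::euclidean_space"
  assumes "g \<in> borel_measurable lebesgue" "S \<in> sets lebesgue"
  shows "set_borel_measurable lebesgue S g"
  unfolding set_borel_measurable_def by (intro borel_measurable_scaleR borel_measurable_indicator assms)

lemma L2_bounded_mult_integrable:
  assumes "S \<in> lmeasurable" "f \<in> L2_space S" "set_borel_measurable lebesgue S g" "\<And>x. x \<in> S \<Longrightarrow> \<bar>g x\<bar> \<le> C"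
  shows "set_integrable lebesgue S (\<lambda>x. f x * g x)"
  by (rule L2_mult_integrable[OF assms(2) L2_bounded[OF assms(1,3,4)]])

lemma L2_Cauchy_Schwarz:
  assumes f: "f \<in> L2_space S" and g: "g \<in> L2_space S"
  shows "(LINT x:S|lebesgue. f x * g x)\<^sup>2 \<le> (LINT x:S|lebesgue. (f x)\<^sup>2) * (LINT x:S|lebesgue. (g x)\<^sup>2)"
proof -
  let ?A = "LINT x:S|lebesgue. (f x)\<^sup>2" and ?B = "LINT x:S|lebesgue. (g x)\<^sup>2"
    and ?D = "LINT x:S|lebesgue. f x * g x"
  note [simp] = L2_mult_integrable[OF f g]
  have ff [simp]: "set_integrable lebesgue S (\<lambda>x. (f x)\<^sup>2)" and gg [simp]: "set_integrable lebesgue S (\<lambda>x. (g x)\<^sup>2)"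
    using f g by (auto simp: L2_space_def)
  have pos: "0 \<le> r\<^sup>2 * ?A + s\<^sup>2 * ?B + 2 * r * s * ?D" for r s
  proof -
    have "0 \<le> (LINT x:S|lebesgue. (r * f x + s * g x)\<^sup>2)"
      by (auto simp: set_lebesgue_integral_def intro!: integral_nonneg_AE)
    also have "\<dots> = (LINT x:S|lebesgue. r\<^sup>2 * (f x)\<^sup>2 + s\<^sup>2 * (g x)\<^sup>2 + 2 * r * s * (f x * g x))"
      by (intro arg_cong[where f = "set_lebesgue_integral lebesgue S"]) (auto simp: power2_sum power_mult_distrib)
    also have "\<dots> = r\<^sup>2 * ?A + s\<^sup>2 * ?B + 2 * r * s * ?D"
      by (subst set_integral_add, simp, simp)+ simp
    finally show ?thesis .
  qed
  have A: "?A \<ge> 0" and B: "?B \<ge> 0"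
    using pos[of 1 0] pos[of 0 1] by auto
  show ?thesis
  proof (cases "?B = 0")
    case True
    have "?D = 0"
    proof (rule ccontr)
      assume "?D \<noteq> 0"
      with pos[of 1 "- (?A + 1) / (2 * ?D)"] True show False
        by (simp add: field_simps)
    qed
    with True show ?thesis by simp
  next
    case False
    have "0 \<le> ?B * (?A * ?B - ?D\<^sup>2)"
      using pos[of ?B "- ?D"] by (simp add: algebra_simps power2_eq_square)
    with False B show ?thesis
      by (simp add: zero_le_mult_iff)
  qed
qed

lemma set_integral_const_lmeasurable:
  fixes c :: real
  shows "S \<in> lmeasurable \<Longrightarrow> set_integrable lebesgue S (\<lambda>x. c)"
    and "S \<in> lmeasurable \<Longrightarrow> (LINT x:S|lebesgue. c) = c * measure lebesgue S"
  by (auto simp: set_integrable_def set_lebesgue_integral_def fmeasurable_def less_top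
      intro!: integrable_real_indicator)

text \<open>The continuity statement behind the limits in the weak equations: strong $L^2$ convergence of one factor and bounded
pointwise convergence of the other suffice for convergence of the integral of the product. The first
half of the difference is controlled by Cauchy-Schwarz, the second by dominated convergence.\<close>

lemma L2_pairing_tendsto:
  assumes S: "S \<in> lmeasurable"
    and f: "\<And>n. f n \<in> L2_space S" "f' \<in> L2_space S" "(\<lambda>n. L2_dist S (f n) f') \<longlonglongrightarrow> 0"
    and g: "\<And>n. set_borel_measurable lebesgue S (g n)" "set_borel_measurable lebesgue S g'"
      "\<And>n x. x \<in> S \<Longrightarrow> \<bar>g n x\<bar> \<le> C" "\<And>x. x \<in> S \<Longrightarrow> (\<lambda>n. g n x) \<longlonglongrightarrow> g' x"
  shows "(\<lambda>n. LINT x:S|lebesgue. f n x * g n x) \<longlonglongrightarrow> (LINT x:S|lebesgue. f' x * g' x)"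
proof -
  have int1: "set_integrable lebesgue S (\<lambda>x. (f n x - f' x) * g n x)" for n
    by (intro L2_bounded_mult_integrable[OF S L2_diff] f g) (use g in auto)
  have int2: "set_integrable lebesgue S (\<lambda>x. f' x * g n x)" for n
    by (intro L2_bounded_mult_integrable[OF S] f g) (use g in auto)
  have gL2: "g n \<in> L2_space S" for n
    by (rule L2_bounded[OF S g(1) g(3)])
  have split: "(LINT x:S|lebesgue. f n x * g n x) =
      (LINT x:S|lebesgue. (f n x - f' x) * g n x) + (LINT x:S|lebesgue. f' x * g n x)" for n
    by (subst set_integral_add(2)[symmetric, OF int1 int2]) (simp add: algebra_simps)
  have bound: "\<bar>LINT x:S|lebesgue. (f n x - f' x) * g n x\<bar> \<le> L2_dist S (f n) f' * sqrt (C\<^sup>2 * measure lebesgue S)" for n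
  proof -
    have "(LINT x:S|lebesgue. (g n x)\<^sup>2) \<le> (LINT x:S|lebesgue. C\<^sup>2)"
    proof (rule set_integral_mono)
      show "set_integrable lebesgue S (\<lambda>x. (g n x)\<^sup>2)"
        using gL2 by (simp add: L2_space_def)
      show "set_integrable lebesgue S (\<lambda>x. C\<^sup>2)"
        using S by (auto simp: set_integrable_def fmeasurable_def)
    qed (use g(3) in \<open>metis abs_le_square_iff abs_ge_self order_trans\<close>)
    also have "\<dots> = C\<^sup>2 * measure lebesgue S"
      by (rule set_integral_const_lmeasurable(2)[OF S])
    finally have "(LINT x:S|lebesgue. (f n x - f' x) * g n x)\<^sup>2
       \<le> (LINT x:S|lebesgue. (f n x - f' x)\<^sup>2) * (C\<^sup>2 * measure lebesgue S)"
      by (intro order_trans[OF L2_Cauchy_Schwarz[OF L2_diff[OF f(1) f(2)] gL2]] mult_left_mono)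
         (auto simp: set_lebesgue_integral_def intro!: integral_nonneg_AE)
    from real_sqrt_le_mono[OF this] show ?thesis
      by (simp add: L2_dist_def real_sqrt_mult)
  qed
  have "(\<lambda>n. LINT x:S|lebesgue. (f n x - f' x) * g n x) \<longlonglongrightarrow> 0"
    by (rule Lim_null_comparison[OF _ tendsto_mult_left_zero[OF f(3), of "sqrt (C\<^sup>2 * measure lebesgue S)"]])
       (use bound in auto)
  moreover have "(\<lambda>n. LINT x:S|lebesgue. f' x * g n x) \<longlonglongrightarrow> (LINT x:S|lebesgue. f' x * g' x)"
    unfolding set_lebesgue_integral_def
  proof (rule integral_dominated_convergence)
    have "set_integrable lebesgue S (\<lambda>x. f' x * C)"
      by (rule L2_bounded_mult_integrable[OF S f(2), of _ "\<bar>C\<bar>"])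
        (use S in \<open>auto simp: set_borel_measurable_def\<close>)
    then show "integrable lebesgue (\<lambda>x. norm (indicator S x *\<^sub>R (f' x * C)))"
      unfolding set_integrable_def by (rule integrable_norm)
    show "(\<lambda>x. indicator S x *\<^sub>R (f' x * g n x)) \<in> borel_measurable lebesgue" for n
      using int2[of n] by (auto simp: set_integrable_def)
    show "(\<lambda>x. indicator S x *\<^sub>R (f' x * g' x)) \<in> borel_measurable lebesgue"
      using set_measurable_mult[OF _ g(2), of f'] f(2) by (auto simp: L2_space_def set_borel_measurable_def)
    show "AE x in lebesgue. norm (indicator S x *\<^sub>R (f' x * g n x)) \<le> norm (indicator S x *\<^sub>R (f' x * C))" for n
    proof (rule AE_I2)
      fix x
      show "norm (indicator S x *\<^sub>R (f' x * g n x)) \<le> norm (indicator S x *\<^sub>R (f' x * C))"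
      proof (cases "x \<in> S")
        case True
        then have "\<bar>g n x\<bar> \<le> \<bar>C\<bar>"
          using g(3)[of x n] by simp
        with True show ?thesis
          by (simp add: abs_mult mult_left_mono)
      qed simp
    qed
    show "AE x in lebesgue. (\<lambda>n. indicator S x *\<^sub>R (f' x * g n x)) \<longlonglongrightarrow> indicator S x *\<^sub>R (f' x * g' x)"
      using g(4) by (auto intro!: AE_I2 tendsto_intros simp: indicator_def)
  qed
  ultimately show ?thesis
    unfolding split using tendsto_add by fastforce
qed

lemma L2_dist_same [simp]: "L2_dist S f f = 0"
  by (simp add: L2_dist_def)

section \<open>Cutoffs near the end points of an interval\<close>

text \<open>Equal to \<open>1\<close> at distance at least \<open>2 / (k + 1)\<close> from the end points of \<open>(0, L)\<close> and to \<open>0\<close> at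
distance at most \<open>1 / (k + 1)\<close>.\<close>

definition cutoff :: "real \<Rightarrow> nat \<Rightarrow> real \<Rightarrow> real" where
  "cutoff L k y = smooth_step (real (Suc k) * y - 1) * smooth_step (real (Suc k) * (L - y) - 1)"

definition cutoff_deriv :: "real \<Rightarrow> nat \<Rightarrow> real \<Rightarrow> real" where
  "cutoff_deriv L k y = real (Suc k) *
     (bump (real (Suc k) * y - 1) * smooth_step (real (Suc k) * (L - y) - 1) -
      smooth_step (real (Suc k) * y - 1) * bump (real (Suc k) * (L - y) - 1))"

lemma cutoff_has_derivative [derivative_intros]:
  assumes "(f has_real_derivative f') (at x)"
  shows "((\<lambda>x. cutoff L k (f x)) has_real_derivative cutoff_deriv L k (f x) * f') (at x)"
  unfolding cutoff_def cutoff_deriv_def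
  by (auto intro!: derivative_eq_intros assms simp: algebra_simps)

lemma Ck_cutoff:
  fixes l :: "'a::euclidean_space \<Rightarrow> real"
  assumes l: "bounded_linear l"
  shows "Ck m (\<lambda>x. cutoff L k (l x + c))"
proof -
  have "Ck m (\<lambda>x. smooth_step ((\<lambda>x. real (Suc k) * l x) x + (real (Suc k) * c - 1)))"
    by (intro Ck_affine_compose Ck_smooth_step bounded_linear_const_mult l)
  moreover have "Ck m (\<lambda>x. smooth_step ((\<lambda>x. (- real (Suc k)) * l x) x + (real (Suc k) * (L - c) - 1)))"
    by (intro Ck_affine_compose Ck_smooth_step bounded_linear_const_mult l)
  ultimately show ?thesis
    unfolding cutoff_def by (intro Ck_mult) (auto simp: algebra_simps)
qed

lemma cutoff_bounds: "0 \<le> cutoff L k y" "cutoff L k y \<le> 1"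
  using smooth_step_bounds by (auto simp: cutoff_def intro!: mult_le_one mult_nonneg_nonneg)

lemma cutoff_support:
  assumes "cutoff L k y \<noteq> 0"
  shows "y \<in> {1 / real (Suc k) .. L - 1 / real (Suc k)}"
proof -
  have "real (Suc k) * y - 1 > 0" "real (Suc k) * (L - y) - 1 > 0"
    using assms smooth_step_eq_0 by (auto simp: cutoff_def not_le[symmetric])
  then show ?thesis
    by (auto simp: field_simps)
qed

lemma eventually_far_from_boundary:
  assumes "0 < y"
  shows "eventually (\<lambda>k. real (Suc k) * y - 1 \<ge> 1) sequentially"
proof -
  obtain K where "2 / y \<le> real K"
    using real_arch_simple by blast
  then have "real (Suc k) * y - 1 \<ge> 1" if "k \<ge> K" for k
  proof -
    have "2 / y \<le> real (Suc k)"
      using that \<open>2 / y \<le> real K\<close> by linarith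
    then show ?thesis
      using assms by (simp add: divide_le_eq)
  qed
  then show ?thesis
    unfolding eventually_sequentially by (intro exI allI impI)
qed

lemma cutoff_eventually:
  assumes "0 < y" "y < L"
  shows "eventually (\<lambda>k. cutoff L k y = 1 \<and> cutoff_deriv L k y = 0) sequentially"
proof -
  have "0 < L - y"
    using assms by simp
  with assms show ?thesis
    by (intro eventually_elim2[OF eventually_far_from_boundary[OF assms(1)] eventually_far_from_boundary[of "L - y"]])
       (simp_all del: of_nat_Suc add: cutoff_def cutoff_deriv_def smooth_step_eq_1 bump_eq_0)
qed

lemma cutoff_tendsto:
  assumes "0 < y" "y < L"
  shows "(\<lambda>k. cutoff L k y) \<longlonglongrightarrow> 1" "(\<lambda>k. cutoff_deriv L k y) \<longlonglongrightarrow> 0"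
  by (rule tendsto_eventually, use cutoff_eventually[OF assms] in \<open>auto elim: eventually_mono\<close>)+

text \<open>The derivative of the cutoff is of order \<open>k\<close>, but it lives in a boundary layer of width of order
\<open>1 / k\<close>. A weight that vanishes linearly at both end points therefore compensates it uniformly in
\<open>k\<close>.\<close>

lemma cutoff_deriv_weighted_bound:
  "\<exists>M. \<forall>L k y w K. 0 < y \<longrightarrow> y < L \<longrightarrow> \<bar>w\<bar> \<le> K * y \<longrightarrow> \<bar>w\<bar> \<le> K * (L - y) \<longrightarrow>
     \<bar>w * cutoff_deriv L k y\<bar> \<le> K * M"
proof -
  obtain M where M: "M > 0" "\<And>x. \<bar>bump x\<bar> \<le> M"
    using bump_bounded by blast
  have 1: "\<bar>real (Suc k) * z * bump (real (Suc k) * z - 1)\<bar> \<le> 2 * M" if "z > 0" for k z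
  proof (cases "real (Suc k) * z - 1 \<ge> 1")
    case False
    then have "\<bar>real (Suc k) * z\<bar> \<le> 2"
      using that by simp
    then show ?thesis
      unfolding abs_mult[of _ "bump _"] by (intro mult_mono M) auto
  qed (use M in \<open>simp add: bump_eq_0\<close>)
  have 2: "\<bar>w * (real (Suc k) * bump (real (Suc k) * z - 1) * s)\<bar> \<le> K * (2 * M)"
    if z: "z > 0" and w: "\<bar>w\<bar> \<le> K * z" and s: "0 \<le> s" "s \<le> 1" for w k z s K
  proof -
    have K: "0 \<le> K"
      using w z by (smt (verit) zero_le_mult_iff mult_neg_pos)
    have "\<bar>w * (real (Suc k) * bump (real (Suc k) * z - 1) * s)\<bar>
        = \<bar>w\<bar> * (real (Suc k) * \<bar>bump (real (Suc k) * z - 1)\<bar>) * s"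
      using s by (simp add: abs_mult)
    also have "\<dots> \<le> (K * z) * (real (Suc k) * \<bar>bump (real (Suc k) * z - 1)\<bar>) * 1"
      using s w K z by (intro mult_mono mult_nonneg_nonneg) auto
    also have "\<dots> = K * \<bar>real (Suc k) * z * bump (real (Suc k) * z - 1)\<bar>"
      using z by (simp add: abs_mult)
    also have "\<dots> \<le> K * (2 * M)"
      by (intro mult_left_mono 1 z K)
    finally show ?thesis .
  qed
  have "\<bar>w * cutoff_deriv L k y\<bar> \<le> K * (4 * M)"
    if "0 < y" "y < L" "\<bar>w\<bar> \<le> K * y" "\<bar>w\<bar> \<le> K * (L - y)" for L k y w K
  proof -
    have "w * cutoff_deriv L k y =
       w * (real (Suc k) * bump (real (Suc k) * y - 1) * smooth_step (real (Suc k) * (L - y) - 1)) -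
       w * (real (Suc k) * bump (real (Suc k) * (L - y) - 1) * smooth_step (real (Suc k) * y - 1))"
      by (simp add: cutoff_deriv_def algebra_simps)
    also have "\<bar>\<dots>\<bar> \<le> K * (2 * M) + K * (2 * M)"
      by (intro order_trans[OF abs_triangle_ineq4] add_mono 2 smooth_step_bounds) (use that in auto)
    finally show ?thesis by simp
  qed
  then show ?thesis by blast
qed

section \<open>Integration by parts\<close>

lemma continuous_bounded_on_interval:
  fixes g :: "real \<Rightarrow> real"
  assumes "continuous_on UNIV g"
  obtains C where "C \<ge> 0" "\<And>x. x \<in> {a..b} \<Longrightarrow> \<bar>g x\<bar> \<le> C"
proof -
  have "compact (g ` {a..b})"
    by (intro compact_continuous_image continuous_on_subset[OF assms]) auto
  from compact_imp_bounded[OF this] obtain C where "C > 0" "\<forall>y\<in>g ` {a..b}. norm y \<le> C"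
    unfolding bounded_pos by blast
  with that[of C] show thesis by auto
qed

lemma continuous_set_measurable:
  assumes "continuous_on UNIV (g :: real \<Rightarrow> real)" "S \<in> sets lebesgue"
  shows "set_borel_measurable lebesgue S g"
  by (intro measurable_imp_set_measurable continuous_imp_lebesgue_measurable assms)

lemma interval_lmeasurable [simp]: "{a<..<b::real} \<in> lmeasurable"
  by (metis box_real(1) lmeasurable_box)

lemma L2_continuous:
  assumes "continuous_on UNIV (g :: real \<Rightarrow> real)"
  shows "g \<in> L2_space {a<..<b}"
proof -
  obtain C where "\<And>x. x \<in> {a..b} \<Longrightarrow> \<bar>g x\<bar> \<le> C"
    using continuous_bounded_on_interval[OF assms] by metis
  then show ?thesis
    by (intro L2_bounded[of _ _ C] continuous_set_measurable assms) auto
qed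

lemma L2_continuous_integrable:
  assumes "f \<in> L2_space {a<..<b}" "continuous_on UNIV (g :: real \<Rightarrow> real)"
  shows "set_integrable lebesgue {a<..<b} (\<lambda>x. f x * g x)"
  by (intro L2_mult_integrable L2_continuous assms)

lemma Ck_deriv:
  assumes "\<And>k. Ck k (g::real \<Rightarrow> real)"
  shows "(g has_real_derivative deriv g x) (at x)" "Ck k (deriv g)" "continuous_on UNIV g" "continuous_on UNIV (deriv g)"
  using Ck_SucD_real[OF assms] Ck_imp_continuous[OF assms] Ck_imp_continuous[OF Ck_SucD_real(2)[OF assms]]
  by blast+

lemma integral_by_parts_test_function:
  fixes g :: "real \<Rightarrow> real"
  assumes \<psi>: "\<psi> \<in> test_functions {a<..<b}" and g: "\<And>k. Ck k g" and ab: "a < b"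
  shows "(LINT x:{a<..<b}|lebesgue. deriv \<psi> x * g x) = - (LINT x:{a<..<b}|lebesgue. \<psi> x * deriv g x)"
proof -
  have \<psi>_smooth: "\<And>k. Ck k \<psi>" and sub: "closure {x. \<psi> x \<noteq> 0} \<subseteq> {a<..<b}"
    using \<psi> by (auto simp: test_functions_def)
  have ends: "\<psi> a = 0" "\<psi> b = 0"
    using sub closure_subset[of "{x. \<psi> x \<noteq> 0}"] by auto
  have int1: "set_integrable lebesgue {a<..<b} (\<lambda>x. deriv \<psi> x * g x)"
    and int2: "set_integrable lebesgue {a<..<b} (\<lambda>x. \<psi> x * deriv g x)"
    by (intro L2_continuous_integrable L2_continuous Ck_deriv \<psi>_smooth g)+
  have "((\<lambda>x. \<psi> x * g x) has_real_derivative deriv \<psi> x * g x + \<psi> x * deriv g x) (at x)" for x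
    using DERIV_mult[OF Ck_deriv(1)[OF \<psi>_smooth] Ck_deriv(1)[OF g]] by (simp add: algebra_simps)
  then have "((\<lambda>x. \<psi> x * g x) has_vector_derivative deriv \<psi> x * g x + \<psi> x * deriv g x) (at x within {a..b})" for x
    by (simp add: has_field_derivative_at_within flip: has_real_derivative_iff_has_vector_derivative)
  then have "((\<lambda>x. deriv \<psi> x * g x + \<psi> x * deriv g x) has_integral (\<psi> b * g b - \<psi> a * g a)) {a..b}"
    using ab by (intro fundamental_theorem_of_calculus) auto
  then have "integral {a<..<b} (\<lambda>x. deriv \<psi> x * g x + \<psi> x * deriv g x) = 0"
    using ends by (simp add: integral_open_interval_real[symmetric] integral_unique)
  then have "(LINT x:{a<..<b}|lebesgue. deriv \<psi> x * g x + \<psi> x * deriv g x) = 0"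
    using set_lebesgue_integral_eq_integral(2)[OF set_integral_add(1)[OF int1 int2]] by simp
  then show ?thesis
    by (simp add: set_integral_add(2)[OF int1 int2])
qed

text \<open>Membership in $H^1_0$ means that no boundary term appears even if \<open>g\<close> does not vanish at the end
points; with \<open>g = 1\<close> this says that the derivative has mean zero. For the derivative \<open>w\<close> belonging to
an approximating sequence of test functions the formula is a limit of the classical one. Any other
weak derivative has the same integral against \<open>g\<close> times a cutoff, hence against \<open>g\<close>.\<close>

lemma H10_integral_by_parts:
  fixes g :: "real \<Rightarrow> real"
  assumes u: "u \<in> H10_space {a<..<b}" and u': "H1_deriv {a<..<b} u u'" and g: "\<And>k. Ck k g" and ab: "a < b"
  shows "(LINT x:{a<..<b}|lebesgue. u' x * g x) = - (LINT x:{a<..<b}|lebesgue. u x * deriv g x)"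
proof -
  let ?S = "{a<..<b}"
  note meas = continuous_set_measurable[of _ ?S, simplified]
  obtain w \<psi> where w: "H1_deriv ?S u w" and \<psi>: "\<And>k::nat. \<psi> k \<in> test_functions ?S"
    and lim: "(\<lambda>k. L2_dist ?S (\<psi> k) u) \<longlonglongrightarrow> 0" "(\<lambda>k. L2_dist ?S (deriv (\<psi> k)) w) \<longlonglongrightarrow> 0"
    using u by (auto simp: H10_space_def)
  have \<psi>_smooth: "Ck m (\<psi> k)" for m k
    using \<psi> by (auto simp: test_functions_def)
  have L2: "u \<in> L2_space ?S" "w \<in> L2_space ?S" "u' \<in> L2_space ?S"
    using w u' by (auto simp: H1_deriv_def)
  obtain C where C: "\<And>x. x \<in> {a..b} \<Longrightarrow> \<bar>g x\<bar> \<le> C"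
    using continuous_bounded_on_interval[OF Ck_deriv(3)[OF g]] by metis
  obtain C' where C': "\<And>x. x \<in> {a..b} \<Longrightarrow> \<bar>deriv g x\<bar> \<le> C'"
    using continuous_bounded_on_interval[OF Ck_deriv(4)[OF g]] by metis
  have "(\<lambda>k. LINT x:?S|lebesgue. deriv (\<psi> k) x * g x) \<longlonglongrightarrow> (LINT x:?S|lebesgue. w x * g x)"
    by (rule L2_pairing_tendsto[where C = C])
       (auto intro!: L2 lim L2_continuous Ck_deriv \<psi>_smooth g meas C)
  moreover have "(\<lambda>k. LINT x:?S|lebesgue. \<psi> k x * deriv g x) \<longlonglongrightarrow> (LINT x:?S|lebesgue. u x * deriv g x)"
    by (rule L2_pairing_tendsto[where C = C'])
       (auto intro!: L2 lim L2_continuous Ck_deriv \<psi>_smooth g meas C')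
  then have "(\<lambda>k. LINT x:?S|lebesgue. deriv (\<psi> k) x * g x) \<longlonglongrightarrow> - (LINT x:?S|lebesgue. u x * deriv g x)"
    unfolding integral_by_parts_test_function[OF \<psi> g ab] by (rule tendsto_minus)
  ultimately have wg: "(LINT x:?S|lebesgue. w x * g x) = - (LINT x:?S|lebesgue. u x * deriv g x)"
    by (rule LIMSEQ_unique)
  define h where "h k x = g x * cutoff (b - a) k (x - a)" for k x
  have h_smooth: "Ck m (h k)" for m k
    unfolding h_def using Ck_cutoff[OF bounded_linear_ident, of m "b - a" k "- a"] by (intro Ck_mult g) simp
  have "h k \<in> test_functions ?S" for k
  proof (rule test_functionsI[of _ "{a + 1 / real (Suc k) .. b - 1 / real (Suc k)}", OF h_smooth])
    have "1 / real (Suc k) > 0" by simp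
    then show "{a + 1 / real (Suc k) .. b - 1 / real (Suc k)} \<subseteq> ?S"
      unfolding greaterThanLessThan_iff subset_iff atLeastAtMost_iff by linarith
  qed (auto simp: h_def dest!: cutoff_support)
  then have eq: "(LINT x:?S|lebesgue. w x * h k x) = (LINT x:?S|lebesgue. u' x * h k x)" for k
    using w u' by (simp add: H1_deriv_def)
  have lim_h: "(\<lambda>k. LINT x:?S|lebesgue. f x * h k x) \<longlonglongrightarrow> (LINT x:?S|lebesgue. f x * g x)"
    if "f \<in> L2_space ?S" for f
  proof (rule L2_pairing_tendsto[where C = C])
    fix n x assume x: "x \<in> ?S"
    have "\<bar>h n x\<bar> \<le> C * 1"
      unfolding h_def abs_mult using x cutoff_bounds C[of x] by (intro mult_mono) auto
    then show "\<bar>h n x\<bar> \<le> C" by simp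
    have "(\<lambda>n. h n x) \<longlonglongrightarrow> g x * 1"
      unfolding h_def using x by (intro tendsto_mult tendsto_const cutoff_tendsto) auto
    then show "(\<lambda>n. h n x) \<longlonglongrightarrow> g x" by simp
  qed (auto intro!: that meas Ck_deriv h_smooth g)
  have "(LINT x:?S|lebesgue. w x * g x) = (LINT x:?S|lebesgue. u' x * g x)"
    using lim_h[OF L2(2)] lim_h[OF L2(3)] unfolding eq by (rule LIMSEQ_unique)
  with wg show ?thesis by simp
qed

section \<open>Pairings along the moving interval\<close>

text \<open>The integrability equivalence makes the change of variables valid for every function: if one side is
not integrable, both integrals have the default value \<open>0\<close>.\<close>

lemma lebesgue_integral_affine:
  fixes f :: "real \<Rightarrow> 'b::euclidean_space"
  assumes "c \<noteq> 0"
  shows "integrable lebesgue (\<lambda>x. f (t + c * x)) \<longleftrightarrow> integrable lebesgue f"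
    and "(LINT x|lebesgue. f x) = \<bar>c\<bar> *\<^sub>R (LINT x|lebesgue. f (t + c * x))"
proof -
  note iff = has_bochner_integral_lebesgue_real_affine_iff[OF assms, of f _ t]
  have int: "integrable lebesgue f" "(LINT x|lebesgue. f x) = \<bar>c\<bar> *\<^sub>R (LINT x|lebesgue. f (t + c * x))"
    if "integrable lebesgue (\<lambda>x. f (t + c * x))"
  proof -
    from that obtain i where i: "has_bochner_integral lebesgue (\<lambda>x. f (t + c * x)) i"
      by (auto simp: integrable.simps)
    have "has_bochner_integral lebesgue f (\<bar>c\<bar> *\<^sub>R i)"
      unfolding iff using i assms by simp
    with i show "integrable lebesgue f" "(LINT x|lebesgue. f x) = \<bar>c\<bar> *\<^sub>R (LINT x|lebesgue. f (t + c * x))"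
      by (auto simp: has_bochner_integral_iff)
  qed
  show iff2: "integrable lebesgue (\<lambda>x. f (t + c * x)) \<longleftrightarrow> integrable lebesgue f"
    using int(1) iff by (auto simp: integrable.simps)
  show "(LINT x|lebesgue. f x) = \<bar>c\<bar> *\<^sub>R (LINT x|lebesgue. f (t + c * x))"
  proof (cases "integrable lebesgue f")
    case False
    with iff2 show ?thesis by (simp add: not_integrable_integral_eq)
  qed (use int iff2 in blast)
qed

lemma set_integral_affine:
  fixes f :: "real \<Rightarrow> 'b::euclidean_space"
  assumes c: "c \<noteq> 0" and S': "\<And>x. x \<in> S' \<longleftrightarrow> t + c * x \<in> S"
  shows "set_integrable lebesgue S' (\<lambda>x. f (t + c * x)) \<longleftrightarrow> set_integrable lebesgue S f"
    and "(LINT x:S|lebesgue. f x) = \<bar>c\<bar> *\<^sub>R (LINT x:S'|lebesgue. f (t + c * x))"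
proof -
  have "indicator S' x = (indicator S (t + c * x) :: real)" for x
    using S' by (simp add: indicator_def)
  then show "set_integrable lebesgue S' (\<lambda>x. f (t + c * x)) \<longleftrightarrow> set_integrable lebesgue S f"
    and "(LINT x:S|lebesgue. f x) = \<bar>c\<bar> *\<^sub>R (LINT x:S'|lebesgue. f (t + c * x))"
    unfolding set_integrable_def set_lebesgue_integral_def
    using lebesgue_integral_affine[OF c, of "\<lambda>x. indicator S x *\<^sub>R f x" t] by simp_all
qed

text \<open>On a set of finite measure an $L^2$ function is integrable, so that the measurability of the
transformed function comes with the integrability given by the change of variables.\<close>

lemma L2_affine:
  assumes S: "S \<in> lmeasurable" and f: "f \<in> L2_space S" and c: "c \<noteq> 0"
    and S': "\<And>x. x \<in> S' \<longleftrightarrow> t + c * x \<in> S"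
  shows "(\<lambda>x. f (t + c * x)) \<in> L2_space S'"
proof -
  have "set_borel_measurable lebesgue S (\<lambda>_. 1 :: real)"
    using S by (intro measurable_imp_set_measurable) auto
  from L2_bounded_mult_integrable[OF S f this, of 1] have "set_integrable lebesgue S f"
    by simp
  then have "set_integrable lebesgue S' (\<lambda>x. f (t + c * x))"
    by (simp add: set_integral_affine(1)[OF c S'])
  moreover have "set_integrable lebesgue S' (\<lambda>x. (f (t + c * x))\<^sup>2)"
    using f set_integral_affine(1)[OF c S', of "\<lambda>x. (f x)\<^sup>2"] by (simp add: L2_space_def)
  ultimately show ?thesis
    by (auto simp: L2_space_def set_borel_measurable_def set_integrable_def)
qed

definition slice_pairing :: "real \<Rightarrow> real \<Rightarrow> (real \<Rightarrow> real \<Rightarrow> real) \<Rightarrow> (real \<times> real \<Rightarrow> real) \<Rightarrow> real \<Rightarrow> real" where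
  "slice_pairing L v u G t = (LINT x:moving_interval L v t|lebesgue. u x t * G (x, t))"

text \<open>In the moving frame \<open>y = x - v t\<close> the interval is fixed, which is how the continuity in time of an
$L^2$-valued curve is expressed.\<close>

lemma slice_pairing_shift:
  "slice_pairing L v u G t = (LINT y:{0<..<L}|lebesgue. u (y + v * t) t * G (y + v * t, t))"
  unfolding slice_pairing_def
  by (subst set_integral_affine(2)[of 1 "{0<..<L}" "v * t"]) (auto simp: moving_interval_def add.commute)

lemma L2_shift:
  assumes "(\<lambda>x. u x t) \<in> L2_space (moving_interval L v t)"
  shows "(\<lambda>y. u (y + v * t) t) \<in> L2_space {0<..<L}"
  using L2_affine[of "moving_interval L v t" "\<lambda>x. u x t" 1 "{0<..<L}" "v * t"] assms
  by (simp add: moving_interval_def add.commute)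

lemma moving_seq_tendsto:
  assumes u: "continuous_L2_moving L v T u" and s: "\<And>n. s n \<in> {0..T}" "t \<in> {0..T}" "s \<longlonglongrightarrow> t"
  shows "(\<lambda>n. L2_dist {0<..<L} (\<lambda>y. u (y + v * s n) (s n)) (\<lambda>y. u (y + v * t) t)) \<longlonglongrightarrow> 0"
proof -
  let ?D = "\<lambda>s. L2_dist {0<..<L} (\<lambda>y. u (y + v * s) s) (\<lambda>y. u (y + v * t) t)"
  have "(?D \<longlongrightarrow> ?D t) (at t within {0..T})"
    using u s(2) by (simp add: continuous_L2_moving_def moving_interval_def)
  then have "continuous (at t within {0..T}) ?D"
    by (simp add: continuous_within)
  then have "(?D \<circ> s) \<longlonglongrightarrow> ?D t"
    using s unfolding continuous_within_sequentially by blast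
  then show ?thesis by (simp add: o_def)
qed

lemma moving_L2:
  assumes "continuous_L2_moving L v T u" "t \<in> {0..T}"
  shows "(\<lambda>x. u x t) \<in> L2_space (moving_interval L v t)" "(\<lambda>y. u (y + v * t) t) \<in> L2_space {0<..<L}"
  using assms L2_shift by (auto simp: continuous_L2_moving_def)

lemma continuous_slice:
  assumes "continuous_on UNIV (G :: real \<times> real \<Rightarrow> real)"
  shows "continuous_on UNIV (\<lambda>y. G (y + v * t, t))"
  by (rule continuous_on_compose2[OF assms]) (auto intro!: continuous_intros)

lemma slice_pairing_continuous:
  assumes u: "continuous_L2_moving L v T u" and G: "continuous_on UNIV G"
  shows "continuous_on {0..T} (slice_pairing L v u G)"
proof -
  have "compact ((\<lambda>(y, s). G (y + v * s, s)) ` ({0..L} \<times> {0..T}))"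
    by (intro compact_continuous_image compact_Times)
      (auto intro!: continuous_on_compose2[OF G] continuous_intros simp: case_prod_unfold)
  from compact_imp_bounded[OF this]
  obtain C where "\<forall>z\<in>(\<lambda>(y, s). G (y + v * s, s)) ` ({0..L} \<times> {0..T}). norm z \<le> C"
    unfolding bounded_pos by blast
  then have C: "\<bar>G (y + v * s, s)\<bar> \<le> C" if "y \<in> {0..L}" "s \<in> {0..T}" for y s
    using that by fastforce
  show ?thesis
    unfolding continuous_on_sequentially o_def slice_pairing_shift
  proof (intro allI ballI impI)
    fix s :: "nat \<Rightarrow> real" and t assume t: "t \<in> {0..T}" and "(\<forall>n. s n \<in> {0..T}) \<and> s \<longlonglongrightarrow> t"
    then have s: "\<And>n. s n \<in> {0..T}" "s \<longlonglongrightarrow> t" by auto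
    show "(\<lambda>n. LINT y:{0<..<L}|lebesgue. u (y + v * s n) (s n) * G (y + v * s n, s n))
      \<longlonglongrightarrow> (LINT y:{0<..<L}|lebesgue. u (y + v * t) t * G (y + v * t, t))"
    proof (rule L2_pairing_tendsto[where C = C])
      fix y :: real
      show "(\<lambda>n. G (y + v * s n, s n)) \<longlonglongrightarrow> G (y + v * t, t)"
        by (rule continuous_on_tendsto_compose[OF G]) (auto intro!: tendsto_intros s)
    qed (use C s t in \<open>auto intro!: moving_L2[OF u] moving_seq_tendsto[OF u] continuous_set_measurable continuous_slice G\<close>)
  qed
qed

lemma moving_norm_bounded:
  assumes u: "continuous_L2_moving L v T u"
  obtains B where "B \<ge> 0" "\<And>t. t \<in> {0..T} \<Longrightarrow> (LINT y:{0<..<L}|lebesgue. (u (y + v * t) t)\<^sup>2) \<le> B"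
proof -
  let ?S = "{0<..<L}"
  let ?u = "\<lambda>t y. u (y + v * t) t"
  let ?N = "\<lambda>t. LINT y:?S|lebesgue. (?u t y)\<^sup>2"
  have "continuous_on {0..T} ?N"
    unfolding continuous_on_sequentially o_def
  proof (intro allI ballI impI)
    fix s :: "nat \<Rightarrow> real" and t assume t: "t \<in> {0..T}" and "(\<forall>n. s n \<in> {0..T}) \<and> s \<longlonglongrightarrow> t"
    then have s: "\<And>n. s n \<in> {0..T}" "s \<longlonglongrightarrow> t" by auto
    let ?d = "\<lambda>n y. ?u (s n) y - ?u t y"
    let ?D = "\<lambda>n. L2_dist ?S (?u (s n)) (?u t)"
    have L2: "?u t \<in> L2_space ?S" "?d n \<in> L2_space ?S" for n
      using s t by (auto intro!: L2_diff moving_L2[OF u])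
    have int: "set_integrable lebesgue ?S (\<lambda>y. (?d n y)\<^sup>2)" "set_integrable lebesgue ?S (\<lambda>y. (?u t y)\<^sup>2)"
      "set_integrable lebesgue ?S (\<lambda>y. ?d n y * ?u t y)" for n
      using L2_mult_integrable[OF L2(2,1)] L2_mult_integrable[OF L2(2,2)] L2_mult_integrable[OF L2(1,1)]
      by (simp_all add: power2_eq_square)
    have nn: "(LINT y:?S|lebesgue. (f y)\<^sup>2) \<ge> 0" for f :: "real \<Rightarrow> real"
      by (auto simp: set_lebesgue_integral_def intro!: integral_nonneg_AE)
    have D2: "(LINT y:?S|lebesgue. (?d n y)\<^sup>2) = (?D n)\<^sup>2" for n
      by (simp add: L2_dist_def nn)
    have cs: "\<bar>LINT y:?S|lebesgue. ?d n y * ?u t y\<bar> \<le> ?D n * sqrt (?N t)" for n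
      using real_sqrt_le_mono[OF L2_Cauchy_Schwarz[OF L2(2,1)]] nn
      unfolding D2 real_sqrt_mult by (simp add: L2_dist_def nn)
    have D: "?D \<longlonglongrightarrow> 0"
      by (rule moving_seq_tendsto[OF u s(1) t s(2)])
    have cross: "(\<lambda>n. LINT y:?S|lebesgue. ?d n y * ?u t y) \<longlonglongrightarrow> 0"
      by (rule Lim_null_comparison[OF _ tendsto_mult_left_zero[OF D, of "sqrt (?N t)"]]) (use cs in auto)
    have "?N (s n) = (?D n)\<^sup>2 + ?N t + 2 * (LINT y:?S|lebesgue. ?d n y * ?u t y)" for n
    proof -
      have "?N (s n) = (LINT y:?S|lebesgue. (?d n y)\<^sup>2 + (?u t y)\<^sup>2 + 2 * (?d n y * ?u t y))"
        by (intro arg_cong[where f = "set_lebesgue_integral lebesgue ?S"]) (auto simp: power2_eq_square algebra_simps)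
      also have "\<dots> = (?D n)\<^sup>2 + ?N t + 2 * (LINT y:?S|lebesgue. ?d n y * ?u t y)"
        using int by (subst set_integral_add; simp add: D2)+
      finally show ?thesis .
    qed
    moreover have "(\<lambda>n. (?D n)\<^sup>2 + ?N t + 2 * (LINT y:?S|lebesgue. ?d n y * ?u t y)) \<longlonglongrightarrow> 0\<^sup>2 + ?N t + 2 * 0"
      by (intro tendsto_intros D cross)
    ultimately show "(\<lambda>n. ?N (s n)) \<longlonglongrightarrow> ?N t"
      by simp
  qed
  then have "compact (?N ` {0..T})"
    by (rule compact_continuous_image) auto
  from compact_imp_bounded[OF this] obtain B where "B > 0" "\<forall>z\<in>?N ` {0..T}. norm z \<le> B"
    unfolding bounded_pos by blast
  show thesis
  proof (rule that[of B])
    fix t assume "t \<in> {0..T}"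
    then have "norm (?N t) \<le> B"
      using \<open>\<forall>z\<in>?N ` {0..T}. norm z \<le> B\<close> by blast
    then show "?N t \<le> B" by simp
  qed (use \<open>B > 0\<close> in simp)
qed

lemma slice_pairing_bound:
  assumes u: "continuous_L2_moving L v T u"
  obtains B where "B \<ge> 0"
    "\<And>G C t. continuous_on UNIV G \<Longrightarrow> t \<in> {0..T} \<Longrightarrow>
       (\<And>x. x \<in> moving_interval L v t \<Longrightarrow> \<bar>G (x, t)\<bar> \<le> C) \<Longrightarrow> \<bar>slice_pairing L v u G t\<bar> \<le> B * \<bar>C\<bar>"
proof -
  obtain B where B: "B \<ge> 0" "\<And>t. t \<in> {0..T} \<Longrightarrow> (LINT y:{0<..<L}|lebesgue. (u (y + v * t) t)\<^sup>2) \<le> B"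
    using moving_norm_bounded[OF u] by blast
  have "\<bar>slice_pairing L v u G t\<bar> \<le> sqrt (B * measure lebesgue {0<..<L}) * \<bar>C\<bar>"
    if G: "continuous_on UNIV G" and t: "t \<in> {0..T}" and C: "\<And>x. x \<in> moving_interval L v t \<Longrightarrow> \<bar>G (x, t)\<bar> \<le> C" for G C t
  proof -
    let ?g = "\<lambda>y. G (y + v * t, t)"
    have gL2: "?g \<in> L2_space {0<..<L}"
      by (intro L2_continuous continuous_slice G)
    have "(LINT y:{0<..<L}|lebesgue. (?g y)\<^sup>2) \<le> (LINT y:{0<..<L}|lebesgue. C\<^sup>2)"
    proof (rule set_integral_mono)
      show "set_integrable lebesgue {0<..<L} (\<lambda>y. (?g y)\<^sup>2)"
        using gL2 by (simp add: L2_space_def)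
      show "set_integrable lebesgue {0<..<L} (\<lambda>y. C\<^sup>2)"
        by (rule set_integral_const_lmeasurable(1)) simp
      fix y assume "y \<in> {0<..<L}"
      then have "\<bar>?g y\<bar> \<le> C"
        by (intro C) (auto simp: moving_interval_def)
      then show "(?g y)\<^sup>2 \<le> C\<^sup>2"
        by (metis abs_le_square_iff abs_ge_self order_trans)
    qed
    also have "\<dots> = C\<^sup>2 * measure lebesgue {0<..<L}"
      by (rule set_integral_const_lmeasurable(2)) simp
    finally have "(slice_pairing L v u G t)\<^sup>2 \<le> B * (C\<^sup>2 * measure lebesgue {0<..<L})"
      unfolding slice_pairing_shift
      by (intro order_trans[OF L2_Cauchy_Schwarz[OF moving_L2(2)[OF u t] gL2]] mult_mono B t)
         (auto simp: set_lebesgue_integral_def B intro!: integral_nonneg_AE)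
    from real_sqrt_le_mono[OF this] show ?thesis
      by (simp add: real_sqrt_mult mult_ac)
  qed
  then show thesis
    using that[of "sqrt (B * measure lebesgue {0<..<L})"] B(1) by simp
qed

lemma time_integrable:
  fixes f \<beta> :: "real \<Rightarrow> real"
  assumes f: "continuous_on {0..d} f" and \<beta>: "continuous_on UNIV \<beta>" "\<And>t. \<beta> t \<noteq> 0 \<Longrightarrow> t \<in> {c..d}" and c: "0 < c"
  shows "set_integrable lebesgue {0<..} (\<lambda>t. \<beta> t * f t)"
proof -
  have "continuous_on {c..d} (\<lambda>t. \<beta> t * f t)"
    using c by (intro continuous_intros continuous_on_subset[OF f] continuous_on_subset[OF \<beta>(1)]) auto
  then have "set_integrable lebesgue {c..d} (\<lambda>t. \<beta> t * f t)"
    by (rule absolutely_integrable_continuous_real)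
  moreover have "indicator {c..d} t *\<^sub>R (\<beta> t * f t) = indicator {0<..} t *\<^sub>R (\<beta> t * f t)" for t
    using \<beta>(2)[of t] c by (auto simp: indicator_def)
  ultimately show ?thesis
    by (simp only: set_integrable_def)
qed

lemma slice_pairing_time_integrable:
  assumes u: "continuous_L2_moving L v d u" and G: "continuous_on UNIV G"
    and \<beta>: "continuous_on UNIV \<beta>" "\<And>t. \<beta> t \<noteq> 0 \<Longrightarrow> t \<in> {c..d}" and c: "0 < c"
  shows "set_integrable lebesgue {0<..} (\<lambda>t. \<beta> t * slice_pairing L v u G t)"
  by (rule time_integrable[OF slice_pairing_continuous[OF u G] \<beta> c])

text \<open>Two dominated convergence arguments, on each slice and then in time; the latter uses that the
$L^2$ norms are bounded on compact time intervals.\<close>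

lemma slice_pairing_time_tendsto:
  assumes u: "continuous_L2_moving L v d u"
    and G: "\<And>k. continuous_on UNIV (G k)" "continuous_on UNIV G'"
    and C: "\<And>k x t. t \<ge> 0 \<Longrightarrow> x \<in> moving_interval L v t \<Longrightarrow> \<bar>G k (x, t)\<bar> \<le> C"
    and lim: "\<And>x t. t \<ge> 0 \<Longrightarrow> x \<in> moving_interval L v t \<Longrightarrow> (\<lambda>k. G k (x, t)) \<longlonglongrightarrow> G' (x, t)"
    and \<beta>: "continuous_on UNIV \<beta>" "\<And>t. \<beta> t \<noteq> 0 \<Longrightarrow> t \<in> {c..d}" and c: "0 < c"
  shows "(\<lambda>k. LINT t:{0<..}|lebesgue. \<beta> t * slice_pairing L v u (G k) t)
           \<longlonglongrightarrow> (LINT t:{0<..}|lebesgue. \<beta> t * slice_pairing L v u G' t)"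
proof -
  obtain B where B: "B \<ge> 0" "\<And>k t. t \<in> {0..d} \<Longrightarrow> \<bar>slice_pairing L v u (G k) t\<bar> \<le> B * \<bar>C\<bar>"
    using slice_pairing_bound[OF u] G(1) C by (metis atLeastAtMost_iff)
  have slice: "(\<lambda>k. slice_pairing L v u (G k) t) \<longlonglongrightarrow> slice_pairing L v u G' t" if t: "t \<in> {0..d}" for t
    unfolding slice_pairing_shift
  proof (rule L2_pairing_tendsto[where C = C])
    fix y assume "y \<in> {0<..<L}"
    then have y: "y + v * t \<in> moving_interval L v t"
      by (auto simp: moving_interval_def)
    show "\<bar>G k (y + v * t, t)\<bar> \<le> C" for k
      using C y t by auto
    show "(\<lambda>k. G k (y + v * t, t)) \<longlonglongrightarrow> G' (y + v * t, t)"
      using lim y t by auto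
  qed (use t in \<open>auto intro!: moving_L2[OF u] continuous_set_measurable continuous_slice G\<close>)
  have dom: "set_integrable lebesgue {0<..} (\<lambda>t. \<beta> t * (B * \<bar>C\<bar>))"
    by (rule time_integrable[OF _ \<beta> c]) auto
  show ?thesis
    unfolding set_lebesgue_integral_def
  proof (rule integral_dominated_convergence[OF _ _ integrable_norm[OF dom[unfolded set_integrable_def]]])
    show "(\<lambda>t. indicator {0<..} t *\<^sub>R (\<beta> t * slice_pairing L v u G' t)) \<in> borel_measurable lebesgue"
      "(\<lambda>t. indicator {0<..} t *\<^sub>R (\<beta> t * slice_pairing L v u (G k) t)) \<in> borel_measurable lebesgue" for k
      using slice_pairing_time_integrable[OF u G(2) \<beta> c] slice_pairing_time_integrable[OF u G(1) \<beta> c]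
      unfolding set_integrable_def by (blast intro: borel_measurable_integrable)+
    show "AE t in lebesgue. (\<lambda>k. indicator {0<..} t *\<^sub>R (\<beta> t * slice_pairing L v u (G k) t))
       \<longlonglongrightarrow> indicator {0<..} t *\<^sub>R (\<beta> t * slice_pairing L v u G' t)"
    proof (rule AE_I2)
      fix t
      show "(\<lambda>k. indicator {0<..} t *\<^sub>R (\<beta> t * slice_pairing L v u (G k) t))
       \<longlonglongrightarrow> indicator {0<..} t *\<^sub>R (\<beta> t * slice_pairing L v u G' t)"
      proof (cases "\<beta> t = 0")
        case False
        with \<beta>(2) c have "t \<in> {0..d}" by force
        then show ?thesis
          by (intro tendsto_intros slice)
      qed simp
    qed
    show "AE t in lebesgue. norm (indicator {0<..} t *\<^sub>R (\<beta> t * slice_pairing L v u (G k) t))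
        \<le> norm (indicator {0<..} t *\<^sub>R (\<beta> t * (B * \<bar>C\<bar>)))" for k
    proof (rule AE_I2)
      fix t
      show "norm (indicator {0<..} t *\<^sub>R (\<beta> t * slice_pairing L v u (G k) t))
        \<le> norm (indicator {0<..} t *\<^sub>R (\<beta> t * (B * \<bar>C\<bar>)))"
      proof (cases "\<beta> t = 0")
        case False
        with \<beta>(2) c have "t \<in> {0..d}" by force
        from B(2)[OF this] B(1) show ?thesis
          by (auto simp: abs_mult indicator_def intro!: mult_left_mono)
      qed simp
    qed
  qed
qed

section \<open>Functions of time with vanishing weak derivative\<close>

lemma bump_integral: "(LINT r:{0..1}|lebesgue. bump r) = 1"
proof -
  have "(bump has_integral (smooth_step 1 - smooth_step 0)) {0..1}"
    by (rule fundamental_theorem_of_calculus)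
      (auto simp: has_field_derivative_at_within[OF Ck_deriv(1)[OF Ck_smooth_step]]
        simp flip: has_real_derivative_iff_has_vector_derivative)
  moreover have "set_integrable lebesgue {0..1} bump"
    by (intro absolutely_integrable_continuous_real continuous_on_subset[OF Ck_imp_continuous[OF Ck_bump]]) auto
  ultimately show ?thesis
    using set_lebesgue_integral_eq_integral(2) by (fastforce simp: smooth_step_eq_0 smooth_step_eq_1)
qed

text \<open>The rescaled bumps form an approximate identity concentrated to the right of \<open>s\<close>.\<close>

lemma mollify_tendsto:
  assumes A: "continuous_on {0..} (A :: real \<Rightarrow> real)" and s: "0 < s"
  shows "(\<lambda>n. LINT t:{0<..}|lebesgue. real (Suc n) * bump (real (Suc n) * (t - s)) * A t) \<longlonglongrightarrow> A s"
proof -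
  let ?c = "\<lambda>n. 1 / real (Suc n)"
  have eq: "(LINT t:{0<..}|lebesgue. real (Suc n) * bump (real (Suc n) * (t - s)) * A t) =
      (LINT r:{0..1}|lebesgue. bump r * A (s + ?c n * r))" for n
  proof -
    have "(LINT t:{0<..}|lebesgue. real (Suc n) * bump (real (Suc n) * (t - s)) * A t) =
        \<bar>?c n\<bar> *\<^sub>R (LINT r|lebesgue. indicator {0<..} (s + ?c n * r) *\<^sub>R
          (real (Suc n) * bump (real (Suc n) * (s + ?c n * r - s)) * A (s + ?c n * r)))"
      unfolding set_lebesgue_integral_def by (rule lebesgue_integral_affine(2)) simp
    also have "\<dots> = (LINT r|lebesgue. \<bar>?c n\<bar> * (indicator {0<..} (s + ?c n * r) *\<^sub>R
          (real (Suc n) * bump (real (Suc n) * (s + ?c n * r - s)) * A (s + ?c n * r))))"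
      unfolding real_scaleR_def by (rule integral_mult_right_zero[symmetric])
    also have "\<dots> = (LINT r:{0..1}|lebesgue. bump r * A (s + ?c n * r))"
      unfolding set_lebesgue_integral_def
    proof (intro Bochner_Integration.integral_cong refl)
      fix r :: real
      show "\<bar>?c n\<bar> * (indicator {0<..} (s + ?c n * r) *\<^sub>R
          (real (Suc n) * bump (real (Suc n) * (s + ?c n * r - s)) * A (s + ?c n * r)))
         = indicator {0..1} r *\<^sub>R (bump r * A (s + ?c n * r))"
      proof (cases "r \<in> {0..1}")
        case True
        then have "s + ?c n * r > 0"
          using s by (intro add_pos_nonneg) auto
        with True show ?thesis by (simp add: indicator_def)
      next
        case False
        then show ?thesis by (auto simp: bump_eq_0)
      qed
    qed
    finally show ?thesis .
  qed
  have c: "?c n \<le> 1" "0 \<le> ?c n" for n by auto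
  have dom: "set_integrable lebesgue {0..1} (\<lambda>r. bump r * C)" for C
    by (intro absolutely_integrable_continuous_real continuous_intros continuous_on_subset[OF Ck_imp_continuous[OF Ck_bump]]) auto
  have pos: "s + ?c n * r \<in> {s..s+1}" if "r \<in> {0..1}" for n r
    using that c[of n] mult_mono[of "?c n" 1 r 1] by auto
  have "compact (A ` {s..s+1})"
    using s by (intro compact_continuous_image continuous_on_subset[OF A]) auto
  from compact_imp_bounded[OF this] obtain C where "C > 0" "\<forall>z\<in>A ` {s..s+1}. norm z \<le> C"
    unfolding bounded_pos by blast
  then have C: "\<bar>A (s + ?c n * r)\<bar> \<le> C" if "r \<in> {0..1}" for n r
    using pos[OF that] by auto
  have "(\<lambda>n. LINT r:{0..1}|lebesgue. bump r * A (s + ?c n * r)) \<longlonglongrightarrow> (LINT r:{0..1}|lebesgue. bump r * A s)"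
    unfolding set_lebesgue_integral_def
  proof (rule integral_dominated_convergence[OF _ _ integrable_norm[OF dom[unfolded set_integrable_def]]])
    show "(\<lambda>r. indicator {0..1} r *\<^sub>R (bump r * A s)) \<in> borel_measurable lebesgue"
      using dom[of "A s"] by (auto simp: set_integrable_def)
    have "set_integrable lebesgue {0..1} (\<lambda>r. bump r * A (s + ?c n * r))" for n
      using s by (intro absolutely_integrable_continuous_real continuous_intros continuous_on_subset[OF Ck_imp_continuous[OF Ck_bump]]
          continuous_on_compose2[OF A]) (auto intro!: continuous_intros add_nonneg_nonneg)
    then show "(\<lambda>r. indicator {0..1} r *\<^sub>R (bump r * A (s + ?c n * r))) \<in> borel_measurable lebesgue" for n
      by (auto simp: set_integrable_def)
    show "AE r in lebesgue. (\<lambda>n. indicator {0..1} r *\<^sub>R (bump r * A (s + ?c n * r))) \<longlonglongrightarrow> indicator {0..1} r *\<^sub>R (bump r * A s)"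
    proof (rule AE_I2)
      fix r :: real
      show "(\<lambda>n. indicator {0..1} r *\<^sub>R (bump r * A (s + ?c n * r))) \<longlonglongrightarrow> indicator {0..1} r *\<^sub>R (bump r * A s)"
      proof (cases "r \<in> {0..1}")
        case True
        have "(\<lambda>n. s + ?c n * r) \<longlonglongrightarrow> s + 0 * r"
          by (intro tendsto_intros LIMSEQ_Suc[OF lim_1_over_n])
        then have "(\<lambda>n. A (s + ?c n * r)) \<longlonglongrightarrow> A s"
          using s pos[OF True] by (intro continuous_on_tendsto_compose[OF A]) (auto intro!: always_eventually order_trans[of 0 s])
        then show ?thesis
          by (intro tendsto_intros)
      qed simp
    qed
    show "AE r in lebesgue. norm (indicator {0..1} r *\<^sub>R (bump r * A (s + ?c n * r))) \<le> norm (indicator {0..1} r *\<^sub>R (bump r * C))" for n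
    proof (rule AE_I2)
      fix r :: real
      show "norm (indicator {0..1} r *\<^sub>R (bump r * A (s + ?c n * r))) \<le> norm (indicator {0..1} r *\<^sub>R (bump r * C))"
      proof (cases "r \<in> {0..1}")
        case True
        from C[OF this, of n] have "\<bar>A (s + ?c n * r)\<bar> \<le> \<bar>C\<bar>" by simp
        with True show ?thesis
          by (simp add: abs_mult mult_left_mono)
      qed simp
    qed
  qed
  also have "(LINT r:{0..1}|lebesgue. bump r * A s) = A s"
    by (simp add: bump_integral)
  finally show ?thesis
    unfolding eq .
qed

text \<open>The difference of two steps, rising at \<open>r\<close> and at \<open>s\<close>, has compact support in the open half line, and
its derivative is the difference of two approximate identities. Testing with it and letting the steps
become steep gives \<open>A r = A s\<close>. The value at \<open>0\<close> is reached by continuity.\<close>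

lemma weakly_constant:
  assumes A: "continuous_on {0..} (A :: real \<Rightarrow> real)"
    and zero: "\<And>\<beta> c d. (\<And>k. Ck k \<beta>) \<Longrightarrow> 0 < c \<Longrightarrow> c < d \<Longrightarrow> (\<And>t. \<beta> t \<noteq> 0 \<Longrightarrow> t \<in> {c..d}) \<Longrightarrow>
        (LINT t:{0<..}|lebesgue. deriv \<beta> t * A t) = 0"
    and t: "0 \<le> t"
  shows "A t = A 0"
proof -
  let ?K = "\<lambda>n s t. real (Suc n) * bump (real (Suc n) * (t - s))"
  have eq: "A r = A s" if r: "0 < r" and s: "0 < s" for r s
  proof -
    have int: "set_integrable lebesgue {0<..} (\<lambda>t. ?K n q t * A t)" if "0 < q" for n q
    proof (rule time_integrable)
      show "continuous_on {0..q+1} A"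
        by (rule continuous_on_subset[OF A]) auto
      show "continuous_on UNIV (?K n q)"
        by (intro continuous_intros continuous_on_compose2[OF Ck_imp_continuous[OF Ck_bump[of 0]]]) auto
      show "t \<in> {q..q+1}" if "?K n q t \<noteq> 0" for t
      proof -
        have "real (Suc n) * (t - q) > 0" "real (Suc n) * (t - q) < 1"
          using that bump_eq_0[of "real (Suc n) * (t - q)"] by (auto simp: not_le[symmetric])
        then show ?thesis
          by (auto simp: zero_less_mult_iff) (smt (verit) mult_le_cancel_right1 of_nat_0_le_iff)
      qed
    qed (use that in auto)
    have "(LINT t:{0<..}|lebesgue. ?K n r t * A t) = (LINT t:{0<..}|lebesgue. ?K n s t * A t)" for n
    proof -
      define \<beta> where "\<beta> t = smooth_step (real (Suc n) * (t - r)) - smooth_step (real (Suc n) * (t - s))" for t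
      have "Ck k (\<lambda>t. smooth_step (real (Suc n) * (t - q)))" for k q
        using Ck_affine_compose[OF bounded_linear_const_mult[OF bounded_linear_ident, of "real (Suc n)"] Ck_smooth_step, of k "- (real (Suc n) * q)"]
        by (simp add: algebra_simps)
      then have \<beta>: "Ck k \<beta>" for k
        unfolding \<beta>_def by (intro Ck_diff)
      have "(\<beta> has_real_derivative ?K n r t - ?K n s t) (at t)" for t
        unfolding \<beta>_def by (auto intro!: derivative_eq_intros)
      then have \<beta>': "deriv \<beta> = (\<lambda>t. ?K n r t - ?K n s t)"
        by (auto intro!: DERIV_imp_deriv)
      have supp: "t \<in> {min r s..max r s + 1}" if "\<beta> t \<noteq> 0" for t
      proof (rule ccontr)
        assume "t \<notin> {min r s..max r s + 1}"
        then consider "t < min r s" | "t > max r s + 1" by force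
        then show False
        proof cases
          case 1
          then have "real (Suc n) * (t - r) \<le> 0" "real (Suc n) * (t - s) \<le> 0"
            by (auto simp: mult_le_0_iff)
          then show ?thesis using that by (simp only: \<beta>_def smooth_step_eq_0)
        next
          case 2
          then have "1 * 1 \<le> real (Suc n) * (t - r)" "1 * 1 \<le> real (Suc n) * (t - s)"
            by (intro mult_mono; simp)+
          then show ?thesis using that by (simp only: \<beta>_def smooth_step_eq_1 mult_1)
        qed
      qed
      have "(LINT t:{0<..}|lebesgue. deriv \<beta> t * A t) = 0"
        by (rule zero[OF \<beta> _ _ supp]) (use r s in auto)
      then have "(LINT t:{0<..}|lebesgue. ?K n r t * A t - ?K n s t * A t) = 0"
        by (simp only: \<beta>' left_diff_distrib)
      then show ?thesis
        by (subst (asm) set_integral_diff(2)[OF int[OF r] int[OF s]]) simp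
    qed
    with mollify_tendsto[OF A r] mollify_tendsto[OF A s] show ?thesis
      by (auto intro: LIMSEQ_unique)
  qed
  have "(\<lambda>n. A (1 / real (Suc n))) \<longlonglongrightarrow> A 0"
    by (rule continuous_on_tendsto_compose[OF A LIMSEQ_Suc[OF lim_1_over_n]]) auto
  moreover have "A (1 / real (Suc n)) = A 1" for n
    by (rule eq) auto
  ultimately have "A 0 = A 1"
    by (simp add: LIMSEQ_const_iff)
  with eq[of t 1] t show ?thesis
    by (cases "t = 0") auto
qed

section \<open>The weak wave equation tested up to the boundary\<close>

lemma deriv_support:
  fixes \<beta> :: "real \<Rightarrow> real"
  assumes "\<And>t. \<beta> t \<noteq> 0 \<Longrightarrow> t \<in> {c..d}" "deriv \<beta> t \<noteq> 0"
  shows "t \<in> {c..d}"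
proof (rule ccontr)
  assume "t \<notin> {c..d}"
  have "((\<lambda>_. 0) has_real_derivative 0) (at t)"
    by simp
  then have "(\<beta> has_real_derivative 0) (at t)"
    by (rule has_field_derivative_transform_within_open[of _ _ _ "- {c..d}"])
       (use assms(1) \<open>t \<notin> {c..d}\<close> in \<open>auto intro!: open_Compl\<close>)
  with assms(2) show False
    by (simp add: DERIV_imp_deriv)
qed

text \<open>A bounded smooth weight \<open>m (x, t)\<close>, with its two partial derivatives, that need not be supported in the
moving domain: it becomes a test function after multiplication by a spatial cutoff and a function of
time.\<close>

locale smooth_weight =
  fixes m mt mx :: "real \<times> real \<Rightarrow> real" and C :: real
  assumes smooth: "Ck k m"
    and slice_smooth: "Ck k (\<lambda>x. m (x, t))"
    and mt: "((\<lambda>s. m (x, s)) has_real_derivative mt (x, t)) (at t)" "continuous_on UNIV mt"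
    and mx: "((\<lambda>y. m (y, t)) has_real_derivative mx (x, t)) (at x)" "continuous_on UNIV mx"
    and bounds: "\<bar>m z\<bar> \<le> C" "\<bar>mt z\<bar> \<le> C" "\<bar>mx z\<bar> \<le> C"
begin

lemma m_continuous: "continuous_on UNIV m"
  by (rule Ck_imp_continuous[OF smooth])

end

definition boundary_cutoff :: "real \<Rightarrow> real \<Rightarrow> nat \<Rightarrow> real \<times> real \<Rightarrow> real" where
  "boundary_cutoff L v k z = cutoff L k (fst z - v * snd z)"

text \<open>The derivative of the boundary cutoff with respect to \<open>x\<close>, and up to the factor \<open>- v\<close> with respect to
\<open>t\<close>.\<close>

definition boundary_layer :: "real \<Rightarrow> real \<Rightarrow> nat \<Rightarrow> real \<times> real \<Rightarrow> real" where
  "boundary_layer L v k z = cutoff_deriv L k (fst z - v * snd z)"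

lemma Ck_boundary_cutoff: "Ck j (boundary_cutoff L v k)"
proof -
  have "bounded_linear (\<lambda>z :: real \<times> real. fst z - v * snd z)"
    by (intro bounded_linear_sub bounded_linear_fst bounded_linear_const_mult bounded_linear_snd)
  from Ck_cutoff[OF this, of j L k 0] show ?thesis
    by (simp add: boundary_cutoff_def [abs_def])
qed

lemma boundary_cutoff_continuous: "continuous_on UNIV (boundary_cutoff L v k)"
  by (rule Ck_imp_continuous[OF Ck_boundary_cutoff])

lemma boundary_layer_continuous: "continuous_on UNIV (boundary_layer L v k)"
proof -
  have step: "continuous_on UNIV smooth_step" and bump: "continuous_on UNIV bump"
    by (rule Ck_imp_continuous[OF Ck_smooth_step] Ck_imp_continuous[OF Ck_bump])+
  show ?thesis
    unfolding boundary_layer_def cutoff_deriv_def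
    by (intro continuous_intros continuous_on_compose2[OF step] continuous_on_compose2[OF bump]) auto
qed

locale weak_wave =
  fixes L v :: real and \<phi>0 \<phi>1 :: "real \<Rightarrow> real" and \<phi> \<phi>x \<phi>t :: "real \<Rightarrow> real \<Rightarrow> real"
  assumes L: "L > 0" and sol: "weak_wave_solution L v \<phi>0 \<phi>1 \<phi> \<phi>x \<phi>t"
begin

abbreviation "SP \<equiv> slice_pairing L v"

definition time_pairing :: "(real \<Rightarrow> real) \<Rightarrow> (real \<Rightarrow> real \<Rightarrow> real) \<Rightarrow> (real \<times> real \<Rightarrow> real) \<Rightarrow> real" where
  "time_pairing \<beta> u G = (LINT t:{0<..}|lebesgue. \<beta> t * SP u G t)"

abbreviation "I \<equiv> moving_interval L v"
abbreviation "\<eta> \<equiv> boundary_cutoff L v"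
abbreviation "\<eta>' \<equiv> boundary_layer L v"

lemma cont:
  assumes "T > 0"
  shows "continuous_L2_moving L v T \<phi>" "continuous_L2_moving L v T \<phi>x" "continuous_L2_moving L v T \<phi>t"
  using sol assms by (auto simp: weak_wave_solution_def)

lemma slice_L2:
  assumes "t \<ge> 0"
  shows "(\<lambda>x. \<phi> x t) \<in> L2_space (I t)" "(\<lambda>x. \<phi>x x t) \<in> L2_space (I t)" "(\<lambda>x. \<phi>t x t) \<in> L2_space (I t)"
  using moving_L2(1)[OF cont(1), of "t + 1" t] moving_L2(1)[OF cont(2), of "t + 1" t]
    moving_L2(1)[OF cont(3), of "t + 1" t] assms by auto

lemma SP_integral:
  assumes "(\<lambda>x. u x t) \<in> L2_space (I t)" "continuous_on UNIV G"
  shows "has_bochner_integral lebesgue (\<lambda>x. indicator (I t) x *\<^sub>R (u x t * G (x, t))) (SP u G t)"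
proof -
  have "set_integrable lebesgue (I t) (\<lambda>x. u x t * G (x, t))"
    unfolding moving_interval_def
    by (rule L2_continuous_integrable)
       (use assms in \<open>auto simp: moving_interval_def intro!: continuous_on_compose2[OF assms(2)] continuous_intros\<close>)
  then show ?thesis
    by (simp add: has_bochner_integral_iff set_integrable_def slice_pairing_def set_lebesgue_integral_def)
qed

lemma SP_zero [simp]: "SP u (\<lambda>_. 0) t = 0"
  by (simp add: slice_pairing_def)

lemma time_pairing_zero [simp]: "time_pairing \<beta> u (\<lambda>_. 0) = 0"
  by (simp add: time_pairing_def)

lemma time_pairing_has_integral:
  assumes "u \<in> {\<phi>, \<phi>x, \<phi>t}" "continuous_on UNIV G"
    and \<beta>: "continuous_on UNIV \<beta>" "\<And>t. \<beta> t \<noteq> 0 \<Longrightarrow> t \<in> {c..d}" and cd: "0 < c" "c < d"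
  shows "has_bochner_integral lebesgue (\<lambda>t. indicator {0<..} t *\<^sub>R (\<beta> t * SP u G t)) (time_pairing \<beta> u G)"
proof -
  have "continuous_L2_moving L v d u"
    using assms(1) cont[of d] cd by auto
  from slice_pairing_time_integrable[OF this assms(2) \<beta> cd(1)] show ?thesis
    by (simp add: has_bochner_integral_iff set_integrable_def time_pairing_def set_lebesgue_integral_def)
qed

lemma time_pairing_tendsto:
  assumes "u \<in> {\<phi>, \<phi>x, \<phi>t}"
    and "\<And>k. continuous_on UNIV (G k)" "continuous_on UNIV G'"
    and "\<And>k x t. t \<ge> 0 \<Longrightarrow> x \<in> I t \<Longrightarrow> \<bar>G k (x, t)\<bar> \<le> C"
    and "\<And>x t. t \<ge> 0 \<Longrightarrow> x \<in> I t \<Longrightarrow> (\<lambda>k. G k (x, t)) \<longlonglongrightarrow> G' (x, t)"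
    and \<beta>: "continuous_on UNIV \<beta>" "\<And>t. \<beta> t \<noteq> 0 \<Longrightarrow> t \<in> {c..d}" and cd: "0 < c" "c < d"
  shows "(\<lambda>k. time_pairing \<beta> u (G k)) \<longlonglongrightarrow> time_pairing \<beta> u G'"
proof -
  have u: "continuous_L2_moving L v d u"
    using assms(1) cont[of d] cd by auto
  show ?thesis
    unfolding time_pairing_def by (rule slice_pairing_time_tendsto[OF u assms(2-5) \<beta> cd(1)])
qed

lemma time_pairing_cutoff_tendsto:
  assumes "u \<in> {\<phi>, \<phi>x, \<phi>t}" and G: "continuous_on UNIV G" "\<And>z. \<bar>G z\<bar> \<le> C"
    and \<beta>: "continuous_on UNIV \<beta>" "\<And>t. \<beta> t \<noteq> 0 \<Longrightarrow> t \<in> {c..d}" and cd: "0 < c" "c < d"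
  shows "(\<lambda>k. time_pairing \<beta> u (\<lambda>z. G z * \<eta> k z)) \<longlonglongrightarrow> time_pairing \<beta> u G"
proof (rule time_pairing_tendsto[OF assms(1) _ G(1) _ _ \<beta> cd])
  show "continuous_on UNIV (\<lambda>z. G z * \<eta> k z)" for k
    by (intro continuous_intros G boundary_cutoff_continuous)
  show "\<bar>G (x, t) * \<eta> k (x, t)\<bar> \<le> C" for k x t
    using mult_mono[OF G(2)[of "(x, t)"] cutoff_bounds(2)[of L k "x - v * t"]] cutoff_bounds(1)[of L k "x - v * t"]
      order_trans[OF abs_ge_zero G(2)]
    by (simp add: abs_mult boundary_cutoff_def)
  show "(\<lambda>k. G (x, t) * \<eta> k (x, t)) \<longlonglongrightarrow> G (x, t)" if "x \<in> I t" for x t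
  proof -
    have "0 < x - v * t" "x - v * t < L"
      using that by (auto simp: moving_interval_def)
    from tendsto_mult[OF tendsto_const cutoff_tendsto(1)[OF this]] show ?thesis
      by (simp add: boundary_cutoff_def)
  qed
qed

text \<open>The weight absorbs the size of the boundary layer, and at each fixed point of the open interval the layer
is eventually absent.\<close>

lemma time_pairing_layer_tendsto:
  assumes "u \<in> {\<phi>, \<phi>x, \<phi>t}" and G: "continuous_on UNIV G"
    and K: "\<And>x t. x \<in> I t \<Longrightarrow> \<bar>G (x, t)\<bar> \<le> K * (x - v * t)" "\<And>x t. x \<in> I t \<Longrightarrow> \<bar>G (x, t)\<bar> \<le> K * (L - (x - v * t))"
    and \<beta>: "continuous_on UNIV \<beta>" "\<And>t. \<beta> t \<noteq> 0 \<Longrightarrow> t \<in> {c..d}" and cd: "0 < c" "c < d"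
  shows "(\<lambda>k. time_pairing \<beta> u (\<lambda>z. G z * \<eta>' k z)) \<longlonglongrightarrow> 0"
proof -
  obtain M where M: "\<forall>L k y w K. 0 < y \<longrightarrow> y < L \<longrightarrow> \<bar>w\<bar> \<le> K * y \<longrightarrow> \<bar>w\<bar> \<le> K * (L - y) \<longrightarrow>
       \<bar>w * cutoff_deriv L k y\<bar> \<le> K * M"
    using cutoff_deriv_weighted_bound by (rule exE)
  have "(\<lambda>k. time_pairing \<beta> u (\<lambda>z. G z * \<eta>' k z)) \<longlonglongrightarrow> time_pairing \<beta> u (\<lambda>_. 0)"
  proof (rule time_pairing_tendsto[OF assms(1) _ _ _ _ \<beta> cd])
    show "continuous_on UNIV (\<lambda>z. G z * \<eta>' k z)" for k
      by (intro continuous_intros G boundary_layer_continuous)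
    fix x t assume "x \<in> I t"
    then have y: "0 < x - v * t" "x - v * t < L"
      by (auto simp: moving_interval_def)
    show "\<bar>G (x, t) * \<eta>' k (x, t)\<bar> \<le> K * M" for k
      using M[rule_format, OF y K(1)[OF \<open>x \<in> I t\<close>] K(2)[OF \<open>x \<in> I t\<close>]] by (simp add: boundary_layer_def)
    show "(\<lambda>k. G (x, t) * \<eta>' k (x, t)) \<longlonglongrightarrow> 0"
      using tendsto_mult_right_zero[OF cutoff_tendsto(2)[OF y]] by (simp add: boundary_layer_def)
  qed auto
  then show ?thesis by simp
qed

lemma test_function_product:
  assumes m: "\<And>k. Ck k m" and \<beta>: "\<And>k. Ck k \<beta>" "\<And>t. \<beta> t \<noteq> 0 \<Longrightarrow> t \<in> {c..d}" and c: "0 < c"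
  shows "(\<lambda>z. m z * \<eta> k z * \<beta> (snd z)) \<in> test_functions (moving_domain L v)"
proof (rule test_functionsI)
  have "Ck j (\<lambda>z :: real \<times> real. \<beta> (snd z))" for j
    using Ck_affine_compose[OF bounded_linear_snd \<beta>(1), of j 0] by simp
  then show "Ck j (\<lambda>z. m z * \<eta> k z * \<beta> (snd z))" for j
    by (intro Ck_mult m Ck_boundary_cutoff)
  let ?e = "1 / real (Suc k)"
  let ?K = "(\<lambda>(y, t). (y + v * t, t)) ` ({?e .. L - ?e} \<times> {c..d})"
  show "compact ?K"
    by (intro compact_continuous_image compact_Times)
       (auto intro!: continuous_intros simp: case_prod_unfold)
  have e: "?e > 0" by simp
  show "?K \<subseteq> moving_domain L v"
  proof clarify
    fix y t assume "y \<in> {?e .. L - ?e}" "t \<in> {c..d}"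
    with e c have "0 < y" "y < L" "0 < t"
      unfolding atLeastAtMost_iff by linarith+
    then show "(y + v * t, t) \<in> moving_domain L v"
      by (simp add: moving_domain_def moving_interval_def)
  qed
  show "z \<in> ?K" if "m z * \<eta> k z * \<beta> (snd z) \<noteq> 0" for z
  proof -
    have "fst z - v * snd z \<in> {?e .. L - ?e}" "snd z \<in> {c..d}"
      using that \<beta>(2) cutoff_support by (auto simp: boundary_cutoff_def simp del: of_nat_Suc)
    then show ?thesis
      by (intro image_eqI[of _ _ "(fst z - v * snd z, snd z)"]) auto
  qed
qed

end

text \<open>A weak solution together with a weight and a function of time with compact support in the open half
line. The lemmas of this locale remove the cutoff from the weak equations.\<close>

locale tested_wave = weak_wave + smooth_weight +
  fixes \<beta> :: "real \<Rightarrow> real" and c d :: real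
  assumes \<beta>_smooth: "Ck k \<beta>" and \<beta>_support: "\<beta> t \<noteq> 0 \<Longrightarrow> t \<in> {c..d}" and cd: "0 < c" "c < d"
begin

lemmas \<beta>_facts = Ck_deriv(3)[OF \<beta>_smooth] \<beta>_support cd
lemmas \<beta>'_facts = Ck_deriv(4)[OF \<beta>_smooth] deriv_support[OF \<beta>_support] cd
lemmas continuity = m_continuous mt(2) mx(2) boundary_cutoff_continuous boundary_layer_continuous

definition "\<Psi> k z = m z * \<eta> k z * \<beta> (snd z)"

lemma \<Psi>_test: "\<Psi> k \<in> test_functions (moving_domain L v)"
  using test_function_product[OF smooth \<beta>_smooth \<beta>_support cd(1)] by (simp add: \<Psi>_def [abs_def])

lemma \<Psi>_derivs:
  "partial_t (\<Psi> k) x t = \<beta> t * (mt (x, t) * \<eta> k (x, t)) - v * \<beta> t * (m (x, t) * \<eta>' k (x, t)) + deriv \<beta> t * (m (x, t) * \<eta> k (x, t))"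
  "partial_x (\<Psi> k) x t = \<beta> t * (mx (x, t) * \<eta> k (x, t)) + \<beta> t * (m (x, t) * \<eta>' k (x, t))"
  unfolding partial_t_def partial_x_def \<Psi>_def boundary_cutoff_def boundary_layer_def
  by (rule DERIV_imp_deriv, auto intro!: derivative_eq_intros mt(1) mx(1) Ck_deriv(1)[OF \<beta>_smooth] simp: algebra_simps)+

lemma wave_equation_cutoff:
  "0 = time_pairing \<beta> \<phi>t (\<lambda>z. mt z * \<eta> k z) - v * time_pairing \<beta> \<phi>t (\<lambda>z. m z * \<eta>' k z) + time_pairing (deriv \<beta>) \<phi>t (\<lambda>z. m z * \<eta> k z)
     - (time_pairing \<beta> \<phi>x (\<lambda>z. mx z * \<eta> k z) + time_pairing \<beta> \<phi>x (\<lambda>z. m z * \<eta>' k z))"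
proof -
  have inner: "(LINT x:I t|lebesgue. \<phi>t x t * partial_t (\<Psi> k) x t - \<phi>x x t * partial_x (\<Psi> k) x t)
     = \<beta> t * SP \<phi>t (\<lambda>z. mt z * \<eta> k z) t - v * (\<beta> t * SP \<phi>t (\<lambda>z. m z * \<eta>' k z) t)
       + deriv \<beta> t * SP \<phi>t (\<lambda>z. m z * \<eta> k z) t
     - (\<beta> t * SP \<phi>x (\<lambda>z. mx z * \<eta> k z) t + \<beta> t * SP \<phi>x (\<lambda>z. m z * \<eta>' k z) t)" (is "_ = ?r") if "t > 0" for t
  proof -
    let ?f = "\<lambda>u G x. indicator (I t) x *\<^sub>R (u x t * G (x, t))"
    have "has_bochner_integral lebesgue (\<lambda>x. \<beta> t * ?f \<phi>t (\<lambda>z. mt z * \<eta> k z) x - v * (\<beta> t * ?f \<phi>t (\<lambda>z. m z * \<eta>' k z) x)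
       + deriv \<beta> t * ?f \<phi>t (\<lambda>z. m z * \<eta> k z) x
       - (\<beta> t * ?f \<phi>x (\<lambda>z. mx z * \<eta> k z) x + \<beta> t * ?f \<phi>x (\<lambda>z. m z * \<eta>' k z) x)) ?r"
      using that by (intro has_bochner_integral_add has_bochner_integral_diff has_bochner_integral_mult_right SP_integral
        slice_L2 continuous_intros continuity) auto
    from has_bochner_integral_integral_eq[OF this] show ?thesis
      unfolding set_lebesgue_integral_def \<Psi>_derivs
      by (simp add: algebra_simps)
  qed
  let ?g = "\<lambda>b u G t. indicator {0<..} t *\<^sub>R (b t * SP u G t)"
  have "has_bochner_integral lebesgue (\<lambda>t. ?g \<beta> \<phi>t (\<lambda>z. mt z * \<eta> k z) t - v * ?g \<beta> \<phi>t (\<lambda>z. m z * \<eta>' k z) t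
       + ?g (deriv \<beta>) \<phi>t (\<lambda>z. m z * \<eta> k z) t
       - (?g \<beta> \<phi>x (\<lambda>z. mx z * \<eta> k z) t + ?g \<beta> \<phi>x (\<lambda>z. m z * \<eta>' k z) t))
      (time_pairing \<beta> \<phi>t (\<lambda>z. mt z * \<eta> k z) - v * time_pairing \<beta> \<phi>t (\<lambda>z. m z * \<eta>' k z) + time_pairing (deriv \<beta>) \<phi>t (\<lambda>z. m z * \<eta> k z)
     - (time_pairing \<beta> \<phi>x (\<lambda>z. mx z * \<eta> k z) + time_pairing \<beta> \<phi>x (\<lambda>z. m z * \<eta>' k z)))" (is "has_bochner_integral _ ?l ?r")
    by (intro has_bochner_integral_add has_bochner_integral_diff has_bochner_integral_mult_right
        time_pairing_has_integral[OF _ _ \<beta>_facts] time_pairing_has_integral[OF _ _ \<beta>'_facts] continuous_intros continuity) auto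
  from has_bochner_integral_integral_eq[OF this]
  have "?r = (LINT t|lebesgue. ?l t)" by simp
  also have "\<dots> = spacetime_integral L v (\<lambda>x t. \<phi>t x t * partial_t (\<Psi> k) x t - \<phi>x x t * partial_x (\<Psi> k) x t)"
    unfolding spacetime_integral_def set_lebesgue_integral_def[of _ "{0<..}"]
    by (intro Bochner_Integration.integral_cong refl) (auto simp: indicator_def inner)
  also have "\<dots> = 0"
    using sol \<Psi>_test[of k] by (simp add: weak_wave_solution_def)
  finally show ?thesis by simp
qed

text \<open>The weak wave equation allows weights that do not have compact support in the interval, provided that
they vanish linearly at the boundary: this makes the terms with the derivative of the cutoff
disappear.\<close>

lemma wave_equation_tested:
  assumes K: "\<And>x t. x \<in> I t \<Longrightarrow> \<bar>m (x, t)\<bar> \<le> K * (x - v * t)" "\<And>x t. x \<in> I t \<Longrightarrow> \<bar>m (x, t)\<bar> \<le> K * (L - (x - v * t))"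
  shows "time_pairing \<beta> \<phi>t mt + time_pairing (deriv \<beta>) \<phi>t m - time_pairing \<beta> \<phi>x mx = 0"
proof -
  have "(\<lambda>k. time_pairing \<beta> \<phi>t (\<lambda>z. mt z * \<eta> k z) - v * time_pairing \<beta> \<phi>t (\<lambda>z. m z * \<eta>' k z) + time_pairing (deriv \<beta>) \<phi>t (\<lambda>z. m z * \<eta> k z)
     - (time_pairing \<beta> \<phi>x (\<lambda>z. mx z * \<eta> k z) + time_pairing \<beta> \<phi>x (\<lambda>z. m z * \<eta>' k z)))
     \<longlonglongrightarrow> time_pairing \<beta> \<phi>t mt - v * 0 + time_pairing (deriv \<beta>) \<phi>t m - (time_pairing \<beta> \<phi>x mx + 0)"
    by (intro tendsto_add tendsto_diff tendsto_mult tendsto_const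
        time_pairing_cutoff_tendsto[OF _ _ bounds(1) \<beta>'_facts] time_pairing_cutoff_tendsto[OF _ _ bounds(2) \<beta>_facts]
        time_pairing_cutoff_tendsto[OF _ _ bounds(3) \<beta>_facts] time_pairing_layer_tendsto[OF _ _ K \<beta>_facts] continuity) auto
  then show ?thesis
    unfolding wave_equation_cutoff[symmetric] by (simp add: LIMSEQ_const_iff)
qed

text \<open>Trades the boundary layer in a pairing with \<open>\<phi>\<close> for pairings that contain only the cutoff itself. This
is why the time derivative of \<open>\<phi>\<close> can be tested with weights that do not vanish at the boundary.\<close>

lemma slice_by_parts_cutoff:
  assumes "t > 0"
  shows "SP \<phi> (\<lambda>z. mx z * \<eta> k z) t + SP \<phi> (\<lambda>z. m z * \<eta>' k z) t = - SP \<phi>x (\<lambda>z. m z * \<eta> k z) t"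
proof -
  let ?h = "\<lambda>x. m (x, t) * \<eta> k (x, t)"
  have "?h \<in> test_functions (I t)"
  proof (rule test_functionsI)
    show "Ck j ?h" for j
      using Ck_cutoff[OF bounded_linear_ident, of j L k "- v * t"]
      by (intro Ck_mult slice_smooth) (simp add: boundary_cutoff_def)
    let ?e = "1 / real (Suc k)"
    show "compact {v * t + ?e .. v * t + L - ?e}" by simp
    have "?e > 0" by simp
    then show "{v * t + ?e .. v * t + L - ?e} \<subseteq> I t"
      unfolding moving_interval_def greaterThanLessThan_iff subset_iff atLeastAtMost_iff by linarith
    show "x \<in> {v * t + ?e .. v * t + L - ?e}" if "?h x \<noteq> 0" for x
      using that cutoff_support[of L k "x - v * t"] by (auto simp: boundary_cutoff_def)
  qed
  moreover have "\<forall>\<psi>\<in>test_functions (I t). (LINT x:I t|lebesgue. \<phi> x t * deriv \<psi> x) = - (LINT x:I t|lebesgue. \<phi>x x t * \<psi> x)"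
    using sol assms by (simp add: weak_wave_solution_def H1_deriv_def)
  ultimately have "(LINT x:I t|lebesgue. \<phi> x t * deriv ?h x) = - (LINT x:I t|lebesgue. \<phi>x x t * ?h x)"
    by (rule bspec[rotated])
  moreover have "deriv ?h x = mx (x, t) * \<eta> k (x, t) + m (x, t) * \<eta>' k (x, t)" for x
    unfolding boundary_cutoff_def boundary_layer_def
    by (rule DERIV_imp_deriv, auto intro!: derivative_eq_intros mx(1) simp: algebra_simps)
  ultimately have "(LINT x:I t|lebesgue. \<phi> x t * (mx (x, t) * \<eta> k (x, t) + m (x, t) * \<eta>' k (x, t)))
      = - SP \<phi>x (\<lambda>z. m z * \<eta> k z) t"
    by (simp only: slice_pairing_def)
  moreover have "has_bochner_integral lebesgue (\<lambda>x. indicator (I t) x *\<^sub>R (\<phi> x t * (mx (x, t) * \<eta> k (x, t)))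
        + indicator (I t) x *\<^sub>R (\<phi> x t * (m (x, t) * \<eta>' k (x, t))))
      (SP \<phi> (\<lambda>z. mx z * \<eta> k z) t + SP \<phi> (\<lambda>z. m z * \<eta>' k z) t)"
    using assms by (intro has_bochner_integral_add SP_integral[where G = "\<lambda>z. mx z * \<eta> k z"]
       SP_integral[where G = "\<lambda>z. m z * \<eta>' k z"] slice_L2 continuous_intros continuity) auto
  note has_bochner_integral_integral_eq[OF this]
  ultimately show ?thesis
    by (simp add: set_lebesgue_integral_def algebra_simps)
qed

lemma time_derivative_cutoff:
  "time_pairing \<beta> \<phi> (\<lambda>z. mt z * \<eta> k z) + v * (time_pairing \<beta> \<phi> (\<lambda>z. mx z * \<eta> k z) + time_pairing \<beta> \<phi>x (\<lambda>z. m z * \<eta> k z))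
     + time_pairing (deriv \<beta>) \<phi> (\<lambda>z. m z * \<eta> k z) = - time_pairing \<beta> \<phi>t (\<lambda>z. m z * \<eta> k z)"
proof -
  have inner: "(LINT x:I t|lebesgue. \<phi> x t * partial_t (\<Psi> k) x t)
     = \<beta> t * SP \<phi> (\<lambda>z. mt z * \<eta> k z) t + v * (\<beta> t * SP \<phi> (\<lambda>z. mx z * \<eta> k z) t + \<beta> t * SP \<phi>x (\<lambda>z. m z * \<eta> k z) t)
       + deriv \<beta> t * SP \<phi> (\<lambda>z. m z * \<eta> k z) t" if "t > 0" for t
  proof -
    let ?f = "\<lambda>u G x. indicator (I t) x *\<^sub>R (u x t * G (x, t))"
    have "has_bochner_integral lebesgue (\<lambda>x. \<beta> t * ?f \<phi> (\<lambda>z. mt z * \<eta> k z) x - v * \<beta> t * ?f \<phi> (\<lambda>z. m z * \<eta>' k z) x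
       + deriv \<beta> t * ?f \<phi> (\<lambda>z. m z * \<eta> k z) x)
      (\<beta> t * SP \<phi> (\<lambda>z. mt z * \<eta> k z) t - v * \<beta> t * SP \<phi> (\<lambda>z. m z * \<eta>' k z) t
       + deriv \<beta> t * SP \<phi> (\<lambda>z. m z * \<eta> k z) t)"
      using that by (intro has_bochner_integral_add has_bochner_integral_diff has_bochner_integral_mult_right SP_integral
        slice_L2 continuous_intros continuity) auto
    from has_bochner_integral_integral_eq[OF this]
    have "(LINT x:I t|lebesgue. \<phi> x t * partial_t (\<Psi> k) x t) =
      \<beta> t * SP \<phi> (\<lambda>z. mt z * \<eta> k z) t - v * \<beta> t * SP \<phi> (\<lambda>z. m z * \<eta>' k z) t
       + deriv \<beta> t * SP \<phi> (\<lambda>z. m z * \<eta> k z) t"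
      unfolding set_lebesgue_integral_def \<Psi>_derivs
      by (simp add: algebra_simps)
    moreover have "SP \<phi> (\<lambda>z. m z * \<eta>' k z) t = - SP \<phi>x (\<lambda>z. m z * \<eta> k z) t - SP \<phi> (\<lambda>z. mx z * \<eta> k z) t"
      using slice_by_parts_cutoff[OF that, of k] by linarith
    ultimately show ?thesis
      by (simp only:) (simp add: algebra_simps)
  qed
  let ?g = "\<lambda>b u G t. indicator {0<..} t *\<^sub>R (b t * SP u G t)"
  have "has_bochner_integral lebesgue (\<lambda>t. ?g \<beta> \<phi> (\<lambda>z. mt z * \<eta> k z) t + v * (?g \<beta> \<phi> (\<lambda>z. mx z * \<eta> k z) t
        + ?g \<beta> \<phi>x (\<lambda>z. m z * \<eta> k z) t) + ?g (deriv \<beta>) \<phi> (\<lambda>z. m z * \<eta> k z) t)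
      (time_pairing \<beta> \<phi> (\<lambda>z. mt z * \<eta> k z) + v * (time_pairing \<beta> \<phi> (\<lambda>z. mx z * \<eta> k z) + time_pairing \<beta> \<phi>x (\<lambda>z. m z * \<eta> k z))
     + time_pairing (deriv \<beta>) \<phi> (\<lambda>z. m z * \<eta> k z))" (is "has_bochner_integral _ ?l ?r")
    by (intro has_bochner_integral_add has_bochner_integral_mult_right
        time_pairing_has_integral[OF _ _ \<beta>_facts] time_pairing_has_integral[OF _ _ \<beta>'_facts] continuous_intros continuity) auto
  from has_bochner_integral_integral_eq[OF this]
  have "?r = (LINT t|lebesgue. ?l t)" by simp
  also have "\<dots> = spacetime_integral L v (\<lambda>x t. \<phi> x t * partial_t (\<Psi> k) x t)"
    unfolding spacetime_integral_def set_lebesgue_integral_def[of _ "{0<..}"]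
    by (intro Bochner_Integration.integral_cong refl) (auto simp: indicator_def inner)
  also have "\<dots> = - spacetime_integral L v (\<lambda>x t. \<phi>t x t * \<Psi> k (x, t))"
    using sol \<Psi>_test[of k] by (simp add: weak_wave_solution_def)
  also have "spacetime_integral L v (\<lambda>x t. \<phi>t x t * \<Psi> k (x, t)) = time_pairing \<beta> \<phi>t (\<lambda>z. m z * \<eta> k z)"
  proof -
    have "(LINT x:I t|lebesgue. \<phi>t x t * \<Psi> k (x, t)) = \<beta> t * SP \<phi>t (\<lambda>z. m z * \<eta> k z) t" for t
      unfolding slice_pairing_def \<Psi>_def by (simp add: mult_ac flip: set_integral_mult_right)
    then show ?thesis
      by (simp add: spacetime_integral_def time_pairing_def)
  qed
  finally show ?thesis .
qed

lemma time_derivative_tested_aux: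
  "time_pairing \<beta> \<phi> mt + v * (time_pairing \<beta> \<phi> mx + time_pairing \<beta> \<phi>x m) + time_pairing (deriv \<beta>) \<phi> m = - time_pairing \<beta> \<phi>t m"
proof -
  have "(\<lambda>k. time_pairing \<beta> \<phi> (\<lambda>z. mt z * \<eta> k z) + v * (time_pairing \<beta> \<phi> (\<lambda>z. mx z * \<eta> k z) + time_pairing \<beta> \<phi>x (\<lambda>z. m z * \<eta> k z))
     + time_pairing (deriv \<beta>) \<phi> (\<lambda>z. m z * \<eta> k z))
     \<longlonglongrightarrow> time_pairing \<beta> \<phi> mt + v * (time_pairing \<beta> \<phi> mx + time_pairing \<beta> \<phi>x m) + time_pairing (deriv \<beta>) \<phi> m"
    by (intro tendsto_add tendsto_diff tendsto_mult tendsto_const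
        time_pairing_cutoff_tendsto[OF _ _ bounds(1) \<beta>'_facts] time_pairing_cutoff_tendsto[OF _ _ bounds(1) \<beta>_facts] time_pairing_cutoff_tendsto[OF _ _ bounds(2) \<beta>_facts]
        time_pairing_cutoff_tendsto[OF _ _ bounds(3) \<beta>_facts] continuity) auto
  moreover have "(\<lambda>k. - time_pairing \<beta> \<phi>t (\<lambda>z. m z * \<eta> k z)) \<longlonglongrightarrow> - time_pairing \<beta> \<phi>t m"
    by (intro tendsto_minus time_pairing_cutoff_tendsto[OF _ _ bounds(1) \<beta>_facts] continuity) auto
  ultimately show ?thesis
    unfolding time_derivative_cutoff by (rule LIMSEQ_unique)
qed

end

context weak_wave
begin

text \<open>The homogeneous boundary conditions of the solution act here: every slice belongs to $H^1_0$, so that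
the weight need not vanish at the boundary.\<close>

lemma slice_by_parts:
  assumes "smooth_weight m mt mx C" "t \<ge> 0"
  shows "SP \<phi>x m t = - SP \<phi> mx t"
proof -
  interpret smooth_weight m mt mx C by fact
  have "deriv (\<lambda>x. m (x, t)) x = mx (x, t)" for x
    by (rule DERIV_imp_deriv[OF mx(1)])
  with H10_integral_by_parts[of "\<lambda>x. \<phi> x t" "v * t" "L + v * t" "\<lambda>x. \<phi>x x t" "\<lambda>x. m (x, t)", OF _ _ slice_smooth]
  show ?thesis
    using sol assms(2) L by (simp add: weak_wave_solution_def slice_pairing_def moving_interval_def)
qed

lemma time_pairing_by_parts:
  assumes "smooth_weight m mt mx C"
  shows "time_pairing b \<phi>x m = - time_pairing b \<phi> mx"
  unfolding time_pairing_def set_lebesgue_integral_def Bochner_Integration.integral_minus[symmetric]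
  by (intro Bochner_Integration.integral_cong refl) (auto simp: indicator_def slice_by_parts[OF assms])

text \<open>The transport terms with factor \<open>v\<close>, which come from the motion of the interval, cancel by integration
by parts on each slice.\<close>

lemma time_derivative_tested:
  assumes "tested_wave L v \<phi>0 \<phi>1 \<phi> \<phi>x \<phi>t m mt mx C \<beta> c d"
  shows "time_pairing \<beta> \<phi> mt + time_pairing (deriv \<beta>) \<phi> m + time_pairing \<beta> \<phi>t m = 0"
proof -
  interpret tested_wave L v \<phi>0 \<phi>1 \<phi> \<phi>x \<phi>t m mt mx C \<beta> c d by fact
  show ?thesis
    using time_derivative_tested_aux time_pairing_by_parts[OF smooth_weight_axioms, of \<beta>] by simp
qed

end

section \<open>Conserved quantities\<close>

text \<open>A superposition of a left- and a right-going wave of the same phase \<open>\<theta>\<close>. Differentiation multiplies the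
amplitudes and shifts \<open>\<theta>\<close> by \<open>\<pi> / 2\<close>, so that one family of weights contains all derivatives, and
\<open>\<theta>\<close> gives access to real and imaginary parts.\<close>

definition standing_wave :: "real \<Rightarrow> real \<Rightarrow> real \<Rightarrow> real \<Rightarrow> real \<Rightarrow> real \<times> real \<Rightarrow> real" where
  "standing_wave p q a b \<theta> z = a * cos (p * (snd z + fst z) + \<theta>) + b * cos (q * (snd z - fst z) + \<theta>)"

text \<open>The constant dominates the wave and both of its derivatives at once.\<close>

lemma standing_wave_weight:
  "smooth_weight (standing_wave p q a b \<theta>) (standing_wave p q (p * a) (q * b) (\<theta> + pi / 2))
     (standing_wave p q (p * a) (- q * b) (\<theta> + pi / 2)) ((1 + \<bar>p\<bar>) * \<bar>a\<bar> + (1 + \<bar>q\<bar>) * \<bar>b\<bar>)"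
proof
  fix k :: nat and x t :: real and z :: "real \<times> real"
  have lin: "bounded_linear (\<lambda>z :: real \<times> real. p * (snd z + fst z))" "bounded_linear (\<lambda>z :: real \<times> real. q * (snd z - fst z))"
    by (intro bounded_linear_add bounded_linear_sub bounded_linear_const_mult bounded_linear_fst bounded_linear_snd)+
  show "Ck k (standing_wave p q a b \<theta>)"
    unfolding standing_wave_def by (intro Ck_add Ck_mult Ck_const Ck_cos_affine lin)
  have "Ck k (\<lambda>x. a * cos (p * x + (p * t + \<theta>)) + b * cos (- q * x + (q * t + \<theta>)))"
    by (intro Ck_add Ck_mult Ck_const Ck_cos_affine bounded_linear_const_mult bounded_linear_ident)
  then show "Ck k (\<lambda>x. standing_wave p q a b \<theta> (x, t))"
    by (simp add: standing_wave_def algebra_simps)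
  show "continuous_on UNIV (standing_wave p q (p * a) (q * b) (\<theta> + pi / 2))"
    "continuous_on UNIV (standing_wave p q (p * a) (- q * b) (\<theta> + pi / 2))"
    unfolding standing_wave_def by (intro continuous_intros)+
  show "((\<lambda>s. standing_wave p q a b \<theta> (x, s)) has_real_derivative
           standing_wave p q (p * a) (q * b) (\<theta> + pi / 2) (x, t)) (at t)"
    "((\<lambda>y. standing_wave p q a b \<theta> (y, t)) has_real_derivative
           standing_wave p q (p * a) (- q * b) (\<theta> + pi / 2) (x, t)) (at x)"
    unfolding standing_wave_def
    by (auto intro!: derivative_eq_intros simp: add.assoc[symmetric] cos_add sin_add) (simp_all add: algebra_simps)
  have *: "\<bar>standing_wave p q a' b' \<theta>' z\<bar> \<le> \<bar>a'\<bar> + \<bar>b'\<bar>" for a' b' \<theta>'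
    unfolding standing_wave_def
    by (intro order_trans[OF abs_triangle_ineq] add_mono) (auto simp: abs_mult intro!: mult_left_le)
  show "\<bar>standing_wave p q a b \<theta> z\<bar> \<le> (1 + \<bar>p\<bar>) * \<bar>a\<bar> + (1 + \<bar>q\<bar>) * \<bar>b\<bar>"
    by (rule order_trans[OF *]) (auto simp: algebra_simps intro!: add_mono)
  show "\<bar>standing_wave p q (p * a) (q * b) (\<theta> + pi / 2) z\<bar> \<le> (1 + \<bar>p\<bar>) * \<bar>a\<bar> + (1 + \<bar>q\<bar>) * \<bar>b\<bar>"
    by (rule order_trans[OF *]) (auto simp: abs_mult algebra_simps intro!: add_mono)
  show "\<bar>standing_wave p q (p * a) (- q * b) (\<theta> + pi / 2) z\<bar> \<le> (1 + \<bar>p\<bar>) * \<bar>a\<bar> + (1 + \<bar>q\<bar>) * \<bar>b\<bar>"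
    by (rule order_trans[OF *]) (auto simp: abs_mult algebra_simps intro!: add_mono)
qed

lemma abs_cos_diff_le: "\<bar>cos a - cos b\<bar> \<le> \<bar>a - b :: real\<bar>"
proof -
  have "\<bar>cos a - cos b\<bar> = 2 * (\<bar>sin ((a + b) / 2)\<bar> * \<bar>sin ((b - a) / 2)\<bar>)"
    by (simp add: cos_diff_cos abs_mult)
  also have "\<dots> \<le> 2 * (1 * \<bar>(b - a) / 2\<bar>)"
    by (intro mult_left_mono mult_mono abs_sin_x_le_abs_x) auto
  finally show ?thesis by simp
qed

context weak_wave
begin

text \<open>Put \<open>\<psi> = C1 - C2\<close> and \<open>S = C1 + C2\<close>, where \<open>C1\<close> and \<open>C2\<close> are the left- and the right-going cosine wave.
Then \<open>\<psi>\<close> solves the wave equation and vanishes on the moving boundary, and \<open>\<psi>\<^sub>t = S\<^sub>x\<close>. The bilinear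
conserved quantity \<open>\<integral> \<phi>\<^sub>t \<psi> - \<phi> \<psi>\<^sub>t\<close> of two solutions becomes, after an integration by parts,
\<open>\<integral> \<phi>\<^sub>t \<psi> + \<phi>\<^sub>x S\<close>. Its time derivative is computed by testing the wave equation with \<open>\<psi>\<close> and the
time derivative of \<open>\<phi>\<close> with \<open>\<psi>\<^sub>t\<close>.\<close>

lemma conserved_quantity:
  fixes n :: int and \<theta> :: real
  defines "\<kappa> \<equiv> of_int n * pi / L"
  defines "p \<equiv> \<kappa> * (1 - v)" and "q \<equiv> \<kappa> * (1 + v)"
  defines "A \<equiv> \<lambda>t. SP \<phi>t (standing_wave p q 1 (- 1) \<theta>) t + SP \<phi>x (standing_wave p q 1 1 \<theta>) t"
  assumes "t \<ge> 0"
  shows "A t = A 0"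
proof (rule weakly_constant[OF _ _ \<open>t \<ge> 0\<close>])
  let ?\<psi> = "standing_wave p q 1 (- 1) \<theta>"
  let ?S = "standing_wave p q 1 1 \<theta>"
  let ?\<psi>t = "standing_wave p q p (- q) (\<theta> + pi / 2)"
  let ?\<psi>x = "standing_wave p q p q (\<theta> + pi / 2)"
  let ?\<psi>tt = "standing_wave p q (p * p) (- q * q) (\<theta> + pi / 2 + pi / 2)"
  let ?\<psi>tx = "standing_wave p q (p * p) (q * q) (\<theta> + pi / 2 + pi / 2)"
  have w\<psi>: "smooth_weight ?\<psi> ?\<psi>t ?\<psi>x (1 + \<bar>p\<bar> + (1 + \<bar>q\<bar>))"
    using standing_wave_weight[of p q 1 "- 1" \<theta>] by simp
  have wS: "smooth_weight ?S ?\<psi>x ?\<psi>t (1 + \<bar>p\<bar> + (1 + \<bar>q\<bar>))"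
    using standing_wave_weight[of p q 1 1 \<theta>] by simp
  have w\<psi>t: "smooth_weight ?\<psi>t ?\<psi>tt ?\<psi>tx ((1 + \<bar>p\<bar>) * \<bar>p\<bar> + (1 + \<bar>q\<bar>) * \<bar>q\<bar>)"
    using standing_wave_weight[of p q p "- q" "\<theta> + pi / 2"] by simp
  have w\<psi>x: "smooth_weight ?\<psi>x ?\<psi>tx ?\<psi>tt ((1 + \<bar>p\<bar>) * \<bar>p\<bar> + (1 + \<bar>q\<bar>) * \<bar>q\<bar>)"
    using standing_wave_weight[of p q p q "\<theta> + pi / 2"] by simp
  have K: "\<bar>?\<psi> (x, t)\<bar> \<le> 2 * \<bar>\<kappa>\<bar> * (x - v * t)" "\<bar>?\<psi> (x, t)\<bar> \<le> 2 * \<bar>\<kappa>\<bar> * (L - (x - v * t))" if "x \<in> I t" for x t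
  proof -
    have y: "0 < x - v * t" "x - v * t < L"
      using that by (auto simp: moving_interval_def)
    \<comment> \<open>The two phases agree at the left end point and differ by a multiple of a full turn at the right one.\<close>
    let ?a = "p * (t + x) + \<theta>" and ?b = "q * (t - x) + \<theta>"
    have "\<bar>?\<psi> (x, t)\<bar> \<le> \<bar>?a - ?b\<bar>"
      using abs_cos_diff_le[of ?a ?b] by (simp add: standing_wave_def)
    also have "?a - ?b = 2 * \<kappa> * (x - v * t)"
      by (simp add: p_def q_def algebra_simps)
    finally show "\<bar>?\<psi> (x, t)\<bar> \<le> 2 * \<bar>\<kappa>\<bar> * (x - v * t)"
      using y by (simp add: abs_mult)
    have "2 * \<kappa> * L = 2 * pi * of_int n"
      using L by (simp add: \<kappa>_def)
    then have "cos (?b + 2 * \<kappa> * L) = cos ?b"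
      by (simp only: cos_add[of ?b] cos_int_2pin sin_int_2pin mult_1_right mult_zero_right diff_0_right)
    then have "\<bar>?\<psi> (x, t)\<bar> \<le> \<bar>?a - (?b + 2 * \<kappa> * L)\<bar>"
      using abs_cos_diff_le[of ?a "?b + 2 * \<kappa> * L"] by (simp add: standing_wave_def)
    also have "?a - (?b + 2 * \<kappa> * L) = - (2 * \<kappa> * (L - (x - v * t)))"
      by (simp add: p_def q_def algebra_simps)
    finally show "\<bar>?\<psi> (x, t)\<bar> \<le> 2 * \<bar>\<kappa>\<bar> * (L - (x - v * t))"
      using y by (simp add: abs_mult)
  qed
  have cont\<psi>: "continuous_on UNIV ?\<psi>" and contS: "continuous_on UNIV ?S"
    using smooth_weight.m_continuous[OF w\<psi>] smooth_weight.m_continuous[OF wS] .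
  have A_cont: "continuous_on {0..T} A" if "T > 0" for T
    unfolding A_def using that
    by (intro continuous_intros slice_pairing_continuous[OF cont(3)] slice_pairing_continuous[OF cont(2)] cont\<psi> contS)
  have "continuous_on {0..<T} A" if "T > 0" for T
    using that by (intro continuous_on_subset[OF A_cont]) auto
  then show "continuous_on {0..} A"
    unfolding continuous_on_eq_continuous_within
  proof (intro ballI)
    fix t :: real assume *: "\<And>T. T > 0 \<Longrightarrow> \<forall>x\<in>{0..<T}. continuous (at x within {0..<T}) A" and "t \<in> {0..}"
    then have "continuous (at t within {0..<t+1}) A" by auto
    moreover have "at t within {0..<t+1} = at t within {0..}"
      by (rule at_within_nhd[of _ "{..<t+1}"]) auto
    ultimately show "continuous (at t within {0..}) A" by simp
  qed
  fix \<beta> :: "real \<Rightarrow> real" and c d :: real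
  assume \<beta>: "\<And>k. Ck k \<beta>" "0 < c" "c < d" "\<And>t. \<beta> t \<noteq> 0 \<Longrightarrow> t \<in> {c..d}"
  interpret t\<psi>: tested_wave L v \<phi>0 \<phi>1 \<phi> \<phi>x \<phi>t ?\<psi> ?\<psi>t ?\<psi>x "1 + \<bar>p\<bar> + (1 + \<bar>q\<bar>)" \<beta> c d
    using weak_wave_axioms w\<psi> \<beta> by (intro tested_wave.intro tested_wave_axioms.intro)
  have t\<psi>t: "tested_wave L v \<phi>0 \<phi>1 \<phi> \<phi>x \<phi>t ?\<psi>t ?\<psi>tt ?\<psi>tx ((1 + \<bar>p\<bar>) * \<bar>p\<bar> + (1 + \<bar>q\<bar>) * \<bar>q\<bar>) \<beta> c d"
    using weak_wave_axioms w\<psi>t \<beta> by (intro tested_wave.intro tested_wave_axioms.intro)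
  have "time_pairing \<beta> \<phi>t ?\<psi>t + time_pairing (deriv \<beta>) \<phi>t ?\<psi> - time_pairing \<beta> \<phi>x ?\<psi>x = 0"
    by (rule t\<psi>.wave_equation_tested[OF K])
  moreover have "time_pairing \<beta> \<phi> ?\<psi>tt + time_pairing (deriv \<beta>) \<phi> ?\<psi>t + time_pairing \<beta> \<phi>t ?\<psi>t = 0"
    by (rule time_derivative_tested[OF t\<psi>t])
  moreover have "time_pairing \<beta> \<phi>x ?\<psi>x = - time_pairing \<beta> \<phi> ?\<psi>tt" "time_pairing (deriv \<beta>) \<phi>x ?S = - time_pairing (deriv \<beta>) \<phi> ?\<psi>t"
    by (rule time_pairing_by_parts[OF w\<psi>x] time_pairing_by_parts[OF wS])+
  ultimately have "time_pairing (deriv \<beta>) \<phi>t ?\<psi> + time_pairing (deriv \<beta>) \<phi>x ?S = 0"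
    by linarith
  moreover have "has_bochner_integral lebesgue (\<lambda>t. indicator {0<..} t *\<^sub>R (deriv \<beta> t * SP \<phi>t ?\<psi> t)
      + indicator {0<..} t *\<^sub>R (deriv \<beta> t * SP \<phi>x ?S t)) (time_pairing (deriv \<beta>) \<phi>t ?\<psi> + time_pairing (deriv \<beta>) \<phi>x ?S)"
    by (intro has_bochner_integral_add time_pairing_has_integral[OF _ _ t\<psi>.\<beta>'_facts] cont\<psi> contS) auto
  note has_bochner_integral_integral_eq[OF this]
  ultimately show "(LINT t:{0<..}|lebesgue. deriv \<beta> t * A t) = 0"
    by (simp add: A_def set_lebesgue_integral_def algebra_simps)
qed

end

section \<open>Fourier series and Parseval's identity\<close>

definition trig :: "real \<Rightarrow> int \<Rightarrow> real \<Rightarrow> complex" where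
  "trig P n x = cis (2 * pi * of_int n * x / P)"

lemma trig_simps [simp]:
  "trig P 0 x = 1" "trig P n x * trig P m x = trig P (n + m) x" "cnj (trig P n x) = trig P (- n) x"
  "cmod (trig P n x) = 1"
  by (simp_all add: trig_def cis_mult cis_cnj ring_distribs add_divide_distrib)

lemma trig_continuous: "continuous_on UNIV (trig P n)"
proof -
  have "trig P n = (\<lambda>x. exp (\<i> * of_real (2 * pi * of_int n / P) * of_real x))"
    by (simp add: fun_eq_iff trig_def cis_conv_exp mult_ac)
  then show ?thesis
    by (simp only:) (intro continuous_intros)
qed

lemma trig_has_integral:
  assumes P: "P > 0"
  shows "has_bochner_integral lebesgue (\<lambda>x. indicator {0<..<P} x *\<^sub>R trig P n x) (if n = 0 then of_real P else 0)"
proof -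
  have int: "set_integrable lebesgue {0<..<P} (trig P n)"
    by (rule set_integrable_subset[of _ "{0..P}"])
      (auto intro!: absolutely_integrable_continuous_real continuous_on_subset[OF trig_continuous])
  have "(LINT x:{0<..<P}|lebesgue. trig P n x) = (if n = 0 then of_real P else 0)"
  proof (cases "n = 0")
    case True
    have "(LINT x:{0<..<P}|lebesgue. 1 :: complex) = of_real P"
      using P by (simp add: set_lebesgue_integral_def scaleR_conv_of_real)
    with True show ?thesis by simp
  next
    case False
    define c where "c = 2 * pi * of_int n / P"
    have c: "c \<noteq> 0"
      using False P by (simp add: c_def)
    have *: "trig P n x = exp (\<i> * of_real c * of_real x)" for x
      by (simp add: trig_def c_def cis_conv_exp mult_ac)
    have "((\<lambda>x. exp (\<i> * of_real c * of_real x) / (\<i> * of_real c)) has_vector_derivative trig P n x) (at x within {0..P})" for x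
      unfolding * by (rule has_vector_derivative_real_field)
        (use c in \<open>auto intro!: derivative_eq_intros\<close>)
    then have "(trig P n has_integral (exp (\<i> * of_real c * of_real P) / (\<i> * of_real c) - exp (\<i> * of_real c * of_real 0) / (\<i> * of_real c))) {0..P}"
      using P by (intro fundamental_theorem_of_calculus) auto
    moreover have "exp (\<i> * of_real c * of_real P) = 1"
    proof -
      have "\<i> * of_real c * of_real P = \<i> * of_real (2 * pi * of_int n)"
        using P by (simp add: c_def)
      then have "exp (\<i> * of_real c * of_real P) = cis (2 * pi * of_int n)"
        by (simp only: cis_conv_exp)
      then show ?thesis
        by (simp add: cis.ctr sin_int_2pin cos_int_2pin complex_eq_iff)
    qed
    ultimately have "integral {0<..<P} (trig P n) = 0"
      by (simp add: integral_open_interval_real[symmetric] integral_unique)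
    then show ?thesis
      using False set_lebesgue_integral_eq_integral(2)[OF int] by simp
  qed
  with int show ?thesis
    by (simp add: has_bochner_integral_iff set_integrable_def set_lebesgue_integral_def)
qed

definition fourier_coeff :: "real \<Rightarrow> (real \<Rightarrow> real) \<Rightarrow> int \<Rightarrow> complex" where
  "fourier_coeff P f n = (LINT x:{0<..<P}|lebesgue. of_real (f x) * trig P (- n) x)"

lemma L2_complex_integrable:
  fixes g :: "real \<Rightarrow> complex"
  assumes f: "f \<in> L2_space {a<..<b}" and g: "continuous_on UNIV g" and C: "\<And>x. x \<in> {a<..<b} \<Longrightarrow> cmod (g x) \<le> C"
  shows "set_integrable lebesgue {a<..<b} (\<lambda>x. of_real (f x) * g x)"
  unfolding set_integrable_def
proof (rule Bochner_Integration.integrable_bound)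
  have "set_integrable lebesgue {a<..<b} (\<lambda>x. f x * C)"
    by (intro L2_continuous_integrable f) auto
  then show "integrable lebesgue (\<lambda>x. indicator {a<..<b} x *\<^sub>R (f x * C))"
    by (simp add: set_integrable_def)
  have "(\<lambda>x. complex_of_real (indicator {a<..<b} x *\<^sub>R f x) * g x) \<in> borel_measurable lebesgue"
    using f by (intro borel_measurable_times continuous_imp_lebesgue_measurable[OF g]
        measurable_compose[OF _ borel_measurable_of_real]) (simp add: L2_space_def set_borel_measurable_def)
  then show "(\<lambda>x. indicator {a<..<b} x *\<^sub>R (complex_of_real (f x) * g x)) \<in> borel_measurable lebesgue"
    by (simp add: scaleR_conv_of_real mult.assoc)
  show "AE x in lebesgue. norm (indicator {a<..<b} x *\<^sub>R (complex_of_real (f x) * g x))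
     \<le> norm (indicator {a<..<b} x *\<^sub>R (f x * C))"
  proof (rule AE_I2)
    fix x
    show "norm (indicator {a<..<b} x *\<^sub>R (complex_of_real (f x) * g x))
     \<le> norm (indicator {a<..<b} x *\<^sub>R (f x * C))"
    proof (cases "x \<in> {a<..<b}")
      case True
      from C[OF this] have "cmod (g x) \<le> \<bar>C\<bar>" by simp
      with True show ?thesis
        by (simp add: norm_mult abs_mult mult_left_mono)
    qed simp
  qed
qed

lemma fourier_coeff_cnj:
  assumes f: "f \<in> L2_space {0<..<P}"
  shows "has_bochner_integral lebesgue (\<lambda>x. indicator {0<..<P} x *\<^sub>R (of_real (f x) * trig P n x)) (cnj (fourier_coeff P f n))"
proof -
  have "set_integrable lebesgue {0<..<P} (\<lambda>x. of_real (f x) * trig P (- n) x)"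
    by (rule L2_complex_integrable[OF f trig_continuous, where C = 1]) simp
  then have "has_bochner_integral lebesgue (\<lambda>x. indicator {0<..<P} x *\<^sub>R (of_real (f x) * trig P (- n) x)) (fourier_coeff P f n)"
    by (simp add: has_bochner_integral_iff fourier_coeff_def set_integrable_def set_lebesgue_integral_def)
  from has_bochner_integral_bounded_linear[OF bounded_linear_cnj this] show ?thesis
    by simp
qed

text \<open>Completing the square in each coefficient: the first two terms on the right give Bessel's inequality,
the last one shows that the Fourier coefficients are the best choice.\<close>

lemma square_distance_trig_sum:
  assumes P: "P > 0" and f: "f \<in> L2_space {0<..<P}" and F: "finite F"
  shows "(LINT x:{0<..<P}|lebesgue. (cmod (of_real (f x) - (\<Sum>n\<in>F. b n * trig P n x)))\<^sup>2) =
    (LINT x:{0<..<P}|lebesgue. (f x)\<^sup>2) - (\<Sum>n\<in>F. (cmod (fourier_coeff P f n))\<^sup>2) / P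
      + P * (\<Sum>n\<in>F. (cmod (b n - fourier_coeff P f n / of_real P))\<^sup>2)"
proof -
  let ?i = "\<lambda>x. indicator {0<..<P} x :: real"
  let ?c = "fourier_coeff P f"
  have 1: "has_bochner_integral lebesgue (\<lambda>x. ?i x *\<^sub>R (f x)\<^sup>2) (LINT x:{0<..<P}|lebesgue. (f x)\<^sup>2)"
    using f by (simp add: L2_space_def has_bochner_integral_iff set_integrable_def set_lebesgue_integral_def)
  have 2: "has_bochner_integral lebesgue (\<lambda>x. Re (\<Sum>n\<in>F. b n * (?i x *\<^sub>R (of_real (f x) * trig P n x))))
      (Re (\<Sum>n\<in>F. b n * cnj (?c n)))"
    by (intro has_bochner_integral_bounded_linear[OF bounded_linear_Re] has_bochner_integral_sum
        has_bochner_integral_mult_right fourier_coeff_cnj f)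
  have 3: "has_bochner_integral lebesgue (\<lambda>x. Re (\<Sum>n\<in>F. \<Sum>m\<in>F. (b n * cnj (b m)) * (?i x *\<^sub>R trig P (n - m) x)))
      (Re (\<Sum>n\<in>F. \<Sum>m\<in>F. (b n * cnj (b m)) * (if n - m = 0 then of_real P else 0)))"
    by (intro has_bochner_integral_bounded_linear[OF bounded_linear_Re] has_bochner_integral_sum
        has_bochner_integral_mult_right trig_has_integral P)
  have pt: "?i x *\<^sub>R (cmod (of_real (f x) - (\<Sum>n\<in>F. b n * trig P n x)))\<^sup>2 =
      ?i x *\<^sub>R (f x)\<^sup>2 - 2 * Re (\<Sum>n\<in>F. b n * (?i x *\<^sub>R (of_real (f x) * trig P n x)))
      + Re (\<Sum>n\<in>F. \<Sum>m\<in>F. (b n * cnj (b m)) * (?i x *\<^sub>R trig P (n - m) x))" for x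
  proof (cases "x \<in> {0<..<P}")
    case True
    define g where "g = (\<Sum>n\<in>F. b n * trig P n x)"
    have "(cmod (of_real (f x) - g))\<^sup>2 = (f x)\<^sup>2 - 2 * (f x * Re g) + Re (g * cnj g)"
      unfolding cmod_power2 by (simp add: power2_eq_square algebra_simps)
    moreover have a: "(\<Sum>n\<in>F. b n * (?i x *\<^sub>R (of_real (f x) * trig P n x))) = of_real (f x) * g"
      using True by (simp add: g_def sum_distrib_left mult_ac)
    moreover have "g * cnj g = (\<Sum>n\<in>F. \<Sum>m\<in>F. (b n * cnj (b m)) * (trig P n x * trig P (- m) x))"
      by (simp only: g_def cnj_sum sum_product complex_cnj_mult trig_simps mult_ac)
    then have b: "(\<Sum>n\<in>F. \<Sum>m\<in>F. (b n * cnj (b m)) * (?i x *\<^sub>R trig P (n - m) x)) = g * cnj g"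
      using True by simp
    ultimately show ?thesis
      unfolding a b g_def[symmetric] using True by simp
  qed simp
  have "(LINT x:{0<..<P}|lebesgue. (cmod (of_real (f x) - (\<Sum>n\<in>F. b n * trig P n x)))\<^sup>2) =
     (LINT x|lebesgue. ?i x *\<^sub>R (cmod (of_real (f x) - (\<Sum>n\<in>F. b n * trig P n x)))\<^sup>2)"
    by (simp only: set_lebesgue_integral_def)
  also have "\<dots> = (LINT x:{0<..<P}|lebesgue. (f x)\<^sup>2) - 2 * Re (\<Sum>n\<in>F. b n * cnj (?c n))
      + Re (\<Sum>n\<in>F. \<Sum>m\<in>F. (b n * cnj (b m)) * (if n - m = 0 then of_real P else 0))"
    unfolding pt
    by (rule has_bochner_integral_integral_eq)
      (intro has_bochner_integral_add has_bochner_integral_diff has_bochner_integral_mult_right 1 2 3)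
  also have "(\<Sum>n\<in>F. \<Sum>m\<in>F. (b n * cnj (b m)) * (if n - m = 0 then of_real P else 0)) = (\<Sum>n\<in>F. b n * cnj (b n) * of_real P)"
    using F by (intro sum.cong refl) (simp add: if_distrib[of "\<lambda>z. _ * z"] cong: if_cong)
  also have "(LINT x:{0<..<P}|lebesgue. (f x)\<^sup>2) - 2 * Re (\<Sum>n\<in>F. b n * cnj (?c n)) + Re (\<Sum>n\<in>F. b n * cnj (b n) * of_real P)
     = (LINT x:{0<..<P}|lebesgue. (f x)\<^sup>2)
       + (\<Sum>n\<in>F. - 2 * Re (b n * cnj (?c n)) + Re (b n * cnj (b n) * of_real P))"
    by (simp add: sum.distrib sum_subtractf sum_distrib_left sum_negf Re_sum)
  also have "(\<Sum>n\<in>F. - 2 * Re (b n * cnj (?c n)) + Re (b n * cnj (b n) * of_real P))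
     = (\<Sum>n\<in>F. - (cmod (?c n))\<^sup>2 / P + P * (cmod (b n - ?c n / of_real P))\<^sup>2)"
    unfolding cmod_power2 using P by (intro sum.cong refl) (simp add: power2_eq_square field_simps)
  also have "\<dots> = - (\<Sum>n\<in>F. (cmod (?c n))\<^sup>2) / P + P * (\<Sum>n\<in>F. (cmod (b n - ?c n / of_real P))\<^sup>2)"
    by (simp add: sum.distrib sum_subtractf sum_distrib_left sum_negf sum_divide_distrib)
  finally show ?thesis by simp
qed

section \<open>Trigonometric polynomials\<close>

definition trig_polys :: "real \<Rightarrow> (real \<Rightarrow> complex) set" where
  "trig_polys P = {g. \<exists>F b. finite F \<and> g = (\<lambda>x. \<Sum>n\<in>F. b n * trig P n x)}"

lemma trig_polys_monomial: "(\<lambda>x. c * trig P n x) \<in> trig_polys P"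
  unfolding trig_polys_def by (auto intro!: exI[of _ "{n}"] exI[of _ "\<lambda>_. c"])

lemma trig_polys_add:
  assumes "f \<in> trig_polys P" "g \<in> trig_polys P"
  shows "(\<lambda>x. f x + g x) \<in> trig_polys P"
proof -
  obtain F b where F: "finite F" "f = (\<lambda>x. \<Sum>n\<in>F. b n * trig P n x)"
    using assms(1) by (auto simp: trig_polys_def)
  obtain G c where G: "finite G" "g = (\<lambda>x. \<Sum>n\<in>G. c n * trig P n x)"
    using assms(2) by (auto simp: trig_polys_def)
  let ?b = "\<lambda>n. (if n \<in> F then b n else 0) + (if n \<in> G then c n else 0)"
  have f: "f x = (\<Sum>n\<in>F \<union> G. (if n \<in> F then b n else 0) * trig P n x)" for x
    unfolding F(2) using F(1) G(1) by (intro sum.mono_neutral_cong_left) auto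
  have g: "g x = (\<Sum>n\<in>F \<union> G. (if n \<in> G then c n else 0) * trig P n x)" for x
    unfolding G(2) using F(1) G(1) by (intro sum.mono_neutral_cong_left) auto
  have "f x + g x = (\<Sum>n\<in>F \<union> G. ?b n * trig P n x)" for x
    unfolding f g by (simp only: sum.distrib distrib_right)
  then show ?thesis
    unfolding trig_polys_def using F(1) G(1) by (auto intro!: exI[of _ "F \<union> G"] exI[of _ ?b])
qed

lemma trig_polys_sum:
  assumes "\<And>i. i \<in> A \<Longrightarrow> f i \<in> trig_polys P"
  shows "(\<lambda>x. \<Sum>i\<in>A. f i x) \<in> trig_polys P"
  using assms
proof (induction A rule: infinite_finite_induct)
  case (insert a A)
  then show ?case
    using trig_polys_add[of "f a" P "\<lambda>x. \<Sum>i\<in>A. f i x"] by simp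
qed (use trig_polys_monomial[of 0] in simp_all)

lemma trig_polys_mult:
  assumes "f \<in> trig_polys P" "g \<in> trig_polys P"
  shows "(\<lambda>x. f x * g x) \<in> trig_polys P"
proof -
  obtain F b where F: "f = (\<lambda>x. \<Sum>n\<in>F. b n * trig P n x)"
    using assms(1) by (auto simp: trig_polys_def)
  obtain G c where G: "g = (\<lambda>x. \<Sum>n\<in>G. c n * trig P n x)"
    using assms(2) by (auto simp: trig_polys_def)
  have "f x * g x = (\<Sum>n\<in>F. \<Sum>m\<in>G. (b n * c m) * trig P (n + m) x)" for x
    unfolding F G sum_product trig_simps(2)[symmetric] by (simp only: mult_ac)
  then show ?thesis
    by (simp only:) (intro trig_polys_sum trig_polys_monomial)
qed

lemma real_polynomial_trig_poly:
  assumes "real_polynomial_function p"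
  shows "(\<lambda>x. complex_of_real (p (trig P 1 x))) \<in> trig_polys P"
  using assms
proof induction
  case (linear l)
  interpret bounded_linear l by fact
  have "complex_of_real (l (trig P 1 x)) = ((l 1 - \<i> * l \<i>) / 2) * trig P 1 x + ((l 1 + \<i> * l \<i>) / 2) * trig P (- 1) x" for x
  proof -
    let ?z = "trig P 1 x"
    have "?z = Re ?z *\<^sub>R 1 + Im ?z *\<^sub>R \<i>"
      by (simp add: complex_eq_iff)
    then have "l ?z = l (Re ?z *\<^sub>R 1 + Im ?z *\<^sub>R \<i>)"
      by (rule arg_cong)
    also have "\<dots> = Re ?z * l 1 + Im ?z * l \<i>"
      by (simp only: add scaleR real_scaleR_def)
    finally show ?thesis
      by (simp add: trig_def complex_eq_iff field_simps)
  qed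
  then show ?case
    by (simp only:) (intro trig_polys_add trig_polys_monomial)
next
  case (const c)
  then show ?case
    using trig_polys_monomial[of "of_real c" P 0] by simp
next
  case (add f g)
  then show ?case
    using trig_polys_add[OF add.IH] by simp
next
  case (mult f g)
  then show ?case
    using trig_polys_mult[OF mult.IH] by simp
qed

text \<open>A function that vanishes near both end points lives on the unit circle, where polynomials in the real
and imaginary part are dense by the Stone-Weierstrass theorem. Vanishing near the end points makes the
transplanted function continuous at \<open>1\<close>, where the argument jumps.\<close>

lemma continuous_trig_approx:
  fixes h :: "real \<Rightarrow> real"
  assumes P: "P > 0" and h: "continuous_on UNIV h" and \<delta>: "0 < \<delta>" "\<And>x. h x \<noteq> 0 \<Longrightarrow> x \<in> {\<delta>..P - \<delta>}" and e: "e > 0"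
  obtains g where "g \<in> trig_polys P" "\<And>x. x \<in> {0<..<P} \<Longrightarrow> cmod (of_real (h x) - g x) \<le> e"
proof -
  define G where "G z = h (P * Arg2pi z / (2 * pi))" for z
  have "continuous (at z within sphere 0 1) G" if z: "z \<in> sphere 0 1" for z
  proof (cases "z = 1")
    case False
    have "z \<notin> \<real>\<^sub>\<ge>\<^sub>0"
    proof
      assume "z \<in> \<real>\<^sub>\<ge>\<^sub>0"
      then obtain r where "z = of_real r" "r \<ge> 0"
        by (auto simp: nonneg_Reals_def)
      with z False show False by simp
    qed
    then have "isCont Arg2pi z"
      by (rule continuous_at_Arg2pi)
    moreover have "isCont h y" for y
      using h by (simp add: continuous_on_eq_continuous_at)
    ultimately have "isCont G z"
      unfolding G_def by (intro continuous_intros isCont_o2[of z _ h]) auto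
    then show ?thesis
      by (rule continuous_at_imp_continuous_within)
  next
    case True
    \<comment> \<open>On an arc around \<open>1\<close> of half angle \<open>\<eta>\<close> the transplanted function is zero.\<close>
    define \<eta> where "\<eta> = min (2 * pi * \<delta> / P) pi"
    have \<eta>: "0 < \<eta>" "\<eta> \<le> pi" "\<eta> \<le> 2 * pi * \<delta> / P"
      using P \<delta>(1) by (auto simp: \<eta>_def)
    have zero: "G w = 0" if w: "w \<in> sphere 0 1" "cos \<eta> < Re w" for w
    proof (rule ccontr)
      assume "G w \<noteq> 0"
      then have "P * Arg2pi w / (2 * pi) \<in> {\<delta>..P - \<delta>}"
        unfolding G_def by (rule \<delta>(2))
      then have "2 * pi * \<delta> / P \<le> Arg2pi w" "Arg2pi w \<le> 2 * pi - 2 * pi * \<delta> / P"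
        using P by (auto simp: field_simps)
      with \<eta> have A: "\<eta> \<le> Arg2pi w" "Arg2pi w \<le> 2 * pi - \<eta>" by linarith+
      have "Re w = cos (Arg2pi w)"
        using cos_Arg2pi[of w] w(1) by simp
      also have "\<dots> \<le> cos \<eta>"
      proof (cases "Arg2pi w \<le> pi")
        case True
        then show ?thesis using A \<eta> by (intro cos_monotone_0_pi_le) auto
      next
        case False
        have "cos (2 * pi - Arg2pi w) \<le> cos \<eta>"
          using A \<eta> False by (intro cos_monotone_0_pi_le) auto
        then show ?thesis by simp
      qed
      finally show False using w(2) by simp
    qed
    have "cos \<eta> < cos 0"
      using \<eta> by (intro cos_monotone_0_pi) auto
    then have z1: "cos \<eta> < Re z" using True by simp
    have "open {w. cos \<eta> < Re w}"
      by (intro open_Collect_less continuous_intros)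
    then have "eventually (\<lambda>w. w \<in> {w. cos \<eta> < Re w}) (nhds z)"
      using z1 by (intro eventually_nhds_in_open) auto
    then have "eventually (\<lambda>w. cos \<eta> < Re w) (at z within sphere 0 1)"
      using filter_leD[OF at_within_le_nhds] by fastforce
    then have "eventually (\<lambda>w. 0 = G w) (at z within sphere 0 1)"
      by (rule eventually_rev_mp) (auto simp: eventually_at_filter zero intro!: always_eventually)
    then have "(G \<longlongrightarrow> 0) (at z within sphere 0 1)"
      by (rule Lim_transform_eventually[OF tendsto_const])
    then show ?thesis
      using zero[OF z z1] by (simp add: continuous_within)
  qed
  then have "continuous_on (sphere 0 1) G"
    by (simp add: continuous_on_eq_continuous_within)
  then obtain p where p: "real_polynomial_function p" "\<And>z. z \<in> sphere 0 1 \<Longrightarrow> \<bar>G z - p z\<bar> < e"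
    using Stone_Weierstrass_real_polynomial_function[OF compact_sphere _ e] by metis
  show thesis
  proof (rule that[OF real_polynomial_trig_poly[OF p(1)]])
    fix x assume x: "x \<in> {0<..<P}"
    have "2 * pi * x < P * (2 * pi)"
      using x by (simp add: mult.commute)
    then have "Arg2pi (trig P 1 x) = 2 * pi * x / P"
      using x P by (intro Arg2pi_unique[of 1]) (auto simp: trig_def cis_conv_exp pos_divide_less_eq mult_ac)
    then have "G (trig P 1 x) = h x"
      using P by (simp add: G_def)
    moreover have "\<bar>G (trig P 1 x) - p (trig P 1 x)\<bar> < e"
      by (rule p(2)) simp
    ultimately show "cmod (of_real (h x) - of_real (p (trig P 1 x))) \<le> e"
      by (simp flip: of_real_diff)
  qed
qed

section \<open>Density of trigonometric polynomials\<close>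

lemma L2_triangle_square:
  assumes f: "f \<in> L2_space S" and g: "g \<in> L2_space S" and h: "h \<in> L2_space S"
  shows "(LINT x:S|lebesgue. (f x - h x)\<^sup>2) \<le> 2 * (LINT x:S|lebesgue. (f x - g x)\<^sup>2) + 2 * (LINT x:S|lebesgue. (g x - h x)\<^sup>2)"
proof -
  have int: "set_integrable lebesgue S (\<lambda>x. (f x - g x)\<^sup>2)" "set_integrable lebesgue S (\<lambda>x. (g x - h x)\<^sup>2)"
    "set_integrable lebesgue S (\<lambda>x. (f x - h x)\<^sup>2)"
    using L2_diff[OF f g] L2_diff[OF g h] L2_diff[OF f h] by (auto simp: L2_space_def)
  have "(f x - h x)\<^sup>2 \<le> 2 * (f x - g x)\<^sup>2 + 2 * (g x - h x)\<^sup>2" for x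
    using zero_le_power2[of "(f x - g x) - (g x - h x)"] by (simp add: power2_eq_square algebra_simps)
  then have "(LINT x:S|lebesgue. (f x - h x)\<^sup>2) \<le> (LINT x:S|lebesgue. 2 * (f x - g x)\<^sup>2 + 2 * (g x - h x)\<^sup>2)"
    using int by (intro set_integral_mono set_integral_add set_integrable_mult_right) auto
  also have "\<dots> = 2 * (LINT x:S|lebesgue. (f x - g x)\<^sup>2) + 2 * (LINT x:S|lebesgue. (g x - h x)\<^sup>2)"
    using int by (subst set_integral_add) auto
  finally show ?thesis .
qed

definition clamp_real :: "real \<Rightarrow> real \<Rightarrow> real" where
  "clamp_real M y = max (- M) (min M y)"

lemma clamp_real_bounds: "M \<ge> 0 \<Longrightarrow> \<bar>clamp_real M y\<bar> \<le> M" "M \<ge> 0 \<Longrightarrow> \<bar>clamp_real M y\<bar> \<le> \<bar>y\<bar>"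
  and clamp_real_eq: "\<bar>y\<bar> \<le> M \<Longrightarrow> clamp_real M y = y"
  by (auto simp: clamp_real_def)

lemma clamp_real_continuous: "continuous_on UNIV (clamp_real M)"
  unfolding clamp_real_def by (intro continuous_intros)

lemma square_integral_tendsto_0:
  fixes d :: "nat \<Rightarrow> real \<Rightarrow> real"
  assumes w: "set_integrable lebesgue S (\<lambda>x. (w x)\<^sup>2)"
    and d: "\<And>n. set_borel_measurable lebesgue S (d n)"
    and bound: "\<And>n x. x \<in> S \<Longrightarrow> \<bar>d n x\<bar> \<le> \<bar>w x\<bar>"
    and lim: "AE x in lebesgue. x \<in> S \<longrightarrow> (\<lambda>n. d n x) \<longlonglongrightarrow> 0"
  shows "(\<lambda>n. LINT x:S|lebesgue. (d n x)\<^sup>2) \<longlonglongrightarrow> 0"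
proof -
  have "(\<lambda>n. LINT x|lebesgue. indicator S x *\<^sub>R (d n x)\<^sup>2) \<longlonglongrightarrow> (LINT x::real|lebesgue. 0)"
  proof (rule integral_dominated_convergence[OF _ _ w[unfolded set_integrable_def]])
    show "(\<lambda>x. indicator S x *\<^sub>R (d n x)\<^sup>2) \<in> borel_measurable lebesgue" for n
      using set_measurable_mult[OF d d, of n n] by (simp add: set_borel_measurable_def power2_eq_square)
    show "AE x in lebesgue. (\<lambda>n. indicator S x *\<^sub>R (d n x)\<^sup>2) \<longlonglongrightarrow> 0"
      using lim
    proof eventually_elim
      case (elim x)
      show ?case
      proof (cases "x \<in> S")
        case True
        with elim have "(\<lambda>n. d n x) \<longlonglongrightarrow> 0" by simp
        from tendsto_power[OF this, of 2] True show ?thesis by simp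
      qed simp
    qed
    show "AE x in lebesgue. norm (indicator S x *\<^sub>R (d n x)\<^sup>2) \<le> indicator S x *\<^sub>R (w x)\<^sup>2" for n
      using bound by (auto intro!: AE_I2 simp: indicator_def abs_le_square_iff)
  qed simp
  then show ?thesis by (simp add: set_lebesgue_integral_def)
qed

text \<open>After truncating the values at height \<open>M\<close>, a measurable function is almost everywhere a limit of
continuous functions, which may be truncated at the same height and cut off near the end points; both
steps converge in $L^2$ by dominated convergence.\<close>

lemma L2_continuous_approx:
  assumes P: "P > 0" and f: "f \<in> L2_space {0<..<P}" and e: "e > 0"
  obtains h \<delta> where "continuous_on UNIV h" "\<delta> > 0" "\<And>x. h x \<noteq> 0 \<Longrightarrow> x \<in> {\<delta>..P - \<delta>}"
    "(LINT x:{0<..<P}|lebesgue. (f x - h x)\<^sup>2) < e"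
proof -
  let ?S = "{0<..<P}"
  define F where "F x = indicator ?S x *\<^sub>R f x" for x
  have F_meas: "F \<in> borel_measurable lebesgue"
    using f by (simp add: F_def [abs_def] L2_space_def set_borel_measurable_def)
  have F: "F x = f x" if "x \<in> ?S" for x
    using that by (simp add: F_def)
  have "F measurable_on UNIV"
    using measurable_on_iff_borel_measurable[of UNIV F] F_meas by simp
  then obtain N g where N: "negligible N" and g: "\<And>n::nat. continuous_on UNIV (g n)" "\<And>x. x \<notin> N \<Longrightarrow> (\<lambda>n. g n x) \<longlonglongrightarrow> F x"
    unfolding measurable_on_def by auto
  have cF_meas: "(\<lambda>x. clamp_real M (F x)) \<in> borel_measurable lebesgue" for M
    using F_meas by (intro measurable_compose[OF F_meas] borel_measurable_continuous_onI clamp_real_continuous)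
  have 1: "(\<lambda>M. LINT x:?S|lebesgue. (f x - clamp_real (real M) (F x))\<^sup>2) \<longlonglongrightarrow> 0"
  proof (rule square_integral_tendsto_0[where w = "\<lambda>x. 2 * f x"])
    show "set_integrable lebesgue ?S (\<lambda>x. (2 * f x)\<^sup>2)"
      using L2_cmult[OF f, of 2] by (simp add: L2_space_def)
    show "set_borel_measurable lebesgue ?S (\<lambda>x. f x - clamp_real (real M) (F x))" for M
    proof -
      have "set_borel_measurable lebesgue ?S (\<lambda>x. - clamp_real (real M) (F x))"
        by (intro measurable_imp_set_measurable borel_measurable_uminus cF_meas) simp
      from set_measurable_add[where f = f, OF _ this] f show ?thesis
        by (simp add: L2_space_def)
    qed
    show "\<bar>f x - clamp_real (real M) (F x)\<bar> \<le> \<bar>2 * f x\<bar>" if "x \<in> ?S" for M x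
      using F[OF that] clamp_real_bounds(2)[of "real M" "f x"] by simp
    show "AE x in lebesgue. x \<in> ?S \<longrightarrow> (\<lambda>M. f x - clamp_real (real M) (F x)) \<longlonglongrightarrow> 0"
    proof (intro AE_I2 impI)
      fix x assume "x \<in> ?S"
      have "eventually (\<lambda>M. f x - clamp_real (real M) (F x) = 0) sequentially"
        using eventually_ge_at_top[of "nat \<lceil>\<bar>f x\<bar>\<rceil>"]
      proof eventually_elim
        case (elim M)
        then have "\<bar>f x\<bar> \<le> real M" by linarith
        with F[OF \<open>x \<in> ?S\<close>] show ?case by (simp add: clamp_real_eq)
      qed
      then show "(\<lambda>M. f x - clamp_real (real M) (F x)) \<longlonglongrightarrow> 0"
        by (rule tendsto_eventually)
    qed
  qed
  have "eventually (\<lambda>M. (LINT x:?S|lebesgue. (f x - clamp_real (real M) (F x))\<^sup>2) < e / 4) sequentially"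
    using e by (intro order_tendstoD(2)[OF 1]) simp
  then obtain M where M: "(LINT x:?S|lebesgue. (f x - clamp_real (real M) (F x))\<^sup>2) < e / 4"
    unfolding eventually_sequentially by blast
  let ?c = "\<lambda>x. clamp_real (real M) (F x)"
  define h where "h n x = cutoff P n x * clamp_real (real M) (g n x)" for n x
  have h_cont: "continuous_on UNIV (h n)" for n
    unfolding h_def using Ck_imp_continuous[OF Ck_cutoff[OF bounded_linear_ident, of 0 P n 0]]
    by (intro continuous_intros continuous_on_compose2[OF clamp_real_continuous g(1)]) auto
  have h_bound: "\<bar>h n x\<bar> \<le> real M" for n x
  proof -
    have "cutoff P n x * \<bar>clamp_real (real M) (g n x)\<bar> \<le> 1 * real M"
      by (intro mult_mono cutoff_bounds clamp_real_bounds) auto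
    then show ?thesis
      using cutoff_bounds(1)[of P n x] by (simp add: h_def abs_mult)
  qed
  have 2: "(\<lambda>n. LINT x:?S|lebesgue. (?c x - h n x)\<^sup>2) \<longlonglongrightarrow> 0"
  proof (rule square_integral_tendsto_0[where w = "\<lambda>x. 2 * real M"])
    show "set_integrable lebesgue ?S (\<lambda>x. (2 * real M)\<^sup>2)"
      by (rule set_integral_const_lmeasurable(1)) simp
    show "set_borel_measurable lebesgue ?S (\<lambda>x. ?c x - h n x)" for n
      by (intro measurable_imp_set_measurable borel_measurable_diff cF_meas continuous_imp_lebesgue_measurable h_cont) simp
    show "\<bar>?c x - h n x\<bar> \<le> \<bar>2 * real M\<bar>" for n x
      using clamp_real_bounds(1)[of "real M" "F x"] h_bound[of n x] by simp
    have "AE x in lebesgue. x \<notin> N"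
      using N by (simp add: negligible_iff_null_sets AE_not_in)
    then show "AE x in lebesgue. x \<in> ?S \<longrightarrow> (\<lambda>n. ?c x - h n x) \<longlonglongrightarrow> 0"
    proof (eventually_elim, intro impI)
      fix x assume "x \<notin> N" "x \<in> ?S"
      have "(\<lambda>n. clamp_real (real M) (g n x)) \<longlonglongrightarrow> ?c x"
        by (rule continuous_on_tendsto_compose[OF clamp_real_continuous g(2)[OF \<open>x \<notin> N\<close>]]) auto
      moreover have "(\<lambda>n. cutoff P n x) \<longlonglongrightarrow> 1"
        using \<open>x \<in> ?S\<close> by (intro cutoff_tendsto) auto
      ultimately have "(\<lambda>n. ?c x - h n x) \<longlonglongrightarrow> ?c x - 1 * ?c x"
        unfolding h_def by (intro tendsto_intros)
      then show "(\<lambda>n. ?c x - h n x) \<longlonglongrightarrow> 0" by simp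
    qed
  qed
  have "eventually (\<lambda>n. (LINT x:?S|lebesgue. (?c x - h n x)\<^sup>2) < e / 4) sequentially"
    using e by (intro order_tendstoD(2)[OF 2]) simp
  then obtain n where n: "(LINT x:?S|lebesgue. (?c x - h n x)\<^sup>2) < e / 4"
    unfolding eventually_sequentially by blast
  have "?c \<in> L2_space ?S"
    using clamp_real_bounds(1)[of "real M"] cF_meas
    by (intro L2_bounded[of _ _ "real M"] measurable_imp_set_measurable) auto
  from L2_triangle_square[OF f this L2_continuous[OF h_cont[of n]]] M n
  have "(LINT x:?S|lebesgue. (f x - h n x)\<^sup>2) < e"
    by linarith
  moreover have "x \<in> {1 / real (Suc n) .. P - 1 / real (Suc n)}" if "h n x \<noteq> 0" for x
    using that by (intro cutoff_support) (auto simp: h_def)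
  ultimately show thesis
    by (intro that[OF h_cont[of n], of "1 / real (Suc n)"]) auto
qed

lemma L2_trig_approx:
  assumes P: "P > 0" and f: "f \<in> L2_space {0<..<P}" and e: "e > 0"
  obtains F b where "finite F" "(LINT x:{0<..<P}|lebesgue. (cmod (of_real (f x) - (\<Sum>n\<in>F. b n * trig P n x)))\<^sup>2) < e"
proof -
  let ?S = "{0<..<P}"
  obtain h \<delta> where h: "continuous_on UNIV h" "\<delta> > 0" "\<And>x. h x \<noteq> 0 \<Longrightarrow> x \<in> {\<delta>..P - \<delta>}"
    "(LINT x:?S|lebesgue. (f x - h x)\<^sup>2) < e / 4"
    using L2_continuous_approx[OF P f, of "e / 4"] e by auto
  define r where "r = sqrt (e / (4 * P))"
  have r: "r > 0" "r\<^sup>2 = e / (4 * P)"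
    using e P by (simp_all add: r_def)
  obtain g where g: "g \<in> trig_polys P" "\<And>x. x \<in> ?S \<Longrightarrow> cmod (of_real (h x) - g x) \<le> r"
    using continuous_trig_approx[OF P h(1,2,3) r(1)] by auto
  obtain F b where F: "finite F" "g = (\<lambda>x. \<Sum>n\<in>F. b n * trig P n x)"
    using g(1) by (auto simp: trig_polys_def)
  have g_cont: "continuous_on UNIV g"
    unfolding F(2) by (intro continuous_intros trig_continuous)
  have fh: "set_integrable lebesgue ?S (\<lambda>x. (f x - h x)\<^sup>2)"
    using L2_diff[OF f L2_continuous[OF h(1)]] by (simp add: L2_space_def)
  have c: "set_integrable lebesgue ?S (\<lambda>x. r\<^sup>2)"
    by (rule set_integral_const_lmeasurable(1)) simp
  have "(LINT x:?S|lebesgue. (cmod (of_real (f x) - g x))\<^sup>2) \<le> (LINT x:?S|lebesgue. 2 * (f x - h x)\<^sup>2 + 2 * r\<^sup>2)"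
  proof (cases "set_integrable lebesgue ?S (\<lambda>x. (cmod (of_real (f x) - g x))\<^sup>2)")
    case True
    show ?thesis
    proof (rule set_integral_mono[OF True])
      show "set_integrable lebesgue ?S (\<lambda>x. 2 * (f x - h x)\<^sup>2 + 2 * r\<^sup>2)"
        using fh c by (intro set_integral_add set_integrable_mult_right) auto
      fix x assume "x \<in> ?S"
      have "cmod (of_real (f x) - g x) \<le> \<bar>f x - h x\<bar> + cmod (of_real (h x) - g x)"
      proof -
        have "of_real (f x) - g x = of_real (f x - h x) + (of_real (h x) - g x)"
          by simp
        then show ?thesis
          using norm_triangle_ineq[of "of_real (f x - h x)" "of_real (h x) - g x"] by (simp only: norm_of_real)
      qed
      with g(2)[OF \<open>x \<in> ?S\<close>] have "cmod (of_real (f x) - g x) \<le> \<bar>f x - h x\<bar> + r"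
        by linarith
      then have "(cmod (of_real (f x) - g x))\<^sup>2 \<le> (\<bar>f x - h x\<bar> + r)\<^sup>2"
        by (intro power_mono) auto
      also have "\<dots> \<le> 2 * (f x - h x)\<^sup>2 + 2 * r\<^sup>2"
      proof -
        have "(a + r)\<^sup>2 \<le> 2 * a\<^sup>2 + 2 * r\<^sup>2" for a
          using zero_le_power2[of "a - r"] by (simp add: power2_eq_square algebra_simps)
        from this[of "\<bar>f x - h x\<bar>"] show ?thesis by simp
      qed
      finally show "(cmod (of_real (f x) - g x))\<^sup>2 \<le> 2 * (f x - h x)\<^sup>2 + 2 * r\<^sup>2" .
    qed
  next
    case False
    then have "(LINT x:?S|lebesgue. (cmod (of_real (f x) - g x))\<^sup>2) = 0"
      by (simp add: set_integrable_def set_lebesgue_integral_def not_integrable_integral_eq)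
    then show ?thesis
      by (auto simp: set_lebesgue_integral_def intro!: integral_nonneg_AE)
  qed
  also have "\<dots> = (LINT x:?S|lebesgue. 2 * (f x - h x)\<^sup>2) + (LINT x:?S|lebesgue. 2 * r\<^sup>2)"
    by (rule set_integral_add(2)) (intro set_integrable_mult_right fh c)+
  also have "\<dots> = 2 * (LINT x:?S|lebesgue. (f x - h x)\<^sup>2) + 2 * (LINT x:?S|lebesgue. r\<^sup>2)"
    by (simp only: set_integral_mult_right)
  also have "(LINT x:?S|lebesgue. r\<^sup>2) = e / 4"
    using P r(2) by (simp add: set_integral_const_lmeasurable(2))
  finally have "(LINT x:?S|lebesgue. (cmod (of_real (f x) - g x))\<^sup>2) < e"
    using h(4) by linarith
  with F show thesis
    by (intro that[of F b]) auto
qed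

text \<open>Bessel's inequality bounds the partial sums from above; the density of trigonometric polynomials and
the best approximation property bound them from below.\<close>

lemma parseval:
  assumes P: "P > 0" and f: "f \<in> L2_space {0<..<P}"
  shows "(\<lambda>n. (cmod (fourier_coeff P f n))\<^sup>2) summable_on UNIV"
    and "(\<Sum>\<^sub>\<infinity>n. (cmod (fourier_coeff P f n))\<^sup>2) = P * (LINT x:{0<..<P}|lebesgue. (f x)\<^sup>2)"
proof -
  let ?c = "\<lambda>n. (cmod (fourier_coeff P f n))\<^sup>2"
  let ?N = "LINT x:{0<..<P}|lebesgue. (f x)\<^sup>2"
  have bessel: "sum ?c F \<le> P * ?N" if "finite F" for F
  proof -
    have "0 \<le> (LINT x:{0<..<P}|lebesgue. (cmod (of_real (f x) - (\<Sum>n\<in>F. (fourier_coeff P f n / of_real P) * trig P n x)))\<^sup>2)"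
      by (auto simp: set_lebesgue_integral_def intro!: integral_nonneg_AE)
    also have "\<dots> = ?N - sum ?c F / P"
      by (subst square_distance_trig_sum[OF P f that]) simp
    finally show ?thesis
      using P by (simp add: field_simps)
  qed
  show summable: "?c summable_on UNIV"
    by (rule nonneg_bdd_above_summable_on) (use bessel in \<open>auto intro!: bdd_aboveI\<close>)
  have "infsum ?c UNIV \<le> P * ?N"
    by (rule infsum_le_finite_sums[OF summable]) (use bessel in auto)
  moreover have "P * ?N \<le> infsum ?c UNIV"
  proof (rule field_le_epsilon)
    fix e :: real assume e: "e > 0"
    then have "e / P > 0" using P by simp
    obtain F b where F: "finite F" "(LINT x:{0<..<P}|lebesgue. (cmod (of_real (f x) - (\<Sum>n\<in>F. b n * trig P n x)))\<^sup>2) < e / P"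
      using L2_trig_approx[OF P f \<open>e / P > 0\<close>] by blast
    have "0 \<le> P * (\<Sum>n\<in>F. (cmod (b n - fourier_coeff P f n / of_real P))\<^sup>2)"
      using P by (intro mult_nonneg_nonneg sum_nonneg) auto
    with F(2) have "?N - sum ?c F / P < e / P"
      unfolding square_distance_trig_sum[OF P f F(1)] by linarith
    from mult_strict_left_mono[OF this P] have "P * ?N < sum ?c F + e"
      using P by (simp add: right_diff_distrib)
    also have "sum ?c F \<le> infsum ?c UNIV"
      by (rule finite_sum_le_infsum[OF summable F(1)]) auto
    finally show "P * ?N \<le> infsum ?c UNIV + e" by simp
  qed
  ultimately show "infsum ?c UNIV = P * ?N" by simp
qed

section \<open>Pairings with exponentials\<close>

text \<open>Integrals against exponentials of arbitrary frequency: the two halves of the extended data are seen with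
different frequencies.\<close>

definition exp_pairing :: "real \<Rightarrow> (real \<Rightarrow> real) \<Rightarrow> real \<Rightarrow> complex" where
  "exp_pairing L f \<omega> = (LINT y:{0<..<L}|lebesgue. of_real (f y) * cis (\<omega> * y))"

lemma cis_continuous: "continuous_on UNIV (\<lambda>y. cis (\<omega> * y))"
  unfolding cis_conv_exp by (intro continuous_intros)

lemma exp_pairing_integral:
  assumes "f \<in> L2_space {0<..<L}"
  shows "has_bochner_integral lebesgue (\<lambda>y. indicator {0<..<L} y *\<^sub>R (of_real (f y) * cis (\<omega> * y))) (exp_pairing L f \<omega>)"
  using L2_complex_integrable[OF assms cis_continuous, where C = 1]
  by (simp add: has_bochner_integral_iff exp_pairing_def set_integrable_def set_lebesgue_integral_def)

lemma exp_pairing_Re: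
  assumes f: "f \<in> L2_space {0<..<L}"
  shows "has_bochner_integral lebesgue (\<lambda>y. indicator {0<..<L} y *\<^sub>R (f y * cos (\<omega> * y + \<theta>))) (Re (cis \<theta> * exp_pairing L f \<omega>))"
proof -
  have "has_bochner_integral lebesgue (\<lambda>y. Re (cis \<theta> * (indicator {0<..<L} y *\<^sub>R (of_real (f y) * cis (\<omega> * y)))))
      (Re (cis \<theta> * exp_pairing L f \<omega>))"
    by (intro has_bochner_integral_bounded_linear[OF bounded_linear_Re] has_bochner_integral_mult_right exp_pairing_integral f)
  moreover have "Re (cis \<theta> * (indicator {0<..<L} y *\<^sub>R (of_real (f y) * cis (\<omega> * y)))) =
      indicator {0<..<L} y *\<^sub>R (f y * cos (\<omega> * y + \<theta>))" for y
    by (simp add: cos_add algebra_simps)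
  ultimately show ?thesis by (simp only:)
qed

text \<open>Real weights of arbitrary phase determine a complex pairing.\<close>

lemma complex_eq_rotated_Re:
  assumes "\<And>\<theta>. Re (cis \<theta> * z) = Re (cis \<theta> * w)"
  shows "z = w"
  using assms[of 0] assms[of "- (pi / 2)"] by (simp add: complex_eq_iff)

section \<open>Energy and Fourier coefficients of the extended data\<close>

text \<open>Data \<open>a\<close> (space derivative) and \<open>b\<close> (velocity) on \<open>(0, L)\<close>, taken at any fixed time in the moving frame,
and their extension \<open>h\<close> to one period \<open>P\<close>. On the left part \<open>h\<close> is \<open>a + b\<close>; on the right part it is
a reflected, stretched and rescaled copy of \<open>a - b\<close>, the component travelling to the right.\<close>

locale extension =
  fixes L v :: real and a b :: "real \<Rightarrow> real"
  assumes L: "L > 0" and v: "0 < v" "v < 1"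
    and a: "a \<in> L2_space {0<..<L}" and b: "b \<in> L2_space {0<..<L}"
begin

definition "\<gamma> = gamma_v v"
definition "P = 2 / (1 - v) * L"
definition "h x = ext_position_deriv L v a x + ext_velocity L v b x"

lemma \<gamma>_pos: "\<gamma> > 0"
  using v by (simp add: \<gamma>_def gamma_v_def)

lemma P_pos: "P > 0"
  using v L by (simp add: P_def)

lemma P_times: "P * (1 - v) = 2 * L"
  using v by (simp add: P_def)

lemma P_split: "P - \<gamma> * L = L" "P / \<gamma> = 2 * L / (1 + v)"
proof -
  have "P - \<gamma> * L = (2 * L - (1 + v) * L) / (1 - v)"
    by (simp add: P_def \<gamma>_def gamma_v_def diff_divide_distrib)
  also have "\<dots> = (1 - v) * L / (1 - v)"
    by (simp add: algebra_simps)
  finally show "P - \<gamma> * L = L"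
    using v by simp
  show "P / \<gamma> = 2 * L / (1 + v)"
    using v by (simp add: P_def \<gamma>_def gamma_v_def)
qed

lemma L_less_P: "L < P"
proof -
  have "\<gamma> * L > 0"
    using \<gamma>_pos L by simp
  with P_split(1) show ?thesis by linarith
qed

lemma divide_P: "x / P = x * (1 - v) / (2 * L)"
  by (simp add: P_def)

lemma h_left: "x < L \<Longrightarrow> h x = a x + b x"
  by (simp add: h_def ext_position_deriv_def ext_velocity_def)

lemma h_right:
  assumes "y \<in> {0<..<L}"
  shows "h (P - \<gamma> * y) = (a y - b y) / \<gamma>"
proof -
  have "\<gamma> * y < \<gamma> * L"
    using assms \<gamma>_pos by simp
  then have "\<not> P - \<gamma> * y < L"
    using P_split(1) by simp
  moreover have "- (P - \<gamma> * y) / \<gamma> = y - P / \<gamma>"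
    using \<gamma>_pos by (simp add: field_simps)
  then have "- (P - \<gamma> * y) / \<gamma> + 2 * L / (1 + v) = y"
    by (simp add: P_split(2))
  ultimately show ?thesis
    by (simp add: h_def ext_position_deriv_def ext_velocity_def \<gamma>_def[symmetric] diff_divide_distrib)
qed

text \<open>The part beyond \<open>L\<close> is the image of \<open>(0, L)\<close> under \<open>y \<mapsto> P - \<gamma> y\<close>.\<close>

lemma extension_integral:
  fixes F :: "real \<Rightarrow> 'b::euclidean_space"
  assumes l: "set_integrable lebesgue {0<..<L} F" and r: "set_integrable lebesgue {0<..<L} (\<lambda>y. F (P - \<gamma> * y))"
  shows "set_integrable lebesgue {0<..<P} F"
    "(LINT x:{0<..<P}|lebesgue. F x) =
      (LINT y:{0<..<L}|lebesgue. F y) + \<gamma> *\<^sub>R (LINT y:{0<..<L}|lebesgue. F (P - \<gamma> * y))"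
proof -
  have mem: "y \<in> {0<..<L} \<longleftrightarrow> P - \<gamma> * y \<in> {L<..<P}" for y
  proof -
    have "L < P - \<gamma> * y \<longleftrightarrow> \<gamma> * y < \<gamma> * L"
      using P_split(1) by linarith
    then show ?thesis
      using \<gamma>_pos by (auto simp: zero_less_mult_iff)
  qed
  have r': "set_integrable lebesgue {L<..<P} F"
    and r_eq: "(LINT x:{L<..<P}|lebesgue. F x) = \<gamma> *\<^sub>R (LINT y:{0<..<L}|lebesgue. F (P - \<gamma> * y))"
    using set_integral_affine[of "- \<gamma>" "{0<..<L}" P "{L<..<P}" F] mem r \<gamma>_pos by auto
  have U: "set_integrable lebesgue ({0<..<L} \<union> {L<..<P}) F"
    by (rule set_integrable_Un[OF l r']) auto
  have diff: "({0<..<L} \<union> {L<..<P}) - {0<..<P} \<union> ({0<..<P} - ({0<..<L} \<union> {L<..<P})) \<subseteq> {L}"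
    using L_less_P L by auto
  show "set_integrable lebesgue {0<..<P} F"
    using U set_integrable_discrete_difference[OF _ diff, of lebesgue F] by simp
  have "(LINT x:{0<..<P}|lebesgue. F x) = (LINT x:{0<..<L} \<union> {L<..<P}|lebesgue. F x)"
    using set_integral_discrete_difference[OF _ diff, of lebesgue F] by simp
  also have "\<dots> = (LINT x:{0<..<L}|lebesgue. F x) + (LINT x:{L<..<P}|lebesgue. F x)"
    by (rule set_integral_Un[OF _ l r']) auto
  finally show "(LINT x:{0<..<P}|lebesgue. F x) =
      (LINT y:{0<..<L}|lebesgue. F y) + \<gamma> *\<^sub>R (LINT y:{0<..<L}|lebesgue. F (P - \<gamma> * y))"
    by (simp add: r_eq)
qed

lemma ab_L2: "(\<lambda>y. a y + b y) \<in> L2_space {0<..<L}" "(\<lambda>y. a y - b y) \<in> L2_space {0<..<L}"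
  by (intro L2_add L2_diff a b)+

lemma L2_set_integrable:
  assumes "f \<in> L2_space {0<..<L}"
  shows "set_integrable lebesgue {0<..<L} f"
  using L2_continuous_integrable[OF assms, of "\<lambda>_. 1"] by simp

lemma h_square:
  "set_integrable lebesgue {0<..<P} (\<lambda>x. (h x)\<^sup>2)"
  "(LINT x:{0<..<P}|lebesgue. (h x)\<^sup>2) =
    (LINT y:{0<..<L}|lebesgue. (a y + b y)\<^sup>2) + 1 / \<gamma> * (LINT y:{0<..<L}|lebesgue. (a y - b y)\<^sup>2)"
proof -
  have l_eq: "(LINT y:{0<..<L}|lebesgue. (h y)\<^sup>2) = (LINT y:{0<..<L}|lebesgue. (a y + b y)\<^sup>2)"
    by (rule set_lebesgue_integral_cong) (auto simp: h_left)
  have r_eq: "(LINT y:{0<..<L}|lebesgue. (h (P - \<gamma> * y))\<^sup>2) = (LINT y:{0<..<L}|lebesgue. (a y - b y)\<^sup>2 / \<gamma>\<^sup>2)"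
    by (rule set_lebesgue_integral_cong) (auto simp: h_right power_divide)
  have l: "set_integrable lebesgue {0<..<L} (\<lambda>y. (h y)\<^sup>2)"
    using ab_L2(1) by (subst set_integrable_cong[where f' = "\<lambda>y. (a y + b y)\<^sup>2", OF refl refl])
      (auto simp: L2_space_def h_left)
  have r: "set_integrable lebesgue {0<..<L} (\<lambda>y. (h (P - \<gamma> * y))\<^sup>2)"
    using ab_L2(2) by (subst set_integrable_cong[where f' = "\<lambda>y. (a y - b y)\<^sup>2 / \<gamma>\<^sup>2", OF refl refl])
      (auto simp: L2_space_def h_right power_divide)
  from extension_integral(1)[OF l r] show "set_integrable lebesgue {0<..<P} (\<lambda>x. (h x)\<^sup>2)" .
  from extension_integral(2)[OF l r] show "(LINT x:{0<..<P}|lebesgue. (h x)\<^sup>2) =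
    (LINT y:{0<..<L}|lebesgue. (a y + b y)\<^sup>2) + 1 / \<gamma> * (LINT y:{0<..<L}|lebesgue. (a y - b y)\<^sup>2)"
    unfolding l_eq r_eq using \<gamma>_pos by (simp add: power2_eq_square)
qed

lemma h_L2: "h \<in> L2_space {0<..<P}"
proof -
  have l: "set_integrable lebesgue {0<..<L} h"
    using L2_set_integrable[OF ab_L2(1)]
    by (subst set_integrable_cong[where f' = "\<lambda>y. a y + b y", OF refl refl]) (auto simp: h_left)
  have r: "set_integrable lebesgue {0<..<L} (\<lambda>y. h (P - \<gamma> * y))"
    using L2_set_integrable[OF ab_L2(2)]
    by (subst set_integrable_cong[where f' = "\<lambda>y. (a y - b y) / \<gamma>", OF refl refl])
      (auto simp: h_right)
  from extension_integral(1)[OF l r] h_square(1) show ?thesis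
    by (auto simp: L2_space_def set_borel_measurable_def set_integrable_def)
qed

text \<open>The energy density is diagonal in the travelling components \<open>a + b\<close> and \<open>a - b\<close>, with weights
\<open>(1 + v) / 2\<close> and \<open>(1 - v) / 2\<close>. The ratio of the weights is exactly the factor \<open>1 / \<gamma>\<close> with which the
reflected part enters the square norm of the extension.\<close>

lemma energy_extension:
  "1 / 2 * (LINT y:{0<..<L}|lebesgue. (b y + v * a y)\<^sup>2 + (1 - v\<^sup>2) * (a y)\<^sup>2)
    = (1 + v) / 4 * (LINT x:{0<..<P}|lebesgue. (h x)\<^sup>2)"
proof -
  have int: "set_integrable lebesgue {0<..<L} (\<lambda>y. (a y + b y)\<^sup>2)" "set_integrable lebesgue {0<..<L} (\<lambda>y. (a y - b y)\<^sup>2)"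
    using ab_L2 by (auto simp: L2_space_def)
  have "(LINT y:{0<..<L}|lebesgue. (b y + v * a y)\<^sup>2 + (1 - v\<^sup>2) * (a y)\<^sup>2)
     = (LINT y:{0<..<L}|lebesgue. (1 + v) / 2 * (a y + b y)\<^sup>2 + (1 - v) / 2 * (a y - b y)\<^sup>2)"
    by (intro arg_cong[where f = "set_lebesgue_integral lebesgue {0<..<L}"] ext)
      (simp add: power2_eq_square field_simps)
  also have "\<dots> = (1 + v) / 2 * (LINT y:{0<..<L}|lebesgue. (a y + b y)\<^sup>2)
      + (1 - v) / 2 * (LINT y:{0<..<L}|lebesgue. (a y - b y)\<^sup>2)"
    using int by (subst set_integral_add) auto
  finally have E: "(LINT y:{0<..<L}|lebesgue. (b y + v * a y)\<^sup>2 + (1 - v\<^sup>2) * (a y)\<^sup>2) =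
      (1 + v) / 2 * (LINT y:{0<..<L}|lebesgue. (a y + b y)\<^sup>2) + (1 - v) / 2 * (LINT y:{0<..<L}|lebesgue. (a y - b y)\<^sup>2)" .
  have "(1 + v) * (1 / \<gamma>) = 1 - v"
    using v by (simp add: \<gamma>_def gamma_v_def)
  then have "(1 + v) / 4 * (A + 1 / \<gamma> * B) = (1 + v) / 4 * A + (1 - v) / 4 * B" for A B
    by (metis (no_types, lifting) distrib_left mult.assoc times_divide_eq_left)
  then show ?thesis
    unfolding h_square(2) E by simp
qed

text \<open>A Fourier mode on the period \<open>P\<close> becomes, after the reflection, a mode on \<open>(0, L)\<close> with frequency
proportional to \<open>1 + v\<close> instead of \<open>1 - v\<close>: these are the frequencies of the two travelling waves in the
conserved quantity.\<close>

lemma fourier_coeff_extension: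
  fixes n :: int
  defines "\<kappa> \<equiv> of_int n * pi / L"
  shows "cnj (fourier_coeff P h n) =
    exp_pairing L a (\<kappa> * (1 - v)) + exp_pairing L b (\<kappa> * (1 - v))
    + (exp_pairing L a (- (\<kappa> * (1 + v))) - exp_pairing L b (- (\<kappa> * (1 + v))))"
proof -
  let ?F = "\<lambda>x. of_real (h x) * trig P n x"
  have trig_l: "trig P n y = cis (\<kappa> * (1 - v) * y)" for y
  proof -
    have "2 * pi * of_int n * y * (1 - v) / (2 * L) = \<kappa> * (1 - v) * y"
      using L by (simp add: \<kappa>_def field_simps)
    then show ?thesis
      by (simp only: trig_def divide_P)
  qed
  have trig_r: "trig P n (P - \<gamma> * y) = cis (- (\<kappa> * (1 + v)) * y)" for y
  proof -
    have "2 * pi * of_int n * (P - \<gamma> * y) / P = 2 * pi * of_int n + (- (2 * pi * of_int n * \<gamma> / P)) * y"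
      using P_pos by (simp add: field_simps)
    also have "2 * pi * of_int n * \<gamma> / P = \<kappa> * (1 + v)"
    proof -
      have "\<gamma> * (1 - v) = 1 + v"
        using v by (simp add: \<gamma>_def gamma_v_def)
      then have "2 * pi * of_int n * \<gamma> * (1 - v) / (2 * L) = 2 * pi * of_int n * (1 + v) / (2 * L)"
        by (simp only: mult.assoc)
      also have "\<dots> = \<kappa> * (1 + v)"
        using L by (simp add: \<kappa>_def field_simps)
      finally show ?thesis
        by (simp only: divide_P)
    qed
    finally have "trig P n (P - \<gamma> * y) = cis (2 * pi * of_int n) * cis (- (\<kappa> * (1 + v)) * y)"
      by (simp only: trig_def cis_mult)
    moreover have "cis (2 * pi * of_int n) = 1"
      by (simp add: complex_eq_iff sin_int_2pin cos_int_2pin)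
    ultimately show ?thesis by simp
  qed
  have hb: "has_bochner_integral lebesgue (\<lambda>y. indicator {0<..<L} y *\<^sub>R (of_real (a y) * cis (\<omega> * y))
       + indicator {0<..<L} y *\<^sub>R (of_real (b y) * cis (\<omega> * y))) (exp_pairing L a \<omega> + exp_pairing L b \<omega>)" 
    "has_bochner_integral lebesgue (\<lambda>y. (1 / of_real \<gamma>) * (indicator {0<..<L} y *\<^sub>R (of_real (a y) * cis (\<omega> * y))
       - indicator {0<..<L} y *\<^sub>R (of_real (b y) * cis (\<omega> * y)))) ((1 / of_real \<gamma>) * (exp_pairing L a \<omega> - exp_pairing L b \<omega>))" for \<omega>
    by (intro has_bochner_integral_add has_bochner_integral_diff has_bochner_integral_mult_right exp_pairing_integral a b)+
  have "indicator {0<..<L} y *\<^sub>R ?F y = indicator {0<..<L} y *\<^sub>R (of_real (a y) * cis (\<kappa> * (1 - v) * y))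
       + indicator {0<..<L} y *\<^sub>R (of_real (b y) * cis (\<kappa> * (1 - v) * y))" for y
    unfolding trig_l by (cases "y \<in> {0<..<L}") (simp_all add: h_left distrib_right)
  with hb(1)[of "\<kappa> * (1 - v)"]
  have l: "has_bochner_integral lebesgue (\<lambda>y. indicator {0<..<L} y *\<^sub>R ?F y)
      (exp_pairing L a (\<kappa> * (1 - v)) + exp_pairing L b (\<kappa> * (1 - v)))"
    by simp
  have "indicator {0<..<L} y *\<^sub>R ?F (P - \<gamma> * y) = (1 / of_real \<gamma>) * (indicator {0<..<L} y *\<^sub>R (of_real (a y) * cis (- (\<kappa> * (1 + v)) * y))
       - indicator {0<..<L} y *\<^sub>R (of_real (b y) * cis (- (\<kappa> * (1 + v)) * y)))" for y
  proof (cases "y \<in> {0<..<L}")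
    case True
    show ?thesis
      unfolding trig_r h_right[OF True] using True by (simp add: diff_divide_distrib left_diff_distrib)
  qed simp
  with hb(2)[of "- (\<kappa> * (1 + v))"]
  have r: "has_bochner_integral lebesgue (\<lambda>y. indicator {0<..<L} y *\<^sub>R ?F (P - \<gamma> * y))
      ((1 / of_real \<gamma>) * (exp_pairing L a (- (\<kappa> * (1 + v))) - exp_pairing L b (- (\<kappa> * (1 + v)))))"
    by (simp only:)
  have "cnj (fourier_coeff P h n) = (LINT x:{0<..<P}|lebesgue. ?F x)"
    using has_bochner_integral_integral_eq[OF fourier_coeff_cnj[OF h_L2]] by (simp add: set_lebesgue_integral_def)
  also have "\<dots> = (LINT y:{0<..<L}|lebesgue. ?F y) + \<gamma> *\<^sub>R (LINT y:{0<..<L}|lebesgue. ?F (P - \<gamma> * y))"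
    using l r by (intro extension_integral) (simp_all only: set_integrable_def has_bochner_integral_iff)
  also have "\<dots> = exp_pairing L a (\<kappa> * (1 - v)) + exp_pairing L b (\<kappa> * (1 - v))
    + (exp_pairing L a (- (\<kappa> * (1 + v))) - exp_pairing L b (- (\<kappa> * (1 + v))))"
    using \<gamma>_pos
    by (simp only: set_lebesgue_integral_def has_bochner_integral_integral_eq[OF l] has_bochner_integral_integral_eq[OF r])
      (simp add: scaleR_conv_of_real)
  finally show ?thesis .
qed

lemma series_coeff_fourier:
  assumes "n \<noteq> 0"
  shows "(cmod (of_int n * series_coeff L v a b n))\<^sup>2 = (cmod (fourier_coeff P h n))\<^sup>2 / (16 * pi\<^sup>2)"
proof -
  have "exp (- (of_int n * of_real pi * \<i> * of_real (1 - v) * of_real x / of_real L)) = trig P (- n) x" for x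
  proof -
    have "2 * pi * of_int (- n) * x / P = - (of_int n * pi * (1 - v) * x / L)"
      using v L by (simp add: P_def field_simps)
    then show ?thesis
      by (simp add: trig_def cis_conv_exp mult_ac)
  qed
  then have "series_coeff L v a b n = 1 / (4 * of_int n * of_real pi * \<i>) * fourier_coeff P h n"
    by (simp add: series_coeff_def fourier_coeff_def P_def h_def)
  then have "of_int n * series_coeff L v a b n = fourier_coeff P h n / (4 * of_real pi * \<i>)"
    using assms by (simp add: field_simps)
  then show ?thesis
    by (simp add: norm_divide norm_mult power_divide power_mult_distrib)
qed

text \<open>The integral of \<open>h\<close> is twice that of \<open>a\<close>. It vanishes, which accounts for the missing index \<open>0\<close>.\<close>

lemma energy_parseval:
  assumes mean: "(LINT y:{0<..<L}|lebesgue. a y) = 0"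
  shows "(\<lambda>n::int. (cmod (of_int n * series_coeff L v a b n))\<^sup>2) summable_on (UNIV - {0})"
    and "1 / 2 * (LINT y:{0<..<L}|lebesgue. (b y + v * a y)\<^sup>2 + (1 - v\<^sup>2) * (a y)\<^sup>2) =
      2 * pi\<^sup>2 * (1 - v\<^sup>2) / L * (\<Sum>\<^sub>\<infinity>n\<in>UNIV - {0::int}. (cmod (of_int n * series_coeff L v a b n))\<^sup>2)"
proof -
  let ?c = "\<lambda>n. (cmod (fourier_coeff P h n))\<^sup>2"
  let ?s = "\<lambda>n. (cmod (of_int n * series_coeff L v a b n))\<^sup>2"
  have "exp_pairing L a 0 = of_real (LINT y:{0<..<L}|lebesgue. a y)"
    by (simp add: exp_pairing_def set_integral_complex_of_real)
  then have zero: "?c 0 = 0"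
    using fourier_coeff_extension[of 0] mean by simp
  note pars = parseval[OF P_pos h_L2]
  have s: "?s n = 1 / (16 * pi\<^sup>2) * ?c n" if "n \<in> UNIV - {0}" for n
    using series_coeff_fourier[of n] that by simp
  have c: "?c summable_on (UNIV - {0})"
    by (rule summable_on_subset_banach[OF pars(1)]) simp
  then have "(\<lambda>n. 1 / (16 * pi\<^sup>2) * ?c n) summable_on (UNIV - {0})"
    by (rule summable_on_cmult_right)
  then show "?s summable_on (UNIV - {0})"
    using s by (subst summable_on_cong[OF s])
  have "infsum ?s (UNIV - {0}) = (\<Sum>\<^sub>\<infinity>n\<in>UNIV - {0}. 1 / (16 * pi\<^sup>2) * ?c n)"
    by (rule infsum_cong[OF s])
  also have "\<dots> = 1 / (16 * pi\<^sup>2) * infsum ?c (UNIV - {0})"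
    by (rule infsum_cmult_right') 
  also have "infsum ?c (UNIV - {0}) = infsum ?c UNIV"
    by (rule infsum_cong_neutral) (use zero in auto)
  also have "\<dots> = P * (LINT x:{0<..<P}|lebesgue. (h x)\<^sup>2)"
    by (rule pars(2))
  finally have inf: "infsum ?s (UNIV - {0}) = 1 / (16 * pi\<^sup>2) * (P * (LINT x:{0<..<P}|lebesgue. (h x)\<^sup>2))" .
  have const: "2 * pi\<^sup>2 * (1 - v\<^sup>2) / L * (1 / (16 * pi\<^sup>2) * (P * I)) = (1 + v) / 4 * I" for I
  proof -
    have "1 - v\<^sup>2 = (1 + v) * (1 - v)"
      by (simp add: power2_eq_square algebra_simps)
    then have "2 * pi\<^sup>2 * (1 - v\<^sup>2) / L * (1 / (16 * pi\<^sup>2) * (P * I)) = (1 + v) * (P * (1 - v)) * I / (8 * L)"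
      by simp
    then show ?thesis
      unfolding P_times using L by simp
  qed
  show "1 / 2 * (LINT y:{0<..<L}|lebesgue. (b y + v * a y)\<^sup>2 + (1 - v\<^sup>2) * (a y)\<^sup>2) =
      2 * pi\<^sup>2 * (1 - v\<^sup>2) / L * infsum ?s (UNIV - {0})"
    unfolding inf energy_extension by (rule const[symmetric])
qed

end

text \<open>In the moving frame both waves oscillate with the same frequency \<open>\<kappa> (1 - v) (1 + v)\<close> in time, so that
the time dependence is a common phase.\<close>

lemma slice_pairing_standing_wave:
  assumes u: "(\<lambda>y. u (y + v * t) t) \<in> L2_space {0<..<L}"
  shows "slice_pairing L v u (standing_wave (\<kappa> * (1 - v)) (\<kappa> * (1 + v)) \<alpha> \<beta> \<theta>) t =
    \<alpha> * Re (cis (\<kappa> * (1 - v) * (1 + v) * t + \<theta>) * exp_pairing L (\<lambda>y. u (y + v * t) t) (\<kappa> * (1 - v))) +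
    \<beta> * Re (cis (\<kappa> * (1 - v) * (1 + v) * t + \<theta>) * exp_pairing L (\<lambda>y. u (y + v * t) t) (- (\<kappa> * (1 + v))))"
proof -
  let ?\<tau> = "\<kappa> * (1 - v) * (1 + v) * t + \<theta>"
  let ?u = "\<lambda>y. u (y + v * t) t"
  have "has_bochner_integral lebesgue (\<lambda>y. \<alpha> * (indicator {0<..<L} y *\<^sub>R (?u y * cos (\<kappa> * (1 - v) * y + ?\<tau>)))
      + \<beta> * (indicator {0<..<L} y *\<^sub>R (?u y * cos (- (\<kappa> * (1 + v)) * y + ?\<tau>))))
    (\<alpha> * Re (cis ?\<tau> * exp_pairing L ?u (\<kappa> * (1 - v))) + \<beta> * Re (cis ?\<tau> * exp_pairing L ?u (- (\<kappa> * (1 + v)))))"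
    by (intro has_bochner_integral_add has_bochner_integral_mult_right exp_pairing_Re u)
  note eq = has_bochner_integral_integral_eq[OF this]
  show ?thesis
  proof (rule trans[OF _ eq])
    have "\<kappa> * (1 - v) * (t + (y + v * t)) + \<theta> = \<kappa> * (1 - v) * y + ?\<tau>"
      "\<kappa> * (1 + v) * (t - (y + v * t)) + \<theta> = - (\<kappa> * (1 + v)) * y + ?\<tau>" for y
      by (simp_all add: algebra_simps)
    then show "slice_pairing L v u (standing_wave (\<kappa> * (1 - v)) (\<kappa> * (1 + v)) \<alpha> \<beta> \<theta>) t =
      (LINT y|lebesgue. \<alpha> * (indicator {0<..<L} y *\<^sub>R (?u y * cos (\<kappa> * (1 - v) * y + ?\<tau>)))
      + \<beta> * (indicator {0<..<L} y *\<^sub>R (?u y * cos (- (\<kappa> * (1 + v)) * y + ?\<tau>))))"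
      unfolding slice_pairing_shift standing_wave_def set_lebesgue_integral_def fst_conv snd_conv
      by (intro Bochner_Integration.integral_cong refl) (simp only: real_scaleR_def distrib_left mult.left_commute mult.assoc)
  qed
qed

section \<open>Conservation of the Fourier moduli and of the energy\<close>

context weak_wave
begin

lemma moving_frame_L2:
  assumes "t \<ge> 0"
  shows "(\<lambda>y. \<phi> (y + v * t) t) \<in> L2_space {0<..<L}" "(\<lambda>y. \<phi>x (y + v * t) t) \<in> L2_space {0<..<L}"
    "(\<lambda>y. \<phi>t (y + v * t) t) \<in> L2_space {0<..<L}"
  by (rule L2_shift, rule slice_L2, rule assms)+

text \<open>Up to a phase depending on time, the Fourier coefficient of the extended data at time \<open>t\<close> is the
conserved quantity for the corresponding standing wave; the phase does not affect the modulus.\<close>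

lemma fourier_coeff_modulus_conserved:
  assumes v: "0 < v" "v < 1" and t: "t \<ge> 0"
  shows "cmod (fourier_coeff (2 / (1 - v) * L)
      (extension.h L v (\<lambda>y. \<phi>x (y + v * t) t) (\<lambda>y. \<phi>t (y + v * t) t)) n) =
    cmod (fourier_coeff (2 / (1 - v) * L)
      (extension.h L v (\<lambda>y. \<phi>x (y + v * 0) 0) (\<lambda>y. \<phi>t (y + v * 0) 0)) n)"
proof -
  define \<kappa> where "\<kappa> = of_int n * pi / L"
  define p q where "p = \<kappa> * (1 - v)" and "q = \<kappa> * (1 + v)"
  define \<tau> where "\<tau> s = p * (1 + v) * s" for s
  define c where "c s = fourier_coeff (2 / (1 - v) * L) (extension.h L v (\<lambda>y. \<phi>x (y + v * s) s) (\<lambda>y. \<phi>t (y + v * s) s)) n" for s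
  have ext: "extension L v (\<lambda>y. \<phi>x (y + v * s) s) (\<lambda>y. \<phi>t (y + v * s) s)" if "s \<ge> 0" for s
    using L v moving_frame_L2[OF that] by unfold_locales
  have A: "SP \<phi>t (standing_wave p q 1 (- 1) \<theta>) s + SP \<phi>x (standing_wave p q 1 1 \<theta>) s =
      Re (cis \<theta> * (cis (\<tau> s) * cnj (c s)))" if s: "s \<ge> 0" for s \<theta>
  proof -
    let ?X = "exp_pairing L (\<lambda>y. \<phi>x (y + v * s) s)" and ?T = "exp_pairing L (\<lambda>y. \<phi>t (y + v * s) s)"
    have c: "cnj (c s) = ?X p + ?T p + (?X (- q) - ?T (- q))"
      unfolding c_def using extension.fourier_coeff_extension[OF ext[OF s], of n] extension.P_def[OF ext[OF s]]
      by (simp only: \<kappa>_def p_def q_def)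
    have X: "SP \<phi>x (standing_wave p q 1 1 \<theta>) s = Re (cis (\<tau> s + \<theta>) * ?X p) + Re (cis (\<tau> s + \<theta>) * ?X (- q))"
      using slice_pairing_standing_wave[where u = \<phi>x and t = s, OF moving_frame_L2(2)[OF s], of \<kappa> 1 1 \<theta>]
      by (simp only: p_def q_def \<tau>_def mult_1)
    have T: "SP \<phi>t (standing_wave p q 1 (- 1) \<theta>) s = Re (cis (\<tau> s + \<theta>) * ?T p) - Re (cis (\<tau> s + \<theta>) * ?T (- q))"
      using slice_pairing_standing_wave[where u = \<phi>t and t = s, OF moving_frame_L2(3)[OF s], of \<kappa> 1 "- 1" \<theta>]
      by (simp only: p_def q_def \<tau>_def mult_1 mult_minus1 add_uminus_conv_diff)
    have "cis \<theta> * (cis (\<tau> s) * z) = cis (\<tau> s + \<theta>) * z" for z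
      by (simp add: cis_mult[symmetric] mult_ac)
    then have "Re (cis \<theta> * (cis (\<tau> s) * cnj (c s))) =
        Re (cis (\<tau> s + \<theta>) * ?X p) + Re (cis (\<tau> s + \<theta>) * ?T p) +
        (Re (cis (\<tau> s + \<theta>) * ?X (- q)) - Re (cis (\<tau> s + \<theta>) * ?T (- q)))"
      by (simp only: c distrib_left right_diff_distrib plus_complex.sel minus_complex.sel)
    then show ?thesis
      unfolding X T by linarith
  qed
  have "Re (cis \<theta> * (cis (\<tau> t) * cnj (c t))) = Re (cis \<theta> * (cis (\<tau> 0) * cnj (c 0)))" for \<theta>
    using conserved_quantity[OF t, of n \<theta>] unfolding \<kappa>_def[symmetric] p_def[symmetric] q_def[symmetric] by (simp only: A[OF t] A[OF order_refl])
  then have "cis (\<tau> t) * cnj (c t) = cis (\<tau> 0) * cnj (c 0)"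
    by (rule complex_eq_rotated_Re)
  then have "cmod (cis (\<tau> t) * cnj (c t)) = cmod (cis (\<tau> 0) * cnj (c 0))"
    by (rule arg_cong)
  then show ?thesis
    by (simp add: norm_mult c_def)
qed

lemma moving_mean_zero:
  assumes "t \<ge> 0"
  shows "(LINT y:{0<..<L}|lebesgue. \<phi>x (y + v * t) t) = 0"
proof -
  have "smooth_weight (\<lambda>_. 1) (\<lambda>_. 0) (\<lambda>_. 0) 1"
    by unfold_locales (auto intro: Ck_const)
  from slice_by_parts[OF this assms] show ?thesis
    by (simp add: slice_pairing_shift)
qed

lemma energy_moving_frame:
  "energy L v \<phi>x \<phi>t t = 1 / 2 * (LINT y:{0<..<L}|lebesgue.
     (\<phi>t (y + v * t) t + v * \<phi>x (y + v * t) t)\<^sup>2 + (1 - v\<^sup>2) * (\<phi>x (y + v * t) t)\<^sup>2)"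
  unfolding energy_def
  by (subst set_integral_affine(2)[of 1 "{0<..<L}" "v * t"]) (auto simp: moving_interval_def add.commute)

text \<open>The coefficients see \<open>\<phi>0x\<close> only through integrals against smooth functions. These are determined by
\<open>\<phi>0\<close> by integration by parts, so that any two weak derivatives give the same coefficients.\<close>

lemma initial_fourier_coeff:
  assumes v: "0 < v" "v < 1"
    and \<phi>0: "\<phi>0 \<in> H10_space (I 0)" "H1_deriv (I 0) \<phi>0 \<phi>0x" and \<phi>1: "\<phi>1 \<in> L2_space (I 0)"
  shows "fourier_coeff (2 / (1 - v) * L) (extension.h L v \<phi>0x \<phi>1) n =
    fourier_coeff (2 / (1 - v) * L) (extension.h L v (\<lambda>y. \<phi>x (y + v * 0) 0) (\<lambda>y. \<phi>t (y + v * 0) 0)) n"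
proof -
  have I0: "I 0 = {0<..<L}"
    by (simp add: moving_interval_def)
  have L2: "\<phi>0x \<in> L2_space {0<..<L}" "\<phi>1 \<in> L2_space {0<..<L}"
    using \<phi>0(2) \<phi>1 by (auto simp: I0 H1_deriv_def)
  note L2' = moving_frame_L2[of 0, simplified]
  interpret e: extension L v \<phi>0x \<phi>1
    using L v L2 by unfold_locales
  interpret e': extension L v "\<lambda>y. \<phi>x y 0" "\<lambda>y. \<phi>t y 0"
    using L v L2' by unfold_locales
  have init: "AE x in lebesgue. x \<in> {0<..<L} \<longrightarrow> \<phi> x 0 = \<phi>0 x" "AE x in lebesgue. x \<in> {0<..<L} \<longrightarrow> \<phi>t x 0 = \<phi>1 x"
    using sol by (auto simp: weak_wave_solution_def I0)
  have eqI: "exp_pairing L f \<omega> = exp_pairing L g \<omega>" if fg: "f \<in> L2_space {0<..<L}" "g \<in> L2_space {0<..<L}"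
    and eq: "\<And>\<theta>. (LINT y:{0<..<L}|lebesgue. f y * cos (\<omega> * y + \<theta>)) = (LINT y:{0<..<L}|lebesgue. g y * cos (\<omega> * y + \<theta>))" for f g \<omega>
    using has_bochner_integral_integral_eq[OF exp_pairing_Re[OF fg(1)]] has_bochner_integral_integral_eq[OF exp_pairing_Re[OF fg(2)]] eq
    by (intro complex_eq_rotated_Re) (simp add: set_lebesgue_integral_def)
  have cong: "(LINT y:{0<..<L}|lebesgue. f y * k y) = (LINT y:{0<..<L}|lebesgue. g y * k y)"
    if fg: "f \<in> L2_space {0<..<L}" "g \<in> L2_space {0<..<L}" and k: "continuous_on UNIV k"
      and ae: "AE y in lebesgue. y \<in> {0<..<L} \<longrightarrow> f y = g y" for f g k :: "real \<Rightarrow> real"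
    unfolding set_lebesgue_integral_def
  proof (rule integral_cong_AE)
    show "AE y in lebesgue. indicator {0<..<L} y *\<^sub>R (f y * k y) = indicator {0<..<L} y *\<^sub>R (g y * k y)"
      using ae by eventually_elim (auto simp: indicator_def)
  qed (use L2_continuous_integrable[OF fg(1) k] L2_continuous_integrable[OF fg(2) k] in \<open>auto simp: set_integrable_def\<close>)
  have "exp_pairing L \<phi>1 \<omega> = exp_pairing L (\<lambda>y. \<phi>t y 0) \<omega>" for \<omega>
    by (intro eqI cong L2 L2' continuous_intros) (use init in \<open>auto elim: eventually_mono\<close>)
  moreover have "exp_pairing L \<phi>0x \<omega> = exp_pairing L (\<lambda>y. \<phi>x y 0) \<omega>" for \<omega>
  proof (intro eqI L2 L2')
    fix \<theta>
    let ?g = "\<lambda>y. cos (\<omega> * y + \<theta>)"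
    have g: "Ck k ?g" for k
      by (intro Ck_cos_affine bounded_linear_const_mult bounded_linear_ident)
    have sol0: "(\<lambda>x. \<phi> x 0) \<in> H10_space {0<..<L}" "H1_deriv {0<..<L} (\<lambda>x. \<phi> x 0) (\<lambda>x. \<phi>x x 0)"
      using sol by (auto simp: weak_wave_solution_def I0[symmetric])
    have "(LINT y:{0<..<L}|lebesgue. \<phi>0x y * ?g y) = - (LINT y:{0<..<L}|lebesgue. \<phi>0 y * deriv ?g y)"
      by (rule H10_integral_by_parts[OF _ _ g L]) (use \<phi>0 in \<open>simp_all add: I0\<close>)
    also have "(LINT y:{0<..<L}|lebesgue. \<phi>0 y * deriv ?g y) = (LINT y:{0<..<L}|lebesgue. \<phi> y 0 * deriv ?g y)"
      using \<phi>0(2) init(1) by (intro cong L2' Ck_deriv(4)[OF g]) (auto simp: I0 H1_deriv_def elim: eventually_mono)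
    also have "- \<dots> = (LINT y:{0<..<L}|lebesgue. \<phi>x y 0 * ?g y)"
      by (rule H10_integral_by_parts[OF sol0 g L, symmetric])
    finally show "(LINT y:{0<..<L}|lebesgue. \<phi>0x y * ?g y) = (LINT y:{0<..<L}|lebesgue. \<phi>x y 0 * ?g y)" .
  qed
  ultimately have "cnj (fourier_coeff e.P e.h n) = cnj (fourier_coeff e'.P e'.h n)"
    unfolding e.fourier_coeff_extension e'.fourier_coeff_extension by simp
  then show ?thesis
    by (simp add: e.P_def e'.P_def)
qed

end

theorem theorem2:
  fixes L v :: real
    and \<phi>0 \<phi>0x \<phi>1 :: "real \<Rightarrow> real"
    and \<phi> \<phi>x \<phi>t :: "real \<Rightarrow> real \<Rightarrow> real"
  assumes "L > 0" and "0 < v" and "v < 1"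
    and "\<phi>0 \<in> H10_space (moving_interval L v 0)"
    and "H1_deriv (moving_interval L v 0) \<phi>0 \<phi>0x"
    and "\<phi>1 \<in> L2_space (moving_interval L v 0)"
    and "weak_wave_solution L v \<phi>0 \<phi>1 \<phi> \<phi>x \<phi>t"
  shows "(\<lambda>n::int. (cmod (of_int n * series_coeff L v \<phi>0x \<phi>1 n))\<^sup>2) summable_on (UNIV - {0}) \<and>
         (\<forall>t\<ge>0. energy L v \<phi>x \<phi>t t =
            2 * pi\<^sup>2 * (1 - v\<^sup>2) / L *
            (\<Sum>\<^sub>\<infinity>n\<in>UNIV - {0::int}. (cmod (of_int n * series_coeff L v \<phi>0x \<phi>1 n))\<^sup>2)) \<and>
         (\<forall>s\<ge>0. \<forall>t\<ge>0. energy L v \<phi>x \<phi>t s = energy L v \<phi>x \<phi>t t)"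
proof -
  interpret weak_wave L v \<phi>0 \<phi>1 \<phi> \<phi>x \<phi>t
    using assms by unfold_locales
  let ?a = "\<lambda>t y. \<phi>x (y + v * t) t" and ?b = "\<lambda>t y. \<phi>t (y + v * t) t"
  let ?s = "\<lambda>a b n. (cmod (of_int n * series_coeff L v a b n))\<^sup>2"
  have ext: "extension L v (?a t) (?b t)" if "t \<ge> 0" for t
    using assms(1-3) moving_frame_L2[OF that] by unfold_locales
  have ext0: "extension L v \<phi>0x \<phi>1"
    using assms(1-6) by unfold_locales (auto simp: moving_interval_def H1_deriv_def)
  have same: "?s (?a t) (?b t) n = ?s \<phi>0x \<phi>1 n" if "t \<ge> 0" "n \<in> UNIV - {0}" for t n
    using that fourier_coeff_modulus_conserved[OF assms(2,3) that(1), of n] initial_fourier_coeff[OF assms(2-6), of n]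
    by (simp only: Diff_iff singleton_iff extension.series_coeff_fourier[OF ext] extension.series_coeff_fourier[OF ext0]
       extension.P_def[OF ext] extension.P_def[OF ext0] not_False_eq_True)
  have summable: "?s \<phi>0x \<phi>1 summable_on (UNIV - {0})"
    using extension.energy_parseval(1)[OF ext[OF order_refl] moving_mean_zero[OF order_refl]]
    by (subst (asm) summable_on_cong[OF same[OF order_refl]])
  have energy: "energy L v \<phi>x \<phi>t t = 2 * pi\<^sup>2 * (1 - v\<^sup>2) / L * infsum (?s \<phi>0x \<phi>1) (UNIV - {0})" if "t \<ge> 0" for t
    unfolding energy_moving_frame extension.energy_parseval(2)[OF ext[OF that] moving_mean_zero[OF that]]
    by (subst infsum_cong[OF same[OF that]]) simp_all
  show ?thesis
    using summable energy by simp
qed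

end
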